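(* Let $K$ be an algebraically closed field with characteristic exponent $p$, and let $d$ be a nonnegative integer that is not of the form $c\cdot p^k$ with $c\in\{0,1,2\}$ and $k\in\mathbb{Z}_{\ge 0}$. For each $n\ge 1$ let $Q_s(n)$ denote the generic symmetric subrank of elements of $S^dV$, where $V$ is an $n$-dimensional $K$-vector space. Then \[ \lim_{n\to\infty}\frac{Q_s(n)}{(d!\cdot n)^{1/(d-1)}}=1 . \]
   Context: The characteristic exponent of $K$ is $1$ if $\operatorname{char}K=0$ and $\operatorname{char}K$ otherwise. $S^dV$ is the $d$-th symmetric power of $V$ (quotient of $V^{\otimes d}$ by the span of all $T-\sigma(T)$, $\sigma\in S_d$). A linear map $\varphi:V\to W$ acts by $\varphi(v_1\cdots v_d)=(\varphi v_1)\cdots(\varphi v_d)$, giving a linear map $S^dV\to S^dW$. The $r$-th unit tensor is $I_r=e_1^d+\dots+e_r^d\in S^dK^r$, with $e_1,\dots,e_r$ the standard basis of $K^r$. The symmetric subrank of $f\in S^dV$ is $Q_s(f)=\max\{r\mid \exists \text{ linear } \varphi:V\to K^r \text{ with } \varphi f=I_r\}$. The generic symmetric subrank $Q_s(n)$ is the unique $r$ such that $Q_s(f)=r$ for all $f$ in some Zariski-dense open subset of $S^dV$ (such $r$ exists and depends only on $n,d,K$). *)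

theory Defs
  imports
    "HOL-Analysis.Analysis"
    "HOL-Computational_Algebra.Polynomial"
    "HOL-Combinatorics.Permutations"
    "HOL-Library.Function_Algebras"
begin

section \<open>The space \<open>K\<^sup>n\<close> and its tensor powers\<close>

definition fscale :: "'a::field \<Rightarrow> ('i \<Rightarrow> 'a) \<Rightarrow> 'i \<Rightarrow> 'a" where
  "fscale c f = (\<lambda>i. c * f i)"

interpretation fun_vs: vector_space "fscale :: 'a::field \<Rightarrow> ('i \<Rightarrow> 'a) \<Rightarrow> 'i \<Rightarrow> 'a"
  by unfold_locales (simp_all add: fscale_def fun_eq_iff algebra_simps)

text \<open>
  Since \<open>n\<close> has to vary, \<open>K\<^sup>n\<close> is the space of functions on \<open>nat\<close> supported on \<open>{..<n}\<close>.
  A tensor in \<open>(K\<^sup>n)\<^sup>\<otimes>\<^sup>d\<close> is given by its coordinates, a function on the lists of length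
  \<open>d\<close> with entries below \<open>n\<close> (extended by \<open>0\<close> to all lists).
\<close>

definition Kn :: "nat \<Rightarrow> (nat \<Rightarrow> 'a::field) set" where
  "Kn n = {v. \<forall>i\<ge>n. v i = 0}"

definition basis_vec :: "nat \<Rightarrow> nat \<Rightarrow> 'a::field" where
  "basis_vec i = (\<lambda>j. if j = i then 1 else 0)"

definition linear_maps :: "nat \<Rightarrow> nat \<Rightarrow> ((nat \<Rightarrow> 'a::field) \<Rightarrow> nat \<Rightarrow> 'a) set" where
  "linear_maps n r = {\<phi>. (\<forall>v\<in>Kn n. \<phi> v \<in> Kn r) \<and>
     (\<forall>u\<in>Kn n. \<forall>v\<in>Kn n. \<phi> (u + v) = \<phi> u + \<phi> v) \<and>
     (\<forall>c. \<forall>v\<in>Kn n. \<phi> (fscale c v) = fscale c (\<phi> v))}"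

definition multi_indices :: "nat \<Rightarrow> nat \<Rightarrow> nat list set" where
  "multi_indices n d = {is. length is = d \<and> set is \<subseteq> {..<n}}"

definition tensors :: "nat \<Rightarrow> nat \<Rightarrow> (nat list \<Rightarrow> 'a::field) set" where
  "tensors n d = {T. \<forall>is. is \<notin> multi_indices n d \<longrightarrow> T is = 0}"

text \<open>The pure tensor \<open>v\<^sub>1 \<otimes> \<dots> \<otimes> v\<^sub>d\<close>, where \<open>vs = [v\<^sub>1, \<dots>, v\<^sub>d]\<close>.\<close>

definition pure_tensor :: "(nat \<Rightarrow> 'a::field) list \<Rightarrow> nat list \<Rightarrow> 'a" where
  "pure_tensor vs = (\<lambda>is. if length is = length vs
     then \<Prod>k<length vs. (vs ! k) (is ! k) else 0)"

text \<open>
  The linear map \<open>\<phi>\<^sup>\<otimes>\<^sup>d\<close>, defined on the basis of tensors \<open>e\<^bsub>i\<^sub>1\<^esub> \<otimes> \<dots> \<otimes> e\<^bsub>i\<^sub>d\<^esub>\<close>; see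
  \<open>tensor_map_pure_tensor\<close> below for its value on arbitrary pure tensors.
\<close>

definition tensor_map ::
  "nat \<Rightarrow> nat \<Rightarrow> ((nat \<Rightarrow> 'a::field) \<Rightarrow> nat \<Rightarrow> 'a) \<Rightarrow> (nat list \<Rightarrow> 'a) \<Rightarrow> nat list \<Rightarrow> 'a" where
  "tensor_map n d \<phi> T =
     (\<Sum>is\<in>multi_indices n d. fscale (T is) (pure_tensor (map (\<lambda>i. \<phi> (basis_vec i)) is)))"

definition permute_tensor :: "(nat \<Rightarrow> nat) \<Rightarrow> (nat list \<Rightarrow> 'a) \<Rightarrow> nat list \<Rightarrow> 'a" where
  "permute_tensor \<sigma> T = (\<lambda>is. T (permute_list \<sigma> is))"


section \<open>Symmetric powers\<close>

definition sym_relations :: "nat \<Rightarrow> nat \<Rightarrow> (nat list \<Rightarrow> 'a::field) set" where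
  "sym_relations n d =
     fun_vs.span {T - permute_tensor \<sigma> T | T \<sigma>. T \<in> tensors n d \<and> \<sigma> permutes {..<d}}"

definition sym_equiv :: "nat \<Rightarrow> nat \<Rightarrow> ((nat list \<Rightarrow> 'a::field) \<times> (nat list \<Rightarrow> 'a)) set" where
  "sym_equiv n d = {(S, T). S \<in> tensors n d \<and> T \<in> tensors n d \<and> S - T \<in> sym_relations n d}"

definition sym_class :: "nat \<Rightarrow> nat \<Rightarrow> (nat list \<Rightarrow> 'a::field) \<Rightarrow> (nat list \<Rightarrow> 'a) set" where
  "sym_class n d T = sym_equiv n d `` {T}"

definition sym_power :: "nat \<Rightarrow> nat \<Rightarrow> (nat list \<Rightarrow> 'a::field) set set" where
  "sym_power n d = tensors n d // sym_equiv n d"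

text \<open>The induced map \<open>S\<^sup>d K\<^sup>n \<rightarrow> S\<^sup>d K\<^sup>r\<close>; the union is over equal classes, by \<open>sym_map_class\<close> below.\<close>

definition sym_map :: "nat \<Rightarrow> nat \<Rightarrow> nat \<Rightarrow> ((nat \<Rightarrow> 'a::field) \<Rightarrow> nat \<Rightarrow> 'a) \<Rightarrow>
    (nat list \<Rightarrow> 'a) set \<Rightarrow> (nat list \<Rightarrow> 'a) set" where
  "sym_map n r d \<phi> f = (\<Union>T\<in>f. sym_class r d (tensor_map n d \<phi> T))"

definition unit_tensor :: "nat \<Rightarrow> nat \<Rightarrow> (nat list \<Rightarrow> 'a::field) set" where
  "unit_tensor r d = sym_class r d (\<Sum>i<r. pure_tensor (replicate d (basis_vec i)))"

definition symmetric_subrank :: "nat \<Rightarrow> nat \<Rightarrow> (nat list \<Rightarrow> 'a::field) set \<Rightarrow> nat" where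
  "symmetric_subrank n d f = Max {r. \<exists>\<phi>\<in>linear_maps n r. sym_map n r d \<phi> f = unit_tensor r d}"


section \<open>The Zariski topology on \<open>S\<^sup>d K\<^sup>n\<close>\<close>

text \<open>Linearity on the quotient is linearity after composing with the projection \<open>sym_class n d\<close>.\<close>

definition sym_functionals :: "nat \<Rightarrow> nat \<Rightarrow> ((nat list \<Rightarrow> 'a::field) set \<Rightarrow> 'a) set" where
  "sym_functionals n d = {l.
     (\<forall>S\<in>tensors n d. \<forall>T\<in>tensors n d.
        l (sym_class n d (S + T)) = l (sym_class n d S) + l (sym_class n d T)) \<and>
     (\<forall>c. \<forall>T\<in>tensors n d. l (sym_class n d (fscale c T)) = c * l (sym_class n d T))}"

inductive_set polynomial_functions :: "nat \<Rightarrow> nat \<Rightarrow> ((nat list \<Rightarrow> 'a::field) set \<Rightarrow> 'a) set"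
  for n d :: nat where
  const: "(\<lambda>_. c) \<in> polynomial_functions n d"
| functional: "l \<in> sym_functionals n d \<Longrightarrow> l \<in> polynomial_functions n d"
| add: "\<lbrakk>p \<in> polynomial_functions n d; q \<in> polynomial_functions n d\<rbrakk>
    \<Longrightarrow> (\<lambda>f. p f + q f) \<in> polynomial_functions n d"
| mult: "\<lbrakk>p \<in> polynomial_functions n d; q \<in> polynomial_functions n d\<rbrakk>
    \<Longrightarrow> (\<lambda>f. p f * q f) \<in> polynomial_functions n d"

definition zariski_open :: "nat \<Rightarrow> nat \<Rightarrow> (nat list \<Rightarrow> 'a::field) set set \<Rightarrow> bool" where
  "zariski_open n d U \<longleftrightarrow>
     (\<exists>P\<subseteq>polynomial_functions n d. U = sym_power n d - {f \<in> sym_power n d. \<forall>p\<in>P. p f = 0})"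

definition zariski_topology :: "nat \<Rightarrow> nat \<Rightarrow> (nat list \<Rightarrow> 'a::field) set topology" where
  "zariski_topology n d = topology (zariski_open n d)"

definition generic_symmetric_subrank :: "'a::alg_closed_field itself \<Rightarrow> nat \<Rightarrow> nat \<Rightarrow> nat" where
  "generic_symmetric_subrank K d n = (THE r. \<exists>U.
     openin (zariski_topology n d :: (nat list \<Rightarrow> 'a) set topology) U \<and>
     zariski_topology n d closure_of U = topspace (zariski_topology n d) \<and>
     (\<forall>f\<in>U. symmetric_subrank n d f = r))"

definition char_exponent :: "'a::field itself \<Rightarrow> nat" where
  "char_exponent K = (if CHAR('a) = 0 then 1 else CHAR('a))"


section \<open>Well-definedness\<close>

lemma zariski_open_iff:
  "zariski_open n d U \<longleftrightarrow>
     (\<exists>P\<subseteq>polynomial_functions n d. U = {f \<in> sym_power n d. \<exists>p\<in>P. p f \<noteq> 0})"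
proof -
  have eq: "sym_power n d - {f \<in> sym_power n d. \<forall>p\<in>P. p f = 0} =
      {f \<in> sym_power n d. \<exists>p\<in>P. p f \<noteq> 0}" for P :: "((nat list \<Rightarrow> 'a) set \<Rightarrow> 'a) set"
    by auto
  show ?thesis unfolding zariski_open_def eq ..
qed

lemma istopology_zariski_open: "istopology (zariski_open n d :: (nat list \<Rightarrow> 'a::field) set set \<Rightarrow> bool)"
  unfolding istopology_def
proof (intro conjI allI impI)
  fix S T :: "(nat list \<Rightarrow> 'a) set set"
  assume S: "zariski_open n d S" and T: "zariski_open n d T"
  obtain P where P: "P \<subseteq> polynomial_functions n d" "S = {f \<in> sym_power n d. \<exists>p\<in>P. p f \<noteq> 0}"
    using S[unfolded zariski_open_iff] by (elim exE conjE)
  obtain Q where Q: "Q \<subseteq> polynomial_functions n d" "T = {f \<in> sym_power n d. \<exists>p\<in>Q. p f \<noteq> 0}"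
    using T[unfolded zariski_open_iff] by (elim exE conjE)
  show "zariski_open n d (S \<inter> T)"
    unfolding zariski_open_iff
  proof (intro exI conjI)
    show "(\<lambda>(p, q) f. p f * q f) ` (P \<times> Q) \<subseteq> polynomial_functions n d"
      using P(1) Q(1) by (auto intro!: polynomial_functions.mult)
    show "S \<inter> T = {f \<in> sym_power n d. \<exists>p\<in>(\<lambda>(p, q) f. p f * q f) ` (P \<times> Q). p f \<noteq> 0}"
      unfolding P(2) Q(2) by auto
  qed
next
  fix \<K> :: "(nat list \<Rightarrow> 'a) set set set"
  assume "\<forall>U\<in>\<K>. zariski_open n d U"
  then have "\<forall>U\<in>\<K>. \<exists>P\<subseteq>polynomial_functions n d. U = {f \<in> sym_power n d. \<exists>p\<in>P. p f \<noteq> 0}"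
    by (simp only: zariski_open_iff)
  then obtain P where P: "\<forall>U\<in>\<K>. P U \<subseteq> polynomial_functions n d \<and>
      U = {f \<in> sym_power n d. \<exists>p\<in>P U. p f \<noteq> 0}"
    by (rule bchoice[THEN exE])
  show "zariski_open n d (\<Union>\<K>)"
    unfolding zariski_open_iff
  proof (intro exI conjI)
    show "(\<Union>U\<in>\<K>. P U) \<subseteq> polynomial_functions n d"
      by (rule UN_least) (rule P[rule_format, THEN conjunct1])
    have "f \<in> U \<longleftrightarrow> f \<in> sym_power n d \<and> (\<exists>p\<in>P U. p f \<noteq> 0)" if "U \<in> \<K>" for f U
      by (subst P[rule_format, OF that, THEN conjunct2]) simp
    then have "\<Union>\<K> = (\<Union>U\<in>\<K>. {f \<in> sym_power n d. \<exists>p\<in>P U. p f \<noteq> 0})"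
      by (intro set_eqI) simp
    also have "\<dots> = {f \<in> sym_power n d. \<exists>p\<in>(\<Union>U\<in>\<K>. P U). p f \<noteq> 0}"
      by auto
    finally show "\<Union>\<K> = {f \<in> sym_power n d. \<exists>p\<in>(\<Union>U\<in>\<K>. P U). p f \<noteq> 0}" .
  qed
qed

lemma openin_zariski_topology: "openin (zariski_topology n d) U \<longleftrightarrow> zariski_open n d U"
  by (simp add: zariski_topology_def topology_inverse' istopology_zariski_open)

lemma topspace_zariski_topology:
  "topspace (zariski_topology n d) = (sym_power n d :: (nat list \<Rightarrow> 'a::field) set set)"
    (is "?Z = ?S")
proof (rule antisym)
  show "?Z \<subseteq> ?S"
    unfolding topspace_def by (auto simp: openin_zariski_topology zariski_open_def)
  have "zariski_open n d ?S"
    unfolding zariski_open_iff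
    by (rule exI[of _ "{\<lambda>_. 1}"]) (auto intro: polynomial_functions.const)
  then show "?S \<subseteq> ?Z"
    by (intro openin_subset) (simp add: openin_zariski_topology)
qed

lemma permute_list_in_multi_indices:
  assumes "\<sigma> permutes {..<d}"
  shows "permute_list \<sigma> is \<in> multi_indices n d \<longleftrightarrow> is \<in> multi_indices n d"
  using assms by (auto simp: multi_indices_def)

lemma permute_tensor_in_tensors:
  "\<lbrakk>\<sigma> permutes {..<d}; T \<in> tensors n d\<rbrakk> \<Longrightarrow> permute_tensor \<sigma> T \<in> tensors n d"
  by (auto simp: tensors_def permute_tensor_def permute_list_in_multi_indices)

lemma subspace_tensors: "fun_vs.subspace (tensors n d)"
  by (auto simp: fun_vs.subspace_def tensors_def fscale_def)

lemma sym_relations_subset: "sym_relations n d \<subseteq> tensors n d"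
  unfolding sym_relations_def
  by (rule fun_vs.span_minimal[OF _ subspace_tensors])
    (auto intro!: fun_vs.subspace_diff[OF subspace_tensors] permute_tensor_in_tensors)

lemma equiv_sym_equiv:
  "equiv (tensors n d :: (nat list \<Rightarrow> 'a::field) set) (sym_equiv n d)" (is "equiv ?A ?R")
proof (rule equivI)
  show "?R \<subseteq> ?A \<times> ?A" by (auto simp: sym_equiv_def)
  show "refl_on ?A ?R"
    by (auto simp: refl_on_def sym_equiv_def sym_relations_def fun_vs.span_zero)
  show "sym ?R"
  proof (rule symI)
    fix S T assume "(S, T) \<in> ?R"
    then show "(T, S) \<in> ?R"
      using fun_vs.span_neg[of "S - T"] by (auto simp: sym_equiv_def sym_relations_def)
  qed
  show "trans ?R"
  proof (rule transI)
    fix S T U assume "(S, T) \<in> ?R" "(T, U) \<in> ?R"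
    then show "(S, U) \<in> ?R"
      using fun_vs.span_add[of "S - T" _ "T - U"] by (auto simp: sym_equiv_def sym_relations_def)
  qed
qed

lemma finite_multi_indices: "finite (multi_indices n d)"
  using finite_lists_length_eq[of "{..<n}" d] by (simp add: multi_indices_def conj_commute)

lemma basis_vec_in_Kn: "i < n \<Longrightarrow> basis_vec i \<in> Kn n"
  by (auto simp: basis_vec_def Kn_def)

lemma pure_tensor_in_tensors:
  assumes "length vs = d" "set vs \<subseteq> Kn n"
  shows "pure_tensor vs \<in> tensors n d"
proof -
  have "pure_tensor vs is = 0" if "is \<notin> multi_indices n d" for "is"
  proof (cases "length is = d")
    case True
    with that obtain k where "k < d" "is ! k \<ge> n"
      by (auto simp: multi_indices_def in_set_conv_nth subset_iff not_less)
    moreover from this assms have "vs ! k \<in> Kn n" by auto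
    ultimately show ?thesis using assms True by (auto simp: pure_tensor_def Kn_def)
  qed (use assms in \<open>simp add: pure_tensor_def\<close>)
  then show ?thesis by (simp add: tensors_def)
qed

lemma tensor_map_in_tensors:
  assumes "\<phi> \<in> linear_maps n r"
  shows "tensor_map n d \<phi> T \<in> tensors r d"
  unfolding tensor_map_def
proof (intro fun_vs.subspace_sum[OF subspace_tensors] fun_vs.subspace_scale[OF subspace_tensors]
    pure_tensor_in_tensors)
  fix "is" assume "is \<in> multi_indices n d"
  then show "length (map (\<lambda>i. \<phi> (basis_vec i)) is) = d"
    and "set (map (\<lambda>i. \<phi> (basis_vec i)) is) \<subseteq> Kn r"
    using assms by (auto simp: multi_indices_def linear_maps_def basis_vec_in_Kn)
qed

lemma sum_fun_apply: "(\<Sum>i\<in>A. f i) x = (\<Sum>i\<in>A. f i x)"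
  for f :: "'i \<Rightarrow> 'j \<Rightarrow> 'a::comm_monoid_add"
  by (induction A rule: infinite_finite_induct) simp_all

lemma linear_map_expand:
  fixes \<phi> :: "(nat \<Rightarrow> 'a::field) \<Rightarrow> nat \<Rightarrow> 'a"
  assumes \<phi>: "\<phi> \<in> linear_maps n r" and v: "v \<in> Kn n"
  shows "\<phi> v j = (\<Sum>i<n. v i * \<phi> (basis_vec i) j)"
proof -
  define w where "w m = (\<lambda>i. if i < m then v i else 0)" for m :: nat
  have "\<phi> (w m) j = (\<Sum>i<m. v i * \<phi> (basis_vec i) j)" if "m \<le> n" for m
    using that
  proof (induction m)
    case 0
    have "fscale 0 (w 0) = w 0" by (simp add: w_def fscale_def)
    moreover have "w 0 \<in> Kn n" by (simp add: w_def Kn_def)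
    then have "\<phi> (fscale 0 (w 0)) = fscale 0 (\<phi> (w 0))"
      using \<phi> unfolding linear_maps_def by blast
    ultimately have "\<phi> (w 0) = fscale 0 (\<phi> (w 0))" by (simp only:)
    then have "\<phi> (w 0) j = fscale 0 (\<phi> (w 0)) j" by (rule fun_cong)
    then show ?case by (simp add: fscale_def)
  next
    case (Suc m)
    have eq: "w (Suc m) = w m + fscale (v m) (basis_vec m)"
      by (auto simp: w_def fscale_def basis_vec_def fun_eq_iff less_Suc_eq)
    have K: "w m \<in> Kn n" "(basis_vec m :: nat \<Rightarrow> 'a) \<in> Kn n" "fscale (v m) (basis_vec m) \<in> Kn n"
      using Suc.prems by (auto simp: w_def Kn_def basis_vec_def fscale_def)
    have "\<phi> (w (Suc m)) = \<phi> (w m) + fscale (v m) (\<phi> (basis_vec m))"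
      using \<phi> K unfolding eq linear_maps_def by simp
    then show ?case using Suc by (simp add: fscale_def)
  qed
  moreover have "w n = v" using v by (auto simp: w_def Kn_def)
  ultimately show ?thesis by auto
qed

lemma multi_indices_Suc:
  "multi_indices n (Suc d) = (\<lambda>(i, is). i # is) ` ({..<n} \<times> multi_indices n d)"
  by (auto simp: multi_indices_def length_Suc_conv image_iff)

lemma sum_multi_indices_prod:
  fixes g :: "nat \<Rightarrow> nat \<Rightarrow> 'a::comm_semiring_1"
  shows "(\<Sum>is\<in>multi_indices n d. \<Prod>k<d. g k (is ! k)) = (\<Prod>k<d. \<Sum>i<n. g k i)"
proof (induction d arbitrary: g)
  case 0
  have "multi_indices n 0 = {[]}" by (auto simp: multi_indices_def)
  then show ?case by simp
next
  case (Suc d)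
  have "(\<Sum>is\<in>multi_indices n (Suc d). \<Prod>k<Suc d. g k (is ! k)) =
      (\<Sum>(i, is)\<in>{..<n} \<times> multi_indices n d. \<Prod>k<Suc d. g k ((i # is) ! k))"
    unfolding multi_indices_Suc by (subst sum.reindex) (auto simp: inj_on_def case_prod_unfold)
  also have "\<dots> = (\<Sum>i<n. \<Sum>is\<in>multi_indices n d. g 0 i * (\<Prod>k<d. g (Suc k) (is ! k)))"
    unfolding prod.lessThan_Suc_shift by (simp add: sum.cartesian_product)
  also have "\<dots> = (\<Sum>i<n. g 0 i * (\<Prod>k<d. \<Sum>i<n. g (Suc k) i))"
    by (simp only: sum_distrib_left[symmetric] Suc.IH[of "\<lambda>k. g (Suc k)"])
  also have "\<dots> = (\<Prod>k<Suc d. \<Sum>i<n. g k i)"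
    by (simp only: prod.lessThan_Suc_shift sum_distrib_right)
  finally show ?case .
qed

lemma tensor_map_apply:
  "tensor_map n d \<phi> T js = (if length js = d
     then \<Sum>is\<in>multi_indices n d. T is * (\<Prod>k<d. \<phi> (basis_vec (is ! k)) (js ! k)) else 0)"
proof -
  have *: "length is = d" if "is \<in> multi_indices n d" for "is"
    using that by (simp add: multi_indices_def)
  show ?thesis
    unfolding tensor_map_def sum_fun_apply fscale_def pure_tensor_def
    by (auto simp: * intro!: sum.cong sum.neutral)
qed

lemma tensor_map_pure_tensor:
  assumes \<phi>: "\<phi> \<in> linear_maps n r" and vs: "set vs \<subseteq> Kn n" "length vs = d"
  shows "tensor_map n d \<phi> (pure_tensor vs) = pure_tensor (map \<phi> vs)"
proof
  fix js
  have K: "vs ! k \<in> Kn n" if "k < d" for k using that vs by auto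
  show "tensor_map n d \<phi> (pure_tensor vs) js = pure_tensor (map \<phi> vs) js"
  proof (cases "length js = d")
    case True
    have "tensor_map n d \<phi> (pure_tensor vs) js =
        (\<Sum>is\<in>multi_indices n d. \<Prod>k<d. (vs ! k) (is ! k) * \<phi> (basis_vec (is ! k)) (js ! k))"
      unfolding tensor_map_apply using True vs
      by (auto simp: pure_tensor_def multi_indices_def prod.distrib intro!: sum.cong)
    also have "\<dots> = (\<Prod>k<d. \<Sum>i<n. (vs ! k) i * \<phi> (basis_vec i) (js ! k))"
      by (rule sum_multi_indices_prod)
    also have "\<dots> = (\<Prod>k<d. \<phi> (vs ! k) (js ! k))"
      by (intro prod.cong refl linear_map_expand[OF \<phi>, symmetric] K) simp
    finally show ?thesis using True vs by (simp add: pure_tensor_def)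
  qed (use vs in \<open>simp add: tensor_map_apply pure_tensor_def\<close>)
qed

lemma bij_betw_permute_list_multi_indices:
  assumes "\<sigma> permutes {..<d}"
  shows "bij_betw (permute_list \<sigma>) (multi_indices n d) (multi_indices n d)"
proof -
  have "inj_on (permute_list \<sigma>) (multi_indices n d)"
  proof (rule inj_onI)
    fix xs ys assume *: "xs \<in> multi_indices n d" "ys \<in> multi_indices n d"
      "permute_list \<sigma> xs = permute_list \<sigma> ys"
    then have len: "length xs = d" "length ys = d" by (simp_all add: multi_indices_def)
    have "xs ! k = ys ! k" if "k < d" for k
    proof -
      have "k \<in> \<sigma> ` {..<d}" using permutes_image[OF assms] that by simp
      then obtain i where i: "i < d" "k = \<sigma> i" by auto
      have "permute_list \<sigma> xs ! i = permute_list \<sigma> ys ! i" using *(3) by simp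
      then show ?thesis using i assms len by (simp add: permute_list_nth)
    qed
    then show "xs = ys" using len by (intro nth_equalityI) auto
  qed
  moreover have "permute_list \<sigma> ` multi_indices n d \<subseteq> multi_indices n d"
    by (auto simp: permute_list_in_multi_indices[OF assms])
  ultimately show ?thesis
    using endo_inj_surj[OF finite_multi_indices] by (auto simp: bij_betw_def)
qed

lemma tensor_map_permute_tensor:
  assumes \<sigma>: "\<sigma> permutes {..<d}"
  shows "tensor_map n d \<phi> (permute_tensor \<sigma> T) = permute_tensor \<sigma> (tensor_map n d \<phi> T)"
proof
  fix js
  show "tensor_map n d \<phi> (permute_tensor \<sigma> T) js = permute_tensor \<sigma> (tensor_map n d \<phi> T) js"
  proof (cases "length js = d")
    case True
    have "permute_tensor \<sigma> (tensor_map n d \<phi> T) js =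
        (\<Sum>is\<in>multi_indices n d. T is * (\<Prod>k<d. \<phi> (basis_vec (is ! k)) (js ! \<sigma> k)))"
      using True \<sigma> by (simp add: permute_tensor_def tensor_map_apply permute_list_nth)
    also have "\<dots> = (\<Sum>is\<in>multi_indices n d. T (permute_list \<sigma> is) *
        (\<Prod>k<d. \<phi> (basis_vec (permute_list \<sigma> is ! k)) (js ! \<sigma> k)))"
      by (rule sum.reindex_bij_betw[OF bij_betw_permute_list_multi_indices[OF \<sigma>], symmetric])
    also have "\<dots> = (\<Sum>is\<in>multi_indices n d. T (permute_list \<sigma> is) *
        (\<Prod>k<d. \<phi> (basis_vec (is ! k)) (js ! k)))"
    proof (rule sum.cong[OF refl])
      fix "is" assume "is \<in> multi_indices n d"
      then have "length is = d" by (simp add: multi_indices_def)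
      then have "(\<Prod>k<d. \<phi> (basis_vec (permute_list \<sigma> is ! k)) (js ! \<sigma> k)) =
          (\<Prod>k<d. \<phi> (basis_vec (is ! \<sigma> k)) (js ! \<sigma> k))"
        using \<sigma> by (simp add: permute_list_nth)
      also have "\<dots> = (\<Prod>k<d. \<phi> (basis_vec (is ! k)) (js ! k))"
        by (rule prod.reindex_bij_betw[OF permutes_imp_bij[OF \<sigma>]])
      finally show "T (permute_list \<sigma> is) *
            (\<Prod>k<d. \<phi> (basis_vec (permute_list \<sigma> is ! k)) (js ! \<sigma> k)) =
          T (permute_list \<sigma> is) * (\<Prod>k<d. \<phi> (basis_vec (is ! k)) (js ! k))"
        by simp
    qed
    finally show ?thesis using True by (simp add: tensor_map_apply permute_tensor_def)
  qed (simp add: tensor_map_apply permute_tensor_def)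
qed

lemma linear_tensor_map: "Vector_Spaces.linear fscale fscale (tensor_map n d \<phi>)"
  unfolding Vector_Spaces.linear_iff
proof (intro conjI allI fun_vs.vector_space_axioms)
  show "tensor_map n d \<phi> (S + T) = tensor_map n d \<phi> S + tensor_map n d \<phi> T" for S T
    by (rule ext) (simp add: tensor_map_apply distrib_right sum.distrib)
  show "tensor_map n d \<phi> (fscale c T) = fscale c (tensor_map n d \<phi> T)" for c T
    by (rule ext) (simp add: tensor_map_apply fscale_def sum_distrib_left mult.assoc)
qed

lemma tensor_map_sym_relations:
  fixes \<phi> :: "(nat \<Rightarrow> 'a::field) \<Rightarrow> nat \<Rightarrow> 'a"
  assumes \<phi>: "\<phi> \<in> linear_maps n r" and T: "T \<in> sym_relations n d"
  shows "tensor_map n d \<phi> T \<in> sym_relations r d"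
proof -
  interpret L: Vector_Spaces.linear fscale fscale "tensor_map n d \<phi>"
    by (rule linear_tensor_map)
  let ?G = "\<lambda>n. {T - permute_tensor \<sigma> T | (T :: nat list \<Rightarrow> 'a) \<sigma>.
    T \<in> tensors n d \<and> \<sigma> permutes {..<d}}"
  have "tensor_map n d \<phi> ` ?G n \<subseteq> ?G r"
  proof (rule image_subsetI)
    fix U assume "U \<in> ?G n"
    then obtain T \<sigma> where U: "U = T - permute_tensor \<sigma> T" and \<sigma>: "\<sigma> permutes {..<d}"
      by blast
    have "tensor_map n d \<phi> U = tensor_map n d \<phi> T - permute_tensor \<sigma> (tensor_map n d \<phi> T)"
      by (simp only: U L.diff tensor_map_permute_tensor[OF \<sigma>])
    then show "tensor_map n d \<phi> U \<in> ?G r"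
      using \<sigma> tensor_map_in_tensors[OF \<phi>] by blast
  qed
  then have "fun_vs.span (tensor_map n d \<phi> ` ?G n) \<subseteq> fun_vs.span (?G r)"
    by (rule fun_vs.span_mono)
  then show ?thesis
    using T unfolding sym_relations_def L.span_image by blast
qed

lemma sym_map_class:
  fixes \<phi> :: "(nat \<Rightarrow> 'a::field) \<Rightarrow> nat \<Rightarrow> 'a"
  assumes \<phi>: "\<phi> \<in> linear_maps n r" and T: "T \<in> tensors n d"
  shows "sym_map n r d \<phi> (sym_class n d T) = sym_class r d (tensor_map n d \<phi> T)"
proof -
  interpret L: Vector_Spaces.linear fscale fscale "tensor_map n d \<phi>"
    by (rule linear_tensor_map)
  have "(\<lambda>T. sym_class r d (tensor_map n d \<phi> T)) respects sym_equiv n d"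
  proof (rule congruentI)
    fix S T :: "nat list \<Rightarrow> 'a" assume "(S, T) \<in> sym_equiv n d"
    then have "(tensor_map n d \<phi> S, tensor_map n d \<phi> T) \<in> sym_equiv r d"
      using tensor_map_sym_relations[OF \<phi>] tensor_map_in_tensors[OF \<phi>]
      by (simp add: sym_equiv_def L.diff[symmetric])
    then show "sym_class r d (tensor_map n d \<phi> S) = sym_class r d (tensor_map n d \<phi> T)"
      unfolding sym_class_def by (rule equiv_class_eq[OF equiv_sym_equiv])
  qed
  then show ?thesis
    using UN_equiv_class[OF equiv_sym_equiv _ T] unfolding sym_map_def sym_class_def by blast
qed

text \<open>With \<open>sym_class n d (pure_tensor vs)\<close> the product \<open>v\<^sub>1 \<cdots> v\<^sub>d\<close> in \<open>S\<^sup>d K\<^sup>n\<close>:\<close>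

corollary sym_map_pure_tensor:
  assumes "\<phi> \<in> linear_maps n r" "set vs \<subseteq> Kn n" "length vs = d"
  shows "sym_map n r d \<phi> (sym_class n d (pure_tensor vs)) = sym_class r d (pure_tensor (map \<phi> vs))"
  using assms by (simp add: sym_map_class pure_tensor_in_tensors tensor_map_pure_tensor)

end

theory Submission
  imports Defs
begin

text \<open>
  Let \<open>E\<^sub>r\<close> be the set of all \<open>f \<in> S\<^sup>d K\<^sup>n\<close> that some linear map \<open>K\<^sup>n \<rightarrow> K\<^sup>r\<close> carries to the unit tensor
  \<open>I\<^sub>r = e\<^sub>1\<^sup>d + \<dots> + e\<^sub>r\<^sup>d\<close>; in coordinates this is \<open>subrank_locus n d r\<close>. These sets decrease with \<open>r\<close>.

  As the projection of an algebraic set, \<open>E\<^sub>r\<close> is constructible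
  (\<open>constructible_project\<close>). The ring of polynomial functions has no zero divisors, so a
  constructible set contains a nonempty Zariski-open set or misses one
  (\<open>subrank_locus_dichotomy\<close>). Let \<open>g\<close> be the largest \<open>r\<close> such that \<open>E\<^sub>r\<close> contains a nonempty open
  set. Then some dense open set lies in \<open>E\<^sub>g\<close> and misses \<open>E\<^bsub>g+1\<^esub>\<close>, so the generic subrank exists and
  is \<open>g\<close> (\<open>generic_subrank_characterization\<close>). The question is for which \<open>r\<close> the set \<open>E\<^sub>r\<close> is dense.

  For the upper bound, since \<open>d\<close> is not a power of the characteristic exponent, \<open>I\<^sub>r\<close> cannot be written in
  fewer than \<open>r\<close> variables, so a linear map that carries \<open>f\<close> to \<open>I\<^sub>r\<close> is surjective and maps \<open>r\<close> of
  the basis vectors of \<open>K\<^sup>n\<close>, say those with index in \<open>I\<close>, to a basis. Then the coefficients of \<open>f\<close>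
  at monomials in the variables from \<open>I\<close> are polynomials in the other coefficients and \<open>r n\<close> further
  parameters. If \<open>r n\<close> is less than the number of these monomials, then \<open>f\<close> lies in the image of a
  polynomial map from a space of smaller dimension, hence in a hypersurface
  (\<open>polynomial_image_in_hypersurface\<close>). There are at least \<open>r\<^sup>d / d!\<close> such monomials, so density of
  \<open>E\<^sub>r\<close> forces \<open>r\<^sup>d \<le> d! r n\<close>, that is \<open>g\<^bsup>d-1\<^esup> \<le> d! n\<close> (\<open>subrank_locus_upper_bound\<close>).

  For the lower bound, let \<open>w\<^sub>1, \<dots>, w\<^sub>N\<close> be forms of degree \<open>d - 1\<close> in \<open>x\<^sub>1, \<dots>, x\<^sub>r\<close>,
    where \<open>r + N \<le> n\<close>, and
  let \<open>f\<^sub>0 = I\<^sub>r + \<Sum>\<^sub>k x\<^bsub>r+k\<^esub> w\<^sub>k\<close>. Substituting \<open>x\<^bsub>r+k\<^esub> + t l\<^sub>k\<close> for \<open>x\<^bsub>r+k\<^esub>\<close>, with linear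
    forms \<open>l\<^sub>k\<close> in
  \<open>x\<^sub>1, \<dots>, x\<^sub>r\<close>, moves \<open>f\<^sub>0\<close> inside \<open>E\<^sub>r\<close> along a curve with tangent vector \<open>\<Sum>\<^sub>k l\<^sub>k w\<^sub>k\<close>,
    and multiples of
  monomials that involve one of \<open>x\<^bsub>r+1\<^esub>, \<dots>, x\<^sub>n\<close> may be added to \<open>f\<^sub>0\<close> beforehand. So
    if the products of
  linear forms with the \<open>w\<^sub>k\<close> span all
    forms of degree \<open>d\<close>, then \<open>E\<^sub>r\<close> contains curves through \<open>f\<^sub>0\<close> in
  every direction and is dense (\<open>generic_unit_if_products_span\<close>). This needs \<open>N\<close> of order
  \<open>r\<^bsup>d-1\<^esup> / d!\<close> at least, and this order can be attained. Divide the variables into \<open>m\<close> blocks of a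
  fixed size \<open>s\<close>. There are only \<open>O(r\<^bsup>d-2\<^esup>)\<close> monomials of degree \<open>d - 1\<close> that use a block twice;
    take
  them all. For \<open>d\<close> distinct blocks the products of one variable from each form a basis of
  \<open>(K\<^sup>s)\<^sup>\<otimes>\<^sup>d\<close>, and \<open>s\<^bsup>d-1\<^esup> / d\<close> tensors
    for each choice of \<open>d - 1\<close> of the \<open>d\<close> blocks suffice to produce
  all of it: for \<open>d = 3\<close> by an explicit system, for larger \<open>d\<close> by induction (\<open>slots_span_exists\<close>).
  Spanning is an open condition, so tensors in general position serve all sets of \<open>d\<close> blocks at the
  same time (\<open>slots_span_simultaneously\<close>). Altogether \<open>N \<le> r\<^bsup>d-1\<^esup> / d! + O(r\<^bsup>d-2\<^esup>)\<close>,
    and \<open>g\<close> is at least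
  the largest multiple \<open>r\<close> of \<open>s\<close> with \<open>r + N \<le> n\<close> (\<open>subrank_locus_lower_bound\<close>).
\<close>

section \<open>Polynomial functions\<close>

text \<open>
  Polynomials are treated as functions. Over an infinite field nothing is lost, and points may have
  an index type of any kind; \<open>I\<close> is the set of coordinates that may occur.
\<close>

inductive_set polyfun :: "'i set \<Rightarrow> (('i \<Rightarrow> 'a::comm_ring_1) \<Rightarrow> 'a) set" for I where
  const: "(\<lambda>_. c) \<in> polyfun I"
| coord: "i \<in> I \<Longrightarrow> (\<lambda>x. x i) \<in> polyfun I"
| add: "\<lbrakk>p \<in> polyfun I; q \<in> polyfun I\<rbrakk> \<Longrightarrow> (\<lambda>x. p x + q x) \<in> polyfun I"
| mult: "\<lbrakk>p \<in> polyfun I; q \<in> polyfun I\<rbrakk> \<Longrightarrow> (\<lambda>x. p x * q x) \<in> polyfun I"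

lemma polyfun_uminus: "p \<in> polyfun I \<Longrightarrow> (\<lambda>x. - p x) \<in> polyfun I"
  using polyfun.mult[OF polyfun.const[of "-1"], of p I] by simp

lemma polyfun_diff: "\<lbrakk>p \<in> polyfun I; q \<in> polyfun I\<rbrakk> \<Longrightarrow> (\<lambda>x. p x - q x) \<in> polyfun I"
  using polyfun.add[OF _ polyfun_uminus, of p I q] by simp

lemma polyfun_sum: "(\<And>k. k \<in> A \<Longrightarrow> p k \<in> polyfun I) \<Longrightarrow> (\<lambda>x. \<Sum>k\<in>A. p k x) \<in> polyfun I"
  by (induction A rule: infinite_finite_induct) (auto intro: polyfun.intros)

lemma polyfun_prod: "(\<And>k. k \<in> A \<Longrightarrow> p k \<in> polyfun I) \<Longrightarrow> (\<lambda>x. \<Prod>k\<in>A. p k x) \<in> polyfun I"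
  by (induction A rule: infinite_finite_induct) (auto intro: polyfun.intros)

lemma polyfun_if:
  "\<lbrakk>b \<Longrightarrow> p \<in> polyfun I; \<not> b \<Longrightarrow> q \<in> polyfun I\<rbrakk> \<Longrightarrow> (\<lambda>x. if b then p x else q x) \<in> polyfun I"
  by (cases b) simp_all

lemmas polyfun_intros = polyfun.const polyfun.coord polyfun.add polyfun.mult polyfun_uminus
  polyfun_diff polyfun_sum polyfun_prod polyfun_if

lemma polyfun_compose:
  assumes "p \<in> polyfun I" "\<And>i. i \<in> I \<Longrightarrow> (\<lambda>x. F x i) \<in> polyfun J"
  shows "(\<lambda>x. p (F x)) \<in> polyfun J"
  using assms(1) by induction (auto intro: polyfun.intros assms(2))

lemma polyfun_cong:
  assumes "p \<in> polyfun I" "\<And>i. i \<in> I \<Longrightarrow> x i = y i"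
  shows "p x = p y"
  using assms(1) by induction (auto intro: assms(2))

lemma polyfun_along_curve:
  fixes p :: "('i \<Rightarrow> 'a::field) \<Rightarrow> 'a"
  assumes "p \<in> polyfun I"
  shows "\<exists>Q. \<forall>t. p (\<lambda>i. poly (c i) t) = poly Q t"
  using assms
proof induction
  case (const a)
  show ?case by (rule exI[of _ "[:a:]"]) simp
next
  case (coord i)
  show ?case by (rule exI[of _ "c i"]) simp
next
  case (add p q)
  then obtain P Q where "\<forall>t. p (\<lambda>i. poly (c i) t) = poly P t" "\<forall>t. q (\<lambda>i. poly (c i) t) = poly Q t"
    by blast
  then show ?case by (intro exI[of _ "P + Q"]) simp
next
  case (mult p q)
  then obtain P Q where "\<forall>t. p (\<lambda>i. poly (c i) t) = poly P t" "\<forall>t. q (\<lambda>i. poly (c i) t) = poly Q t"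
    by blast
  then show ?case by (intro exI[of _ "P * Q"]) simp
qed

lemma infinite_alg_closed_field: "infinite (UNIV :: 'a::alg_closed_field set)"
proof
  assume fin: "finite (UNIV :: 'a set)"
  \<comment> \<open>a polynomial that vanishes everywhere; adding \<open>1\<close> leaves no root\<close>
  define P where "P = (\<Prod>a\<in>(UNIV :: 'a set). [:- a, 1:])"
  have "P \<noteq> 0" unfolding P_def using fin by (simp add: prod_zero_iff)
  have "degree P = (\<Sum>a\<in>(UNIV :: 'a set). 1)"
    unfolding P_def by (subst degree_prod_eq_sum_degree) auto
  also have "\<dots> > 0" using fin by (simp add: card_gt_0_iff)
  finally have "degree P > 0" .
  then have "degree (P + 1) > 0" by (subst degree_add_eq_left) auto
  then obtain x where "poly (P + 1) x = 0" using alg_closed_imp_poly_has_root by blast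
  moreover have "poly P x = 0" unfolding P_def poly_prod using fin by (auto simp: prod_zero_iff)
  ultimately show False by simp
qed

lemma poly_zero_off_finite:
  fixes P :: "'a::alg_closed_field poly"
  assumes "\<And>t. t \<notin> A \<Longrightarrow> poly P t = 0" "finite A"
  shows "P = 0"
proof (rule ccontr)
  assume "P \<noteq> 0"
  then have "finite {t. poly P t = 0}" by (rule poly_roots_finite)
  moreover have "UNIV \<subseteq> A \<union> {t. poly P t = 0}" using assms by auto
  ultimately show False
    using infinite_alg_closed_field[where 'a='a] assms(2) by (meson finite_UnI finite_subset)
qed

text \<open>
  Irreducibility of affine space: on the line through a non-zero of \<open>p\<close> and a non-zero of \<open>q\<close> both
  restrict to nonzero univariate polynomials, whose product is nonzero.
\<close>

lemma polyfun_mult_nonzero: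
  fixes p q :: "('i \<Rightarrow> 'a::alg_closed_field) \<Rightarrow> 'a"
  assumes p: "p \<in> polyfun I" and q: "q \<in> polyfun I" and "p x \<noteq> 0" "q y \<noteq> 0"
  shows "\<exists>z. p z * q z \<noteq> 0"
proof (rule ccontr)
  assume *: "\<not> ?thesis"
  define c where "c i = [:x i, y i - x i:]" for i
  obtain P where P: "\<And>t. p (\<lambda>i. poly (c i) t) = poly P t"
    using polyfun_along_curve[OF p] by metis
  obtain Q where Q: "\<And>t. q (\<lambda>i. poly (c i) t) = poly Q t"
    using polyfun_along_curve[OF q] by metis
  have "poly (P * Q) t = 0" for t
    using * P[of t, symmetric] Q[of t, symmetric] by simp
  then have "P * Q = 0" by (intro poly_zero_off_finite[of "{}"]) auto
  moreover have "poly P 0 \<noteq> 0" using P[of 0] assms by (simp add: c_def)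
  moreover have "poly Q 1 \<noteq> 0" using Q[of 1] assms by (simp add: c_def)
  ultimately show False by auto
qed

lemma polyfun_prod_nonzero:
  fixes p :: "'k \<Rightarrow> ('i \<Rightarrow> 'a::alg_closed_field) \<Rightarrow> 'a"
  assumes "finite A" "\<And>k. k \<in> A \<Longrightarrow> p k \<in> polyfun I" "\<And>k. k \<in> A \<Longrightarrow> \<exists>x. p k x \<noteq> 0"
  shows "\<exists>z. (\<Prod>k\<in>A. p k z) \<noteq> 0"
  using assms
proof (induction A rule: finite_induct)
  case (insert k A)
  obtain x where x: "p k x \<noteq> 0" using insert.prems(2)[of k] by auto
  obtain y where y: "(\<Prod>k\<in>A. p k y) \<noteq> 0" using insert.IH insert.prems by auto
  have "(\<lambda>z. \<Prod>k\<in>A. p k z) \<in> polyfun I" using insert.prems by (intro polyfun_prod) auto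
  then have "\<exists>z. p k z * (\<Prod>k\<in>A. p k z) \<noteq> 0"
    using polyfun_mult_nonzero[of "p k" I "\<lambda>z. \<Prod>k\<in>A. p k z" x y, OF _ _ x y] insert.prems(1)[of k]
      by simp
  then show ?case using insert.hyps by simp
qed auto

section \<open>Constructible sets and their projections\<close>

text \<open>
  Complements are left out: the elimination of a variable below only produces unions and
  intersections, and the dichotomy is a direct induction on this form.
\<close>

inductive_set constructible :: "'i set \<Rightarrow> ('i \<Rightarrow> 'a::comm_ring_1) set set" for I where
  zero: "p \<in> polyfun I \<Longrightarrow> {x. p x = 0} \<in> constructible I"
| nonzero: "p \<in> polyfun I \<Longrightarrow> {x. p x \<noteq> 0} \<in> constructible I"
| Un: "\<lbrakk>S \<in> constructible I; T \<in> constructible I\<rbrakk> \<Longrightarrow> S \<union> T \<in> constructible I"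
| Int: "\<lbrakk>S \<in> constructible I; T \<in> constructible I\<rbrakk> \<Longrightarrow> S \<inter> T \<in> constructible I"

lemma constructible_UNIV: "UNIV \<in> constructible I"
  using constructible.zero[OF polyfun.const[of 0]] by simp

lemma constructible_empty: "{} \<in> constructible I"
  using constructible.nonzero[OF polyfun.const[of 0]] by simp

lemma constructible_UN:
  "\<lbrakk>finite A; \<And>k. k \<in> A \<Longrightarrow> S k \<in> constructible I\<rbrakk> \<Longrightarrow> (\<Union>k\<in>A. S k) \<in> constructible I"
  by (induction A rule: finite_induct) (auto intro: constructible.Un constructible_empty)

lemma constructible_INT:
  "\<lbrakk>finite A; \<And>k. k \<in> A \<Longrightarrow> S k \<in> constructible I\<rbrakk> \<Longrightarrow> (\<Inter>k\<in>A. S k) \<in> constructible I"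
  by (induction A rule: finite_induct) (auto intro: constructible.Int constructible_UNIV)

text \<open>
  A zero set is everything or is missed by the open set where its equation fails; for unions and
  intersections two nonempty open sets are intersected.
\<close>

lemma constructible_dichotomy:
  fixes S :: "('i \<Rightarrow> 'a::alg_closed_field) set"
  assumes "S \<in> constructible I"
  shows "\<exists>q\<in>polyfun I. (\<exists>x. q x \<noteq> 0) \<and> ({x. q x \<noteq> 0} \<subseteq> S \<or> {x. q x \<noteq> 0} \<inter> S = {})"
  using assms
proof induction
  case (zero p)
  show ?case
  proof (cases "\<exists>x. p x \<noteq> 0")
    case True
    then show ?thesis using zero by (intro bexI[of _ p]) auto
  qed (intro bexI[of _ "\<lambda>_. 1"]; auto intro: polyfun.const)
next
  case (nonzero p)
  show ?case
  proof (cases "\<exists>x. p x \<noteq> 0")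
    case True
    then show ?thesis using nonzero by (intro bexI[of _ p]) auto
  qed (intro bexI[of _ "\<lambda>_. 1"]; auto intro: polyfun.const)
next
  case (Un S T)
  from Un.IH(1) obtain p x where p: "p \<in> polyfun I" "p x \<noteq> 0"
    "{x. p x \<noteq> 0} \<subseteq> S \<or> {x. p x \<noteq> 0} \<inter> S = {}" by (elim bexE conjE exE)
  from Un.IH(2) obtain q y where q: "q \<in> polyfun I" "q y \<noteq> 0"
    "{x. q x \<noteq> 0} \<subseteq> T \<or> {x. q x \<noteq> 0} \<inter> T = {}" by (elim bexE conjE exE)
  show ?case
  proof (intro bexI[of _ "\<lambda>z. p z * q z"] conjI)
    show "\<exists>z. p z * q z \<noteq> 0" by (rule polyfun_mult_nonzero[of p I q x y, OF p(1) q(1) p(2) q(2)])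
    have "{z. p z * q z \<noteq> 0} = {z. p z \<noteq> 0} \<inter> {z. q z \<noteq> 0}" by auto
    then show "{z. p z * q z \<noteq> 0} \<subseteq> S \<union> T \<or> {z. p z * q z \<noteq> 0} \<inter> (S \<union> T) = {}"
      using p(3) q(3) by blast
  qed (intro polyfun.mult p q)
next
  case (Int S T)
  from Int.IH(1) obtain p x where p: "p \<in> polyfun I" "p x \<noteq> 0"
    "{x. p x \<noteq> 0} \<subseteq> S \<or> {x. p x \<noteq> 0} \<inter> S = {}" by (elim bexE conjE exE)
  from Int.IH(2) obtain q y where q: "q \<in> polyfun I" "q y \<noteq> 0"
    "{x. q x \<noteq> 0} \<subseteq> T \<or> {x. q x \<noteq> 0} \<inter> T = {}" by (elim bexE conjE exE)
  show ?case
  proof (intro bexI[of _ "\<lambda>z. p z * q z"] conjI)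
    show "\<exists>z. p z * q z \<noteq> 0" by (rule polyfun_mult_nonzero[of p I q x y, OF p(1) q(1) p(2) q(2)])
    have "{z. p z * q z \<noteq> 0} = {z. p z \<noteq> 0} \<inter> {z. q z \<noteq> 0}" by auto
    then show "{z. p z * q z \<noteq> 0} \<subseteq> S \<inter> T \<or> {z. p z * q z \<noteq> 0} \<inter> (S \<inter> T) = {}"
      using p(3) q(3) by blast
  qed (intro polyfun.mult p q)
qed

text \<open>
  Univariate polynomials whose coefficients are polynomial functions of a point \<open>x\<close>. The bound \<open>N\<close> on
  the number of coefficients is uniform in \<open>x\<close> while the true degree of \<open>F x\<close> may drop, which is why
  the coefficient at \<open>N - 1\<close>, and not the leading coefficient of \<open>F x\<close>, drives the elimination.
\<close>

definition polyfam :: "'i set \<Rightarrow> nat \<Rightarrow> (('i \<Rightarrow> 'a::comm_ring_1) \<Rightarrow> 'a poly) set" where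
  "polyfam I N = {F. (\<forall>k. (\<lambda>x. coeff (F x) k) \<in> polyfun I) \<and> (\<forall>x. \<forall>k\<ge>N. coeff (F x) k = 0)}"

lemma polyfam_coeff: "F \<in> polyfam I N \<Longrightarrow> (\<lambda>x. coeff (F x) k) \<in> polyfun I"
  by (simp add: polyfam_def)

lemma polyfam_mono: "\<lbrakk>F \<in> polyfam I N; N \<le> N'\<rbrakk> \<Longrightarrow> F \<in> polyfam I N'"
  by (auto simp: polyfam_def)

lemma polyfam_add:
  "\<lbrakk>F \<in> polyfam I N; G \<in> polyfam I M\<rbrakk> \<Longrightarrow> (\<lambda>x. F x + G x) \<in> polyfam I (max N M)"
  by (auto simp: polyfam_def intro: polyfun.add)

lemma polyfam_diff:
  "\<lbrakk>F \<in> polyfam I N; G \<in> polyfam I M\<rbrakk> \<Longrightarrow> (\<lambda>x. F x - G x) \<in> polyfam I (max N M)"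
  by (auto simp: polyfam_def intro: polyfun_diff)

lemma polyfam_mult:
  assumes "F \<in> polyfam I N" "G \<in> polyfam I M"
  shows "(\<lambda>x. F x * G x) \<in> polyfam I (N + M)"
proof -
  have "coeff (F x * G x) k = 0" if "k \<ge> N + M" for x k
  proof -
    have "coeff (F x) i * coeff (G x) (k - i) = 0" if "i \<le> k" for i
      using that \<open>k \<ge> N + M\<close> assms by (cases "i \<ge> N") (auto simp: polyfam_def)
    then show ?thesis by (simp add: coeff_mult)
  qed
  moreover have "(\<lambda>x. coeff (F x * G x) k) \<in> polyfun I" for k
    unfolding coeff_mult using assms by (intro polyfun_sum polyfun.mult polyfam_coeff)
  ultimately show ?thesis by (simp add: polyfam_def)
qed

lemma polyfam_monom: "p \<in> polyfun I \<Longrightarrow> (\<lambda>x. monom (p x) m) \<in> polyfam I (Suc m)"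
  by (auto simp: polyfam_def intro!: polyfun_if polyfun.const)

lemma polyfam_smult:
  "\<lbrakk>F \<in> polyfam I N; p \<in> polyfun I\<rbrakk> \<Longrightarrow> (\<lambda>x. smult (p x) (F x)) \<in> polyfam I N"
  by (auto simp: polyfam_def intro: polyfun.mult)

lemma polyfam_power: "F \<in> polyfam I N \<Longrightarrow> \<exists>M. (\<lambda>x. F x ^ n) \<in> polyfam I M"
proof (induction n)
  case 0
  show ?case using polyfam_monom[OF polyfun.const[of 1 I], of 0] by (auto simp: monom_0 one_pCons)
next
  case (Suc n)
  then show ?case using polyfam_mult[of F I N] by auto
qed

lemma polyfam_zero: "F \<in> polyfam I 0 \<Longrightarrow> F x = 0"
  by (auto simp: polyfam_def poly_eq_iff)

lemma polyfam_degree: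
  assumes "F \<in> polyfam I N" "F x \<noteq> 0" shows "degree (F x) < N"
proof (rule ccontr)
  assume "\<not> ?thesis"
  then have "coeff (F x) (degree (F x)) = 0" using assms(1) by (auto simp: polyfam_def)
  with assms(2) show False by simp
qed

lemma polyfam_truncate:
  assumes "F \<in> polyfam I (Suc N)"
  shows "(\<lambda>x. F x - monom (coeff (F x) N) N) \<in> polyfam I N"
proof -
  have "(\<lambda>x. F x - monom (coeff (F x) N) N) \<in> polyfam I (max (Suc N) (Suc N))"
    using assms by (intro polyfam_diff polyfam_monom polyfam_coeff)
  moreover have "coeff (F x - monom (coeff (F x) N) N) k = 0" if "k \<ge> N" for x k
    using assms that by (cases "k = N") (auto simp: polyfam_def)
  ultimately show ?thesis unfolding polyfam_def by blast
qed

lemma polyfam_reduce: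
  assumes F: "F \<in> polyfam I (Suc n)" and H: "H \<in> polyfam I (Suc N)" and "n \<le> N"
  shows "(\<lambda>x. smult (coeff (F x) n) (H x) - monom (coeff (H x) N) (N - n) * F x) \<in> polyfam I N"
    (is "?R \<in> _")
proof -
  have "?R \<in> polyfam I (max (Suc N) (Suc (N - n) + Suc n))"
    using F H by (intro polyfam_diff polyfam_smult polyfam_mult polyfam_monom polyfam_coeff)
  moreover have "coeff (?R x) k = 0" if "k \<ge> N" for x k
  proof (cases "k = N")
    case True
    then show ?thesis using \<open>n \<le> N\<close> by (simp add: coeff_monom_mult)
  next
    case False
    then show ?thesis using that \<open>n \<le> N\<close> F H by (auto simp: coeff_monom_mult polyfam_def)
  qed
  ultimately show ?thesis unfolding polyfam_def by blast
qed

text \<open>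
  Division with remainder without inverting the leading coefficient, so that the remainder is again
  a family with polynomial coefficients.
\<close>

lemma polyfam_pseudo_remainder:
  fixes F H :: "('i \<Rightarrow> 'a::idom) \<Rightarrow> 'a poly"
  assumes F: "F \<in> polyfam I (Suc n)" and H: "H \<in> polyfam I N"
  shows "\<exists>R e. R \<in> polyfam I n \<and> (\<forall>x. F x dvd smult (coeff (F x) n ^ e) (H x) - R x)"
  using H
proof (induction N arbitrary: H)
  case 0
  then show ?case using polyfam_mono[OF 0, of n] by (intro exI[of _ H] exI[of _ 0]) auto
next
  case (Suc N)
  show ?case
  proof (cases "n \<le> N")
    case True
    define H' where "H' = (\<lambda>x. smult (coeff (F x) n) (H x) - monom (coeff (H x) N) (N - n) * F x)"
    have "H' \<in> polyfam I N" unfolding H'_def by (rule polyfam_reduce[OF F Suc.prems True])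
    then obtain R e where R: "R \<in> polyfam I n" "\<And>x. F x dvd smult (coeff (F x) n ^ e) (H' x) - R x"
      using Suc.IH by blast
    have "F x dvd smult (coeff (F x) n ^ Suc e) (H x) - R x" for x
    proof -
      have "smult (coeff (F x) n ^ Suc e) (H x) - R x =
        (smult (coeff (F x) n ^ e) (H' x) - R x) +
        F x * smult (coeff (F x) n ^ e) (monom (coeff (H x) N) (N - n))"
        by (simp add: H'_def algebra_simps smult_diff_right)
      then show ?thesis using R(2)[of x] by (metis dvd_add dvd_triv_left)
    qed
    then show ?thesis using R(1) by blast
  next
    case False
    then show ?thesis using polyfam_mono[OF Suc.prems, of n] by (intro exI[of _ H] exI[of _ 0]) auto
  qed
qed

text \<open>
  All roots of \<open>F\<close> are roots of \<open>G\<close> exactly if every linear factor of \<open>F\<close> divides \<open>G\<close>; the exponent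
  \<open>n\<close> takes care of multiplicities.
\<close>

lemma exists_root_nonroot_iff:
  fixes F G :: "'a::alg_closed_field poly"
  assumes "F \<noteq> 0" "degree F \<le> n"
  shows "(\<exists>t. poly F t = 0 \<and> poly G t \<noteq> 0) \<longleftrightarrow> \<not> F dvd G ^ n"
proof
  assume "\<exists>t. poly F t = 0 \<and> poly G t \<noteq> 0"
  then show "\<not> F dvd G ^ n" by (auto elim!: dvdE simp: poly_power[symmetric] simp del: poly_power)
    (metis poly_power mult_zero_left poly_mult power_not_zero)
next
  assume *: "\<not> F dvd G ^ n"
  show "\<exists>t. poly F t = 0 \<and> poly G t \<noteq> 0"
  proof (rule ccontr)
    assume no: "\<not> ?thesis"
    obtain A where A: "size A = degree F" "F = smult (lead_coeff F) (\<Prod>x\<in>#A. [:-x, 1:])"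
      using alg_closed_imp_factorization[OF assms(1)] by blast
    have "(\<Prod>x\<in>#B. [:-x, 1:]) dvd G ^ size B" if "B \<subseteq># A" for B
      using that
    proof (induction B)
      case (add b B)
      have "b \<in># A" using add.prems by (meson insert_subset_eq_iff)
      then have "[:-b, 1:] dvd F"
        by (subst A(2)) (auto intro!: dvd_smult dvd_prod_mset)
      then have "poly F b = 0" by (simp add: poly_eq_0_iff_dvd)
      then have "[:-b, 1:] dvd G" using no by (auto simp: poly_eq_0_iff_dvd)
      moreover have "(\<Prod>x\<in>#B. [:-x, 1:]) dvd G ^ size B"
        using add.IH add.prems subset_mset.order_trans[of B "add_mset b B" A] by simp
      ultimately show ?case by (simp only: image_mset_add_mset prod_mset.add_mset size_add_mset
        power_Suc mult_dvd_mono)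
    qed simp
    from this[of A] have "(\<Prod>x\<in>#A. [:-x, 1:]) dvd G ^ degree F" using A(1) by simp
    then have "F dvd G ^ degree F"
      by (subst A(2)) (use assms(1) in \<open>simp add: smult_dvd_iff\<close>)
    also have "G ^ degree F dvd G ^ n" using assms(2) by (rule le_imp_power_dvd)
    finally show False using * by simp
  qed
qed

lemma constructible_nonroot_exists:
  fixes G :: "('i \<Rightarrow> 'a::alg_closed_field) \<Rightarrow> 'a poly"
  assumes "G \<in> polyfam I M"
  shows "{x. \<exists>t. poly (G x) t \<noteq> 0} \<in> constructible I"
proof -
  have "(\<exists>t. poly (G x) t \<noteq> 0) \<longleftrightarrow> (\<exists>k<M. coeff (G x) k \<noteq> 0)" for x
  proof -
    have "(\<exists>t. poly (G x) t \<noteq> 0) \<longleftrightarrow> G x \<noteq> 0"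
      using poly_zero_off_finite[of "{}" "G x"] by auto
    also have "\<dots> \<longleftrightarrow> (\<exists>k<M. coeff (G x) k \<noteq> 0)"
      using assms by (auto simp: poly_eq_iff polyfam_def not_less[symmetric])
    finally show ?thesis .
  qed
  then have "{x. \<exists>t. poly (G x) t \<noteq> 0} = (\<Union>k\<in>{..<M}. {x. coeff (G x) k \<noteq> 0})" by auto
  then show ?thesis
    using assms by (auto intro!: constructible_UN constructible.nonzero polyfam_coeff)
qed

lemma constructible_root_nonroot_exists:
  fixes F G :: "('i \<Rightarrow> 'a::alg_closed_field) \<Rightarrow> 'a poly"
  assumes F: "F \<in> polyfam I (Suc n)" and G: "G \<in> polyfam I M"
  shows "{x. coeff (F x) n \<noteq> 0} \<inter> {x. \<exists>t. poly (F x) t = 0 \<and> poly (G x) t \<noteq> 0} \<in> constructible I"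
proof -
  obtain M' where M': "(\<lambda>x. G x ^ n) \<in> polyfam I M'" using polyfam_power[OF G] by blast
  obtain R e where R: "R \<in> polyfam I n"
    and dvd: "\<And>x. F x dvd smult (coeff (F x) n ^ e) (G x ^ n) - R x"
    using polyfam_pseudo_remainder[OF F M'] by blast
  have "(\<exists>t. poly (F x) t = 0 \<and> poly (G x) t \<noteq> 0) \<longleftrightarrow> (\<exists>k<n. coeff (R x) k \<noteq> 0)"
    if a: "coeff (F x) n \<noteq> 0" for x
  proof -
    have F0: "F x \<noteq> 0" using a by auto
    have "degree (F x) = n" using a polyfam_degree[OF F F0] le_degree[OF a] by simp
    then have "(\<exists>t. poly (F x) t = 0 \<and> poly (G x) t \<noteq> 0) \<longleftrightarrow> \<not> F x dvd G x ^ n"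
      using exists_root_nonroot_iff[OF F0] by simp
    also have "F x dvd G x ^ n \<longleftrightarrow> F x dvd smult (coeff (F x) n ^ e) (G x ^ n)"
      using a by (simp add: dvd_smult_iff)
    also have "\<dots> \<longleftrightarrow> F x dvd R x"
      using dvd[of x] by (metis add_diff_cancel_left' diff_add_cancel dvd_diff dvd_add)
    also have "\<dots> \<longleftrightarrow> R x = 0"
      using polyfam_degree[OF R, of x] \<open>degree (F x) = n\<close> dvd_imp_degree_le[of "F x" "R x"]
        by fastforce
    also have "\<dots> \<longleftrightarrow> \<not> (\<exists>k<n. coeff (R x) k \<noteq> 0)"
      using R by (auto simp: poly_eq_iff polyfam_def not_less[symmetric])
    finally show ?thesis by blast
  qed
  then have "{x. coeff (F x) n \<noteq> 0} \<inter> {x. \<exists>t. poly (F x) t = 0 \<and> poly (G x) t \<noteq> 0} =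
      {x. coeff (F x) n \<noteq> 0} \<inter> (\<Union>k\<in>{..<n}. {x. coeff (R x) k \<noteq> 0})" by auto
  then show ?thesis
    using F R by (auto intro!: constructible.Int constructible_UN constructible.nonzero
      polyfam_coeff)
qed

text \<open>
  The Euclidean algorithm with parameters. If two equations are present, the one of larger degree
  bound is reduced modulo the other wherever the top coefficient of the latter is nonzero; where that
  coefficient vanishes, the latter equation has a smaller bound. Either way the sum of the bounds
  drops, until at most one equation is left.
\<close>

lemma constructible_common_root_exists:
  fixes L :: "((('i \<Rightarrow> 'a::alg_closed_field) \<Rightarrow> 'a poly) \<times> nat) list"
  assumes "\<forall>(F, n)\<in>set L. F \<in> polyfam I n" "G \<in> polyfam I M"
  shows "{x. \<exists>t. (\<forall>(F, n)\<in>set L. poly (F x) t = 0) \<and> poly (G x) t \<noteq> 0} \<in> constructible I"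
    (is "?Z L \<in> _")
  using assms(1)
proof (induction "\<Sum>(F, n)\<leftarrow>L. Suc n" arbitrary: L rule: less_induct)
  case less
  note G = assms(2)
  have IH: "?Z L' \<in> constructible I"
    if "(\<Sum>(F, n)\<leftarrow>L'. Suc n) < (\<Sum>(F, n)\<leftarrow>L. Suc n)" "\<forall>(F, n)\<in>set L'. F \<in> polyfam I n" for L'
    using less.hyps that by blast
  have split: "?Z L \<in> constructible I"
    if "p \<in> polyfun I" "S \<in> constructible I" "T \<in> constructible I"
      "\<And>x. p x = 0 \<Longrightarrow> x \<in> ?Z L \<longleftrightarrow> x \<in> S" "\<And>x. p x \<noteq> 0 \<Longrightarrow> x \<in> ?Z L \<longleftrightarrow> x \<in> T" for p S T
  proof -
    have "?Z L = ({x. p x = 0} \<inter> S) \<union> ({x. p x \<noteq> 0} \<inter> T)"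
    proof (rule set_eqI)
      show "x \<in> ?Z L \<longleftrightarrow> x \<in> ({x. p x = 0} \<inter> S) \<union> ({x. p x \<noteq> 0} \<inter> T)" for x
        using that(4,5)[of x] by (cases "p x = 0") simp_all
    qed
    then show ?thesis using that(1-3) by (simp only: constructible.intros)
  qed
  show ?case
  proof (cases L)
    case Nil
    then show ?thesis using constructible_nonroot_exists[OF G] by simp
  next
    case (Cons Fn L1)
    obtain F n where Fn: "Fn = (F, n)" by fastforce
    show ?thesis
    proof (cases L1)
      case Nil
      have L: "L = [(F, n)]" using Cons Fn Nil by simp
      have F: "F \<in> polyfam I n" using less.prems L by simp
      show ?thesis
      proof (cases n)
        case 0
        have "?Z [] \<in> constructible I" by (rule IH) (simp_all add: L)
        then show ?thesis using polyfam_zero[of F] F 0 by (simp add: L)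
      next
        case (Suc m)
        let ?F' = "\<lambda>x. F x - monom (coeff (F x) m) m"
        show ?thesis
        proof (rule split)
          show "(\<lambda>x. coeff (F x) m) \<in> polyfun I" by (rule polyfam_coeff[OF F])
          show "?Z [(?F', m)] \<in> constructible I"
            by (rule IH) (use polyfam_truncate[of F I m] F Suc in \<open>simp_all add: L\<close>)
          show "{x. coeff (F x) m \<noteq> 0} \<inter> {x. \<exists>t. poly (F x) t = 0 \<and> poly (G x) t \<noteq> 0} \<in>
            constructible I"
            using F Suc by (intro constructible_root_nonroot_exists[OF _ G]) simp
        qed (simp_all add: L)
      qed
    next
      case (Cons Hn L2)
      obtain H N where HN: "Hn = (H, N)" by fastforce
      \<comment> \<open>order the first two members by their degree bound\<close>
      obtain F' H' n' N' where FH: "set L = insert (F', n') (insert (H', N') (set L2))" "n' \<le> N'"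
        "(\<Sum>(F, n)\<leftarrow>L. Suc n) = Suc n' + Suc N' + (\<Sum>(F, n)\<leftarrow>L2. Suc n)"
      proof (cases "n \<le> N")
        case True
        show ?thesis by (rule that[of F n H N]) (use \<open>L = Fn # L1\<close> Fn Cons HN True in auto)
      next
        case False
        show ?thesis by (rule that[of H N F n]) (use \<open>L = Fn # L1\<close> Fn Cons HN False in auto)
      qed
      have F: "F' \<in> polyfam I n'" and H: "H' \<in> polyfam I N'"
        and L2: "\<forall>(F, n)\<in>set L2. F \<in> polyfam I n"
        using less.prems unfolding FH(1) by auto
      show ?thesis
      proof (cases n')
        case 0
        have "?Z ((H', N') # L2) \<in> constructible I" by (rule IH) (use FH H L2 in simp_all)
        moreover have "?Z L = ?Z ((H', N') # L2)"
          unfolding FH(1) using polyfam_zero[of F'] F 0 by simp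
        ultimately show ?thesis by simp
      next
        case (Suc m)
        obtain K where K: "N' = Suc K" "m \<le> K" using Suc FH(2) by (cases N') auto
        let ?F = "\<lambda>x. F' x - monom (coeff (F' x) m) m"
        let ?H = "\<lambda>x. smult (coeff (F' x) m) (H' x) - monom (coeff (H' x) K) (K - m) * F' x"
        show ?thesis
        proof (rule split)
          show "(\<lambda>x. coeff (F' x) m) \<in> polyfun I" by (rule polyfam_coeff[OF F])
          show "?Z ((?F, m) # (H', N') # L2) \<in> constructible I"
            by (rule IH) (use FH(3) polyfam_truncate[of F' I m] F H L2 Suc in simp_all)
          show "?Z ((F', n') # (?H, K) # L2) \<in> constructible I"
            by (rule IH) (use FH(3) polyfam_reduce[of F' I m H' K] F H L2 Suc K in simp_all)
          show "x \<in> ?Z L \<longleftrightarrow> x \<in> ?Z ((?F, m) # (H', N') # L2)" if "coeff (F' x) m = 0" for x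
            unfolding FH(1) using that by simp
          show "x \<in> ?Z L \<longleftrightarrow> x \<in> ?Z ((F', n') # (?H, K) # L2)" if a: "coeff (F' x) m \<noteq> 0" for x
          proof -
            have "poly (F' x) t = 0 \<and> poly (H' x) t = 0 \<and> Q \<longleftrightarrow> poly (F' x) t = 0 \<and> poly (?H x) t = 0
              \<and> Q" for t Q
              using a by auto
            then show ?thesis unfolding FH(1) by simp
          qed
        qed
      qed
    qed
  qed
qed

lemma polyfun_as_polyfam:
  fixes p :: "('i \<Rightarrow> 'a::idom) \<Rightarrow> 'a"
  assumes "p \<in> polyfun (insert j I)" "j \<notin> I"
  shows "\<exists>N. \<exists>F\<in>polyfam I N. \<forall>x t. p (x(j := t)) = poly (F x) t"
  using assms(1)
proof induction
  case (const c)
  show ?case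
    by (intro exI[of _ "Suc 0"] bexI[of _ "\<lambda>_. monom c 0"] polyfam_monom polyfun.const)
      (simp add: poly_monom)
next
  case (coord i)
  show ?case
  proof (cases "i = j")
    case True
    show ?thesis
      by (intro exI[of _ "Suc 1"] bexI[of _ "\<lambda>_. monom 1 1"] polyfam_monom polyfun.const)
        (simp add: poly_monom True)
  next
    case False
    then show ?thesis using coord
      by (intro exI[of _ "Suc 0"] bexI[of _ "\<lambda>x. monom (x i) 0"] polyfam_monom polyfun.coord)
        (auto simp add: poly_monom)
  qed
next
  case (add p q)
  then obtain N M F G where *: "F \<in> polyfam I N" "\<And>x t. p (x(j := t)) = poly (F x) t"
    "G \<in> polyfam I M" "\<And>x t. q (x(j := t)) = poly (G x) t" by blast
  show ?case
    by (intro exI[of _ "max N M"] bexI[of _ "\<lambda>x. F x + G x"] polyfam_add allI *(1,3))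
      (simp only: *(2,4) poly_add)
next
  case (mult p q)
  then obtain N M F G where *: "F \<in> polyfam I N" "\<And>x t. p (x(j := t)) = poly (F x) t"
    "G \<in> polyfam I M" "\<And>x t. q (x(j := t)) = poly (G x) t" by blast
  show ?case
    by (intro exI[of _ "N + M"] bexI[of _ "\<lambda>x. F x * G x"] polyfam_mult allI *(1,3))
      (simp only: *(2,4) poly_mult)
qed

text \<open>
  The building blocks of a constructible set: finitely many equations and a single inequation, since
  several inequations can be multiplied together.
\<close>

definition locally_closed_basic :: "'i set \<Rightarrow> ('i \<Rightarrow> 'a::comm_ring_1) set set" where
  "locally_closed_basic I = {{x. (\<forall>p\<in>P. p x = 0) \<and> q x \<noteq> 0} | P q.
     finite P \<and> P \<subseteq> polyfun I \<and> q \<in> polyfun I}"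

lemma constructible_normal_form:
  fixes S :: "('i \<Rightarrow> 'a::idom) set"
  assumes "S \<in> constructible I"
  shows "\<exists>\<B>. finite \<B> \<and> \<B> \<subseteq> locally_closed_basic I \<and> S = \<Union>\<B>"
  using assms
proof induction
  case (zero p)
  have "{x. p x = 0} = {x. (\<forall>p\<in>{p}. p x = 0) \<and> (\<lambda>_. 1) x \<noteq> (0 :: 'a)}" by simp
  then have "{x. p x = 0} \<in> locally_closed_basic I"
    unfolding locally_closed_basic_def using zero polyfun.const[of 1 I]
    by (intro CollectI exI[of _ "{p}"] exI[of _ "\<lambda>_. 1"]) simp
  then show ?case by (intro exI[of _ "{{x. p x = 0}}"]) simp
next
  case (nonzero p)
  have "{x. p x \<noteq> 0} = {x. (\<forall>p\<in>{}. p x = (0 :: 'a)) \<and> p x \<noteq> 0}" by simp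
  then have "{x. p x \<noteq> 0} \<in> locally_closed_basic I"
    unfolding locally_closed_basic_def using nonzero
    by (intro CollectI exI[of _ "{}"] exI[of _ p]) simp
  then show ?case by (intro exI[of _ "{{x. p x \<noteq> 0}}"]) simp
next
  case (Un S T)
  then obtain \<A> \<B> where "finite \<A>" "\<A> \<subseteq> locally_closed_basic I" "S = \<Union>\<A>"
    "finite \<B>" "\<B> \<subseteq> locally_closed_basic I" "T = \<Union>\<B>" by (elim exE conjE)
  then show ?case by (intro exI[of _ "\<A> \<union> \<B>"]) auto
next
  case (Int S T)
  then obtain \<A> \<B> where *: "finite \<A>" "\<A> \<subseteq> locally_closed_basic I" "S = \<Union>\<A>"
    "finite \<B>" "\<B> \<subseteq> locally_closed_basic I" "T = \<Union>\<B>" by (elim exE conjE)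
  have int: "A \<inter> B \<in> locally_closed_basic I"
    if A: "A \<in> locally_closed_basic I" and B: "B \<in> locally_closed_basic I"
      for A B :: "('i \<Rightarrow> 'a) set"
  proof -
    obtain P p where P: "A = {x. (\<forall>p\<in>P. p x = 0) \<and> p x \<noteq> 0}"
      "finite P" "P \<subseteq> polyfun I" "p \<in> polyfun I"
      using A unfolding locally_closed_basic_def by blast
    obtain Q q where Q: "B = {x. (\<forall>p\<in>Q. p x = 0) \<and> q x \<noteq> 0}"
      "finite Q" "Q \<subseteq> polyfun I" "q \<in> polyfun I"
      using B unfolding locally_closed_basic_def by blast
    have "A \<inter> B = {x. (\<forall>p\<in>P \<union> Q. p x = 0) \<and> (\<lambda>x. p x * q x) x \<noteq> 0}" unfolding P(1) Q(1) by auto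
    then show ?thesis unfolding locally_closed_basic_def
      using P(2-) Q(2-) polyfun.mult[OF P(4) Q(4)]
        by (intro CollectI exI[of _ "P \<union> Q"] exI[of _ "\<lambda>x. p x * q x"]) simp
  qed
  have "S \<inter> T = \<Union>((\<lambda>(A, B). A \<inter> B) ` (\<A> \<times> \<B>))" unfolding *(3,6) by auto
  moreover have "(\<lambda>(A, B). A \<inter> B) ` (\<A> \<times> \<B>) \<subseteq> locally_closed_basic I" using int *(2,5) by auto
  moreover have "finite ((\<lambda>(A, B). A \<inter> B) ` (\<A> \<times> \<B>))" using *(1,4) by blast
  ultimately show ?case by blast
qed

lemma constructible_project_one:
  fixes S :: "('i \<Rightarrow> 'a::alg_closed_field) set"
  assumes S: "S \<in> constructible (insert j I)" and j: "j \<notin> I"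
  shows "{x. \<exists>t. x(j := t) \<in> S} \<in> constructible I"
proof -
  obtain \<B> where *: "finite \<B> \<and> \<B> \<subseteq> locally_closed_basic (insert j I) \<and> S = \<Union>\<B>"
    using constructible_normal_form[OF S] by (rule exE)
  note \<B> = *[THEN conjunct1] *[THEN conjunct2, THEN conjunct1] *[THEN conjunct2, THEN conjunct2]
  have "{x. \<exists>t. x(j := t) \<in> B} \<in> constructible I" if "B \<in> \<B>" for B
  proof -
    have "B \<in> locally_closed_basic (insert j I)" using \<B>(2) that by (rule subsetD)
    then obtain P q where B: "B = {x. (\<forall>p\<in>P. p x = 0) \<and> q x \<noteq> 0}"
      and P: "finite P" "P \<subseteq> polyfun (insert j I)" and q: "q \<in> polyfun (insert j I)"
      unfolding locally_closed_basic_def by (elim CollectE exE conjE)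
    have "\<exists>N F. F \<in> polyfam I N \<and> (\<forall>x t. p (x(j := t)) = poly (F x) t)" if "p \<in> P" for p
      using polyfun_as_polyfam[OF subsetD[OF P(2) that] j] unfolding Bex_def .
    then obtain N F where F: "\<And>p. p \<in> P \<Longrightarrow> F p \<in> polyfam I (N p)"
      "\<And>p x t. p \<in> P \<Longrightarrow> p (x(j := t)) = poly (F p x) t" by metis
    obtain G M where G: "G \<in> polyfam I M" "\<And>x t. q (x(j := t)) = poly (G x) t"
      using polyfun_as_polyfam[OF q j] by blast
    obtain ps where ps: "set ps = P" using finite_list[OF P(1)] by blast
    let ?L = "map (\<lambda>p. (F p, N p)) ps"
    have "{x. \<exists>t. (\<forall>(F, n)\<in>set ?L. poly (F x) t = 0) \<and> poly (G x) t \<noteq> 0} \<in> constructible I"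
      by (rule constructible_common_root_exists[OF _ G(1)]) (simp add: ps F(1))
    also have "{x. \<exists>t. (\<forall>(F, n)\<in>set ?L. poly (F x) t = 0) \<and> poly (G x) t \<noteq> 0} =
        {x. \<exists>t. x(j := t) \<in> B}"
      unfolding B by (simp add: ps F(2)[symmetric] G(2) del: fun_upd_apply)
    finally show ?thesis .
  qed
  then have "(\<Union>B\<in>\<B>. {x. \<exists>t. x(j := t) \<in> B}) \<in> constructible I" by (rule constructible_UN[OF \<B>(1)])
  also have "(\<Union>B\<in>\<B>. {x. \<exists>t. x(j := t) \<in> B}) = {x. \<exists>t. x(j := t) \<in> S}" unfolding \<B>(3) by auto
  finally show ?thesis .
qed

text \<open>
  Chevalley's theorem for the projection that forgets the coordinates in \<open>J\<close>.
\<close>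

theorem constructible_project:
  fixes S :: "('i \<Rightarrow> 'a::alg_closed_field) set"
  assumes "finite J" "S \<in> constructible (I \<union> J)" "I \<inter> J = {}"
  shows "{x. \<exists>y. (\<lambda>i. if i \<in> J then y i else x i) \<in> S} \<in> constructible I"
  using assms
proof (induction J arbitrary: S rule: finite_induct)
  case empty
  then show ?case by simp
next
  case (insert j J)
  let ?S' = "{x. \<exists>t. x(j := t) \<in> S}"
  have "?S' \<in> constructible (I \<union> J)"
    by (rule constructible_project_one) (use insert in auto)
  then have "{x. \<exists>y. (\<lambda>i. if i \<in> J then y i else x i) \<in> ?S'} \<in> constructible I"
    using insert by blast
  also have "{x. \<exists>y. (\<lambda>i. if i \<in> J then y i else x i) \<in> ?S'} =
      {x. \<exists>y. (\<lambda>i. if i \<in> insert j J then y i else x i) \<in> S}"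
  proof (intro Collect_cong iffI)
    fix x
    assume "\<exists>y. (\<lambda>i. if i \<in> J then y i else x i) \<in> ?S'"
    then obtain y t where "(\<lambda>i. if i \<in> J then y i else x i)(j := t) \<in> S" by blast
    moreover have "(\<lambda>i. if i \<in> J then y i else x i)(j := t) = (\<lambda>i. if i \<in> insert j J then (y(j :=
      t)) i else x i)"
      by auto
    ultimately show "\<exists>y. (\<lambda>i. if i \<in> insert j J then y i else x i) \<in> S" by metis
  next
    fix x
    assume "\<exists>y. (\<lambda>i. if i \<in> insert j J then y i else x i) \<in> S"
    then obtain y where "(\<lambda>i. if i \<in> insert j J then y i else x i) \<in> S" by blast
    moreover have "(\<lambda>i. if i \<in> J then y i else x i)(j := y j) = (\<lambda>i. if i \<in> insert j J then y i else
      x i)"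
      by auto
    ultimately have "\<exists>t. (\<lambda>i. if i \<in> J then y i else x i)(j := t) \<in> S" by metis
    then show "\<exists>y. (\<lambda>i. if i \<in> J then y i else x i) \<in> ?S'" by blast
  qed
  finally show ?case .
qed

section \<open>Density from tangent directions\<close>

lemma polyfun_expand_along_line:
  fixes p :: "('i \<Rightarrow> 'a::idom) \<Rightarrow> 'a"
  assumes "p \<in> polyfun I"
  shows "\<exists>N. \<exists>F\<in>polyfam I N. \<forall>y t. p (\<lambda>i. b i + t * y i) = poly (F y) t"
  using assms
proof induction
  case (const c)
  show ?case
    by (intro exI[of _ "Suc 0"] bexI[of _ "\<lambda>_. monom c 0"] polyfam_monom polyfun.const)
      (simp add: poly_monom)
next
  case (coord i)
  show ?case
    by (intro exI[of _ "max (Suc 0) (Suc 1)"] bexI[of _ "\<lambda>y. monom (b i) 0 + monom (y i) 1"]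
        polyfam_add polyfam_monom polyfun.const polyfun.coord coord) (simp add: poly_monom)
next
  case (add p q)
  then obtain N M F G where *: "F \<in> polyfam I N" "\<And>y t. p (\<lambda>i. b i + t * y i) = poly (F y) t"
    "G \<in> polyfam I M" "\<And>y t. q (\<lambda>i. b i + t * y i) = poly (G y) t" by blast
  show ?case
    by (intro exI[of _ "max N M"] bexI[of _ "\<lambda>x. F x + G x"] polyfam_add allI *(1,3))
      (simp only: *(2,4) poly_add)
next
  case (mult p q)
  then obtain N M F G where *: "F \<in> polyfam I N" "\<And>y t. p (\<lambda>i. b i + t * y i) = poly (F y) t"
    "G \<in> polyfam I M" "\<And>y t. q (\<lambda>i. b i + t * y i) = poly (G y) t" by blast
  show ?case
    by (intro exI[of _ "N + M"] bexI[of _ "\<lambda>x. F x * G x"] polyfam_mult allI *(1,3))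
      (simp only: *(2,4) poly_mult)
qed

text \<open>
  Expand \<open>p\<close> around \<open>b\<close> and let \<open>m\<close> be the lowest degree with a nonzero homogeneous part. Along a curve
  \<open>b + t y + O(t\<^sup>2)\<close> the coefficient of \<open>t\<^sup>m\<close> in \<open>p\<close> is the value of that part at \<open>y\<close>. Hence \<open>p\<close> cannot
  vanish on curves in all directions \<open>y\<close> unless it is zero. No derivatives of \<open>p\<close> are taken, so the
  characteristic does not matter.
\<close>

lemma polyfun_zero_if_curves_in_all_directions:
  fixes p :: "('i \<Rightarrow> 'a::alg_closed_field) \<Rightarrow> 'a"
  assumes p: "p \<in> polyfun I"
    and curves: "\<And>y. \<exists>Y. (\<forall>i\<in>I. poly (Y i) 0 = y i) \<and> (\<forall>t. p (\<lambda>i. b i + t * poly (Y i) t) = 0)"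
  shows "p x = 0"
proof (rule ccontr)
  assume "p x \<noteq> 0"
  obtain N F where F: "F \<in> polyfam I N" and pF: "\<And>y t. p (\<lambda>i. b i + t * y i) = poly (F y) t"
    using polyfun_expand_along_line[OF p, of b] by blast
  have "poly (F (\<lambda>i. x i - b i)) 1 \<noteq> 0" using pF[of 1 "\<lambda>i. x i - b i"] \<open>p x \<noteq> 0\<close> by simp
  then have "F (\<lambda>i. x i - b i) \<noteq> 0" by auto
  then have ex: "\<exists>m y. coeff (F y) m \<noteq> 0" by (meson leading_coeff_neq_0)
  \<comment> \<open>the lowest degree of a nonzero homogeneous part of \<open>p\<close> at \<open>b\<close>\<close>
  define m where "m = (LEAST m. \<exists>y. coeff (F y) m \<noteq> 0)"
  obtain y where y: "coeff (F y) m \<noteq> 0" using LeastI_ex[OF ex] unfolding m_def by blast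
  have least: "coeff (F z) k = 0" if "k < m" for k z
    using not_less_Least[of k "\<lambda>m. \<exists>y. coeff (F y) m \<noteq> 0"] that unfolding m_def by blast
  obtain Y where Y: "\<And>i. i \<in> I \<Longrightarrow> poly (Y i) 0 = y i" "\<And>t. p (\<lambda>i. b i + t * poly (Y i) t) = 0"
    using curves[of y] by blast
  have "\<exists>C. \<forall>t. coeff (F (\<lambda>i. poly (Y i) t)) k = poly C t" for k
    using polyfun_along_curve[OF polyfam_coeff[OF F]] .
  then obtain C where C: "\<And>k t. coeff (F (\<lambda>i. poly (Y i) t)) k = poly (C k) t" by metis
  have C0: "C k = 0" if "k < m" for k
    by (rule poly_zero_off_finite[of "{}"]) (simp_all add: C[symmetric] least that)
  define R where "R = (\<Sum>k<N. C k * monom 1 k)"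
  have "poly R t = 0" for t
  proof -
    let ?G = "F (\<lambda>i. poly (Y i) t)"
    have "?G = (\<Sum>k<N. monom (coeff ?G k) k)"
      using F by (intro poly_eqI) (auto simp: coeff_sum polyfam_def not_less)
    from arg_cong[OF this, of "\<lambda>p. poly p t"] have "poly ?G t = (\<Sum>k<N. coeff ?G k * t ^ k)"
      by (simp only: poly_sum poly_monom)
    moreover have "poly ?G t = 0" using pF[of t "\<lambda>i. poly (Y i) t"] Y(2)[of t] by simp
    ultimately show ?thesis by (simp add: R_def poly_sum poly_monom C)
  qed
  then have "R = 0" by (intro poly_zero_off_finite[of "{}"]) auto
  then have "0 = coeff R m" by simp
  also have "coeff R m = (\<Sum>k<N. if k = m then coeff (C m) 0 else 0)"
    unfolding R_def coeff_sum
  proof (rule sum.cong)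
    show "coeff (C k * monom 1 k) m = (if k = m then coeff (C m) 0 else 0)" for k
      using C0[of k] by (cases k m rule: linorder_cases)
        (auto simp: mult.commute[of _ "monom 1 _"] coeff_monom_mult)
  qed simp
  also have "\<dots> = coeff (C m) 0"
    using y F by (auto simp: polyfam_def not_less[symmetric])
  also have "\<dots> = coeff (F (\<lambda>i. poly (Y i) 0)) m"
    unfolding C by (rule poly_0_coeff_0[symmetric])
  also have "\<dots> = coeff (F y) m" by (rule polyfun_cong[OF polyfam_coeff[OF F]]) (rule Y(1))
  finally show False using y by simp
qed

section \<open>Images of polynomial maps into a space of larger dimension\<close>

definition monomial_fun :: "'i set \<Rightarrow> ('i \<Rightarrow> nat) \<Rightarrow> ('i \<Rightarrow> 'a::comm_ring_1) \<Rightarrow> 'a" where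
  "monomial_fun I e = (\<lambda>x. \<Prod>i\<in>I. x i ^ e i)"

lemma monomial_fun_polyfun: "monomial_fun I e \<in> polyfun I"
proof -
  have "(\<lambda>x. x i ^ n) \<in> polyfun I" if "i \<in> I" for i n
  proof (induction n)
    case (Suc n)
    then show ?case using polyfun.mult[OF polyfun.coord[OF that] Suc] by simp
  qed (simp add: polyfun.const)
  then show ?thesis unfolding monomial_fun_def by (intro polyfun_prod)
qed

text \<open>
  Bounding each exponent separately, and not the total degree, makes the number of monomials a
  plain power.
\<close>

definition exponent_bounded :: "'i set \<Rightarrow> nat \<Rightarrow> (('i \<Rightarrow> 'a::field) \<Rightarrow> 'a) set" where
  "exponent_bounded I c = fun_vs.span (monomial_fun I ` (I \<rightarrow>\<^sub>E {..c}))"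

lemma monomial_fun_exponent_bounded:
  "e \<in> I \<rightarrow>\<^sub>E {..c} \<Longrightarrow> monomial_fun I e \<in> exponent_bounded I c"
  unfolding exponent_bounded_def by (intro fun_vs.span_base imageI)

lemma exponent_bounded_mono: "c \<le> c' \<Longrightarrow> exponent_bounded I c \<subseteq> exponent_bounded I c'"
  unfolding exponent_bounded_def by (intro fun_vs.span_mono image_mono PiE_mono) auto

lemma exponent_bounded_mult:
  assumes "f \<in> exponent_bounded I c" "g \<in> exponent_bounded I c'"
  shows "(\<lambda>x. f x * g x) \<in> exponent_bounded I (c + c')"
proof -
  have 1: "(\<lambda>x. monomial_fun I e x * g x) \<in> exponent_bounded I (c + c')" if e: "e \<in> I \<rightarrow>\<^sub>E {..c}"
    for e
    using assms(2) unfolding exponent_bounded_def[of I c']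
  proof (induction rule: fun_vs.span_induct_alt)
    case base
    show ?case using fun_vs.span_zero by (simp add: exponent_bounded_def zero_fun_def)
  next
    case (step a u v)
    then obtain e' where e': "e' \<in> I \<rightarrow>\<^sub>E {..c'}" "u = monomial_fun I e'" by auto
    have "(\<lambda>x. monomial_fun I e x * u x) = monomial_fun I (\<lambda>i\<in>I. e i + e' i)"
      unfolding e'(2) by (auto simp: monomial_fun_def power_add prod.distrib intro!: prod.cong)
    moreover have "(\<lambda>i\<in>I. e i + e' i) \<in> I \<rightarrow>\<^sub>E {..c + c'}"
      using e e'(1) by (simp add: restrict_PiE_iff PiE_iff add_mono)
    ultimately have "(\<lambda>x. monomial_fun I e x * u x) \<in> exponent_bounded I (c + c')"
      by (simp only: monomial_fun_exponent_bounded)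
    then have "fscale a (\<lambda>x. monomial_fun I e x * u x) + (\<lambda>x. monomial_fun I e x * v x)
        \<in> exponent_bounded I (c + c')"
      using step.IH unfolding exponent_bounded_def by (intro fun_vs.span_add fun_vs.span_scale)
    moreover have "fscale a (\<lambda>x. monomial_fun I e x * u x) + (\<lambda>x. monomial_fun I e x * v x) =
        (\<lambda>x. monomial_fun I e x * (fscale a u + v) x)"
      by (auto simp: fscale_def algebra_simps)
    ultimately show ?case by simp
  qed
  show ?thesis
    using assms(1) unfolding exponent_bounded_def[of I c]
  proof (induction rule: fun_vs.span_induct_alt)
    case base
    show ?case using fun_vs.span_zero by (simp add: exponent_bounded_def zero_fun_def)
  next
    case (step a u v)
    have "(\<lambda>x. u x * g x) \<in> exponent_bounded I (c + c')" using step.hyps 1 by auto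
    then have "fscale a (\<lambda>x. u x * g x) + (\<lambda>x. v x * g x) \<in> exponent_bounded I (c + c')"
      using step.IH unfolding exponent_bounded_def by (intro fun_vs.span_add fun_vs.span_scale)
    moreover have "fscale a (\<lambda>x. u x * g x) + (\<lambda>x. v x * g x) = (\<lambda>x. (fscale a u + v) x * g x)"
      by (auto simp: fscale_def algebra_simps)
    ultimately show ?case by simp
  qed
qed

lemma exponent_bounded_const:
  fixes a :: "'a::field"
  shows "(\<lambda>_. a) \<in> exponent_bounded I 0"
proof -
  have "monomial_fun I (\<lambda>i\<in>I. 0) = (\<lambda>_. 1 :: 'a)" by (auto simp: monomial_fun_def)
  moreover have "(\<lambda>i\<in>I. 0) \<in> I \<rightarrow>\<^sub>E {..0::nat}" by simp
  ultimately have "(\<lambda>_. 1 :: 'a) \<in> exponent_bounded I 0"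
    by (metis monomial_fun_exponent_bounded)
  then have "fscale a (\<lambda>_. 1) \<in> exponent_bounded I 0"
    unfolding exponent_bounded_def by (rule fun_vs.span_scale)
  then show ?thesis by (simp add: fscale_def)
qed

lemma polyfun_exponent_bounded:
  fixes p :: "('i \<Rightarrow> 'a::field) \<Rightarrow> 'a"
  assumes "finite I" "p \<in> polyfun I"
  shows "\<exists>c. p \<in> exponent_bounded I c"
  using assms(2)
proof induction
  case (const a)
  then show ?case using exponent_bounded_const by blast
next
  case (coord i)
  have "monomial_fun I (\<lambda>k\<in>I. if k = i then 1 else 0) = (\<lambda>x. x i :: 'a)"
    using coord assms(1) by (simp add: monomial_fun_def if_distrib[of "power _"] prod.delta cong:
      if_cong)
  moreover have "(\<lambda>k\<in>I. if k = i then 1 else 0) \<in> I \<rightarrow>\<^sub>E {..1::nat}" by (simp add: restrict_PiE_iff)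
  ultimately have "(\<lambda>x. x i :: 'a) \<in> exponent_bounded I 1"
    by (metis monomial_fun_exponent_bounded)
  then show ?case by blast
next
  case (add p q)
  then obtain c c' where "p \<in> exponent_bounded I c" "q \<in> exponent_bounded I c'" by blast
  then have "p \<in> exponent_bounded I (max c c')" "q \<in> exponent_bounded I (max c c')"
    using exponent_bounded_mono[of c "max c c'" I] exponent_bounded_mono[of c' "max c c'" I] by auto
  then have "p + q \<in> exponent_bounded I (max c c')"
    unfolding exponent_bounded_def by (rule fun_vs.span_add)
  then show ?case unfolding plus_fun_def by blast
next
  case (mult p q)
  then show ?case using exponent_bounded_mult by blast
qed

lemma exponent_bounded_power:
  assumes "f \<in> exponent_bounded I c" shows "(\<lambda>x. f x ^ n) \<in> exponent_bounded I (c * n)"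
proof (induction n)
  case (Suc n)
  then show ?case using exponent_bounded_mult[OF assms Suc] by simp
qed (simp add: exponent_bounded_const)

lemma exponent_bounded_prod:
  assumes "\<And>m. m \<in> A \<Longrightarrow> f m \<in> exponent_bounded I c"
  shows "(\<lambda>x. \<Prod>m\<in>A. f m x) \<in> exponent_bounded I (c * card A)"
  using assms
proof (induction A rule: infinite_finite_induct)
  case (insert m A)
  have "f m \<in> exponent_bounded I c" "(\<lambda>x. \<Prod>m\<in>A. f m x) \<in> exponent_bounded I (c * card A)"
    using insert.prems insert.IH by blast+
  from exponent_bounded_mult[OF this] show ?case using insert.hyps by simp
qed (simp_all add: exponent_bounded_const)

text \<open>
  By induction on the set of variables: for fixed values of the other variables the sum is a
  univariate polynomial that vanishes identically, so each of its coefficients vanishes.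
\<close>

lemma monomial_funs_independent:
  fixes \<alpha> :: "('i \<Rightarrow> nat) \<Rightarrow> 'a::alg_closed_field"
  assumes "finite I" "\<And>x. (\<Sum>e\<in>I \<rightarrow>\<^sub>E {..<D}. \<alpha> e * monomial_fun I e x) = 0" "e \<in> I \<rightarrow>\<^sub>E {..<D}"
  shows "\<alpha> e = 0"
  using assms
proof (induction I arbitrary: \<alpha> e rule: finite_induct)
  case empty
  then show ?case by (simp add: monomial_fun_def)
next
  case (insert i I)
  have eq: "insert i I \<rightarrow>\<^sub>E {..<D} = (\<lambda>(k, g). g(i := k)) ` ({..<D} \<times> (I \<rightarrow>\<^sub>E {..<D}))"
    by (rule PiE_insert_eq[of i I "\<lambda>_. {..<D}"])
  have inj: "inj_on (\<lambda>(k, g). g(i := k)) ({..<D} \<times> (I \<rightarrow>\<^sub>E {..<D}))"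
    by (rule inj_combinator[of i I "\<lambda>_. {..<D}"]) (rule insert.hyps(2))
  have zero: "(\<Sum>g\<in>I \<rightarrow>\<^sub>E {..<D}. \<alpha> (g(i := k)) * monomial_fun I g x) = 0" if "k < D" for k x
  proof -
    define P where "P = (\<Sum>k<D. monom (\<Sum>g\<in>I \<rightarrow>\<^sub>E {..<D}. \<alpha> (g(i := k)) * monomial_fun I g x) k)"
    have mon: "monomial_fun (insert i I) (g(i := k)) (x(i := t)) = t ^ k * monomial_fun I g x"
      for g k t
    proof -
      have "(\<Prod>a\<in>I. (x(i := t)) a ^ (g(i := k)) a) = (\<Prod>a\<in>I. x a ^ g a)"
        using insert.hyps(2) by (intro prod.cong) auto
      then show ?thesis using insert.hyps by (simp add: monomial_fun_def)
    qed
    have "poly P t = 0" for t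
    proof -
      have "poly P t = (\<Sum>k<D. \<Sum>g\<in>I \<rightarrow>\<^sub>E {..<D}.
          \<alpha> (g(i := k)) * monomial_fun (insert i I) (g(i := k)) (x(i := t)))"
        by (simp add: P_def poly_sum poly_monom mon sum_distrib_right mult.assoc)
          (simp add: mult.commute)
      also have "\<dots> = (\<Sum>e\<in>insert i I \<rightarrow>\<^sub>E {..<D}. \<alpha> e * monomial_fun (insert i I) e (x(i := t)))"
        unfolding eq sum.reindex[OF inj] sum.cartesian_product by (rule sum.cong) auto
      finally show ?thesis using insert.prems(1) by simp
    qed
    then have "P = 0" by (intro poly_zero_off_finite[of "{}"]) auto
    moreover have "coeff P k = (\<Sum>g\<in>I \<rightarrow>\<^sub>E {..<D}. \<alpha> (g(i := k)) * monomial_fun I g x)"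
      using that by (simp add: P_def coeff_sum)
    ultimately show ?thesis by simp
  qed
  obtain k g where kg: "k < D" "g \<in> I \<rightarrow>\<^sub>E {..<D}" "e = g(i := k)"
    using insert.prems(2) unfolding eq by auto
  show ?case using insert.IH[OF zero[OF kg(1)] kg(2)] kg(3) by simp
qed

text \<open>
  There are \<open>D ^ card M\<close> monomials in the target coordinates with exponents below \<open>D\<close>. Composed with
  \<open>F\<close> they lie in a space of dimension \<open>O(D ^ card J)\<close>, so for large \<open>D\<close> they become linearly
  dependent, and a dependency is a polynomial that vanishes on the image.
\<close>

theorem polynomial_image_in_hypersurface:
  fixes F :: "'m \<Rightarrow> ('j \<Rightarrow> 'a::alg_closed_field) \<Rightarrow> 'a"
  assumes fin: "finite J" "finite M" and less: "card J < card M"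
    and F: "\<And>m. m \<in> M \<Longrightarrow> F m \<in> polyfun J"
  shows "\<exists>P\<in>polyfun M. (\<exists>y. P y \<noteq> 0) \<and> (\<forall>x. P (\<lambda>m. F m x) = 0)"
proof -
  have "\<forall>m\<in>M. \<exists>c. F m \<in> exponent_bounded J c"
    using polyfun_exponent_bounded[OF fin(1) F] by blast
  then obtain c' where c': "\<And>m. m \<in> M \<Longrightarrow> F m \<in> exponent_bounded J (c' m)" by metis
  define c where "c = (\<Sum>m\<in>M. c' m)"
  have c: "F m \<in> exponent_bounded J c" if "m \<in> M" for m
    using c'[OF that] exponent_bounded_mono[of "c' m" c J] member_le_sum[of m M c'] fin that
    unfolding c_def by auto
  define b where "b = card M"
  \<comment> \<open>large enough for \<open>(c D b + 1) ^ card J < D ^ card M\<close>\<close>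
  define D where "D = Suc ((c * b + 1) ^ card J)"
  let ?E = "M \<rightarrow>\<^sub>E {..<D}"
  let ?G = "\<lambda>e x. \<Prod>m\<in>M. F m x ^ e m"
  let ?B = "monomial_fun J ` (J \<rightarrow>\<^sub>E {..c * D * b}) :: (('j \<Rightarrow> 'a) \<Rightarrow> 'a) set"
  have finE: "finite ?E" using fin by (simp add: finite_PiE)
  have finB: "finite ?B" using fin by (simp add: finite_PiE)
  have G: "?G e \<in> fun_vs.span ?B" if e: "e \<in> ?E" for e
  proof -
    have "(\<lambda>x. F m x ^ e m) \<in> exponent_bounded J (c * D)" if "m \<in> M" for m
    proof -
      have "e m < D" using e that by (auto simp: PiE_iff)
      then have "c * e m \<le> c * D" by simp
      then show ?thesis
        using exponent_bounded_power[OF c[OF that], of "e m"] exponent_bounded_mono[of "c * e m" "c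
          * D" J] by blast
    qed
    from exponent_bounded_prod[of M "\<lambda>m x. F m x ^ e m" J "c * D", OF this]
    show ?thesis unfolding b_def exponent_bounded_def .
  qed
  have "card ?B \<le> card (J \<rightarrow>\<^sub>E {..c * D * b})" using fin by (intro card_image_le finite_PiE) auto
  also have "\<dots> = (c * D * b + 1) ^ card J" using fin by (simp add: card_PiE)
  also have "\<dots> \<le> (D * (c * b + 1)) ^ card J"
    by (intro power_mono) (auto simp: D_def algebra_simps)
  also have "\<dots> = D ^ card J * (c * b + 1) ^ card J" by (rule power_mult_distrib)
  also have "\<dots> < D ^ card J * D" by (intro mult_strict_left_mono) (auto simp: D_def)
  also have "\<dots> = D ^ Suc (card J)" by simp
  also have "\<dots> \<le> D ^ card M" using less by (intro power_increasing) (auto simp: D_def)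
  also have "\<dots> = card ?E" using fin by (simp add: card_PiE)
  finally have card: "card ?B < card ?E" .
  have "\<exists>\<alpha>. (\<exists>e\<in>?E. \<alpha> e \<noteq> 0) \<and> (\<forall>x. (\<Sum>e\<in>?E. \<alpha> e * ?G e x) = 0)"
  proof (cases "inj_on ?G ?E")
    case True
    have "fun_vs.dependent (?G ` ?E)"
    proof (rule ccontr)
      assume "fun_vs.independent (?G ` ?E)"
      then have "card (?G ` ?E) \<le> card ?B"
        using fun_vs.independent_span_bound[OF finB, of "?G ` ?E"] G by blast
      then show False using card card_image[OF True] by simp
    qed
    then obtain u where u: "\<exists>v\<in>?G ` ?E. u v \<noteq> 0" "(\<Sum>v\<in>?G ` ?E. fscale (u v) v) = 0"
      using fun_vs.dependent_finite[of "?G ` ?E"] finE by auto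
    have "(\<Sum>e\<in>?E. u (?G e) * ?G e x) = 0" for x
    proof -
      have "(\<Sum>e\<in>?E. fscale (u (?G e)) (?G e)) = 0" using u(2) unfolding sum.reindex[OF True] by simp
      from fun_cong[OF this, of x] show ?thesis by (simp add: sum_fun_apply fscale_def)
    qed
    then show ?thesis using u(1) by (intro exI[of _ "\<lambda>e. u (?G e)"]) auto
  next
    case False
    then obtain e1 e2 where e: "e1 \<in> ?E" "e2 \<in> ?E" "e1 \<noteq> e2" "?G e1 = ?G e2"
      unfolding inj_on_def by blast
    let ?\<alpha> = "\<lambda>e. (if e = e1 then 1 else 0) - (if e = e2 then 1 else 0) :: 'a"
    have "(\<Sum>e\<in>?E. ?\<alpha> e * ?G e x) = 0" for x
    proof -
      have "(\<Sum>e\<in>?E. ?\<alpha> e * ?G e x) =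
          (\<Sum>e\<in>?E. if e = e1 then ?G e1 x else 0) - (\<Sum>e\<in>?E. if e = e2 then ?G e2 x else 0)"
        unfolding sum_subtractf[symmetric] by (rule sum.cong) auto
      then show ?thesis using e finE fun_cong[OF e(4), of x] by simp
    qed
    then show ?thesis using e by (intro exI[of _ ?\<alpha>]) auto
  qed
  then obtain \<alpha> e where \<alpha>: "e \<in> ?E" "\<alpha> e \<noteq> 0" "\<And>x. (\<Sum>e\<in>?E. \<alpha> e * ?G e x) = 0" by blast
  define P where "P = (\<lambda>y. \<Sum>e\<in>?E. \<alpha> e * monomial_fun M e y)"
  have "P \<in> polyfun M"
    unfolding P_def by (intro polyfun_sum polyfun.mult polyfun.const monomial_fun_polyfun)
  moreover have "\<exists>y. P y \<noteq> 0"
    using monomial_funs_independent[OF fin(2), of \<alpha> D e] \<alpha> unfolding P_def by blast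
  moreover have "P (\<lambda>m. F m x) = 0" for x using \<alpha>(3)[of x] by (simp add: P_def monomial_fun_def)
  ultimately show ?thesis by blast
qed

section \<open>Spanning is an open condition\<close>

text \<open>
  Gaussian elimination with parameters: a pivot that is nonzero at \<open>x0\<close> reduces the number of
  coordinates by one, and \<open>q\<close> is the product of the pivots.
\<close>

lemma spanning_open:
  fixes v :: "'j \<Rightarrow> ('p \<Rightarrow> 'a::field) \<Rightarrow> 'i \<Rightarrow> 'a"
  assumes "finite I" "finite J" "\<And>j i. j \<in> J \<Longrightarrow> i \<in> I \<Longrightarrow> (\<lambda>x. v j x i) \<in> polyfun P"
    and "\<And>T. \<exists>c. \<forall>i\<in>I. T i = (\<Sum>j\<in>J. c j * v j x0 i)"
  shows "\<exists>q\<in>polyfun P. q x0 \<noteq> 0 \<and> (\<forall>x. q x \<noteq> 0 \<longrightarrow> (\<forall>T. \<exists>c. \<forall>i\<in>I. T i = (\<Sum>j\<in>J. c j * v j x i)))"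
  using assms(1,3,4)
proof (induction I arbitrary: v rule: finite_induct)
  case empty
  show ?case by (rule bexI[of _ "\<lambda>_. 1"]) (auto intro: polyfun.const)
next
  case (insert k I)
  obtain c where "\<forall>i\<in>insert k I. 1 = (\<Sum>j\<in>J. c j * v j x0 i)"
    using insert.prems(2)[of "\<lambda>_. 1"] by (rule exE)
  then have "1 = (\<Sum>j\<in>J. c j * v j x0 k)" by (rule bspec) simp
  then have "(\<Sum>j\<in>J. c j * v j x0 k) \<noteq> 0" by simp
  then obtain l where l: "l \<in> J" "v l x0 k \<noteq> 0" by (rule sum.not_neutral_contains_not_neutral) simp
  \<comment> \<open>clear coordinate \<open>k\<close> in all vectors with the pivot \<open>v l x k\<close>\<close>
  define w where "w j x i = v l x k * v j x i - v j x k * v l x i" for j x i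
  have wP: "(\<lambda>x. w j x i) \<in> polyfun P" if "j \<in> J" "i \<in> I" for j i
    unfolding w_def using that l by (intro polyfun_diff polyfun.mult insert.prems(1)) auto
  have w0: "\<exists>c. \<forall>i\<in>I. T i = (\<Sum>j\<in>J. c j * w j x0 i)" for T
  proof -
    obtain c where c: "\<And>i. i \<in> insert k I \<Longrightarrow> (if i = k then 0 else T i / v l x0 k) = (\<Sum>j\<in>J. c j * v j
      x0 i)"
      using insert.prems(2)[of "\<lambda>i. if i = k then 0 else T i / v l x0 k"] by blast
    have "T i = (\<Sum>j\<in>J. c j * w j x0 i)" if "i \<in> I" for i
    proof -
      have "(\<Sum>j\<in>J. c j * w j x0 i) =
          v l x0 k * (\<Sum>j\<in>J. c j * v j x0 i) - (\<Sum>j\<in>J. c j * v j x0 k) * v l x0 i"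
        unfolding sum_distrib_left sum_distrib_right sum_subtractf[symmetric]
        by (rule sum.cong) (auto simp: w_def algebra_simps)
      also have "\<dots> = T i"
      proof -
        have "i \<noteq> k" using that insert.hyps(2) by auto
        then have "(\<Sum>j\<in>J. c j * v j x0 i) = T i / v l x0 k" "(\<Sum>j\<in>J. c j * v j x0 k) = 0"
          using c[of i] c[of k] that by simp_all
        then show ?thesis using l(2) by simp
      qed
      finally show ?thesis by simp
    qed
    then show ?thesis by blast
  qed
  obtain q where q: "q \<in> polyfun P" "q x0 \<noteq> 0"
    "\<And>x T. q x \<noteq> 0 \<Longrightarrow> \<exists>c. \<forall>i\<in>I. T i = (\<Sum>j\<in>J. c j * w j x i)"
    using insert.IH[OF wP w0] by blast
  have "\<exists>c. \<forall>i\<in>insert k I. T i = (\<Sum>j\<in>J. c j * v j x i)" if "q x * v l x k \<noteq> 0" for x T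
  proof -
    let ?a = "v l x k"
    have a: "?a \<noteq> 0" "q x \<noteq> 0" using that by auto
    obtain c where c: "\<And>i. i \<in> I \<Longrightarrow> T i - T k / ?a * v l x i = (\<Sum>j\<in>J. c j * w j x i)"
      using q(3)[OF a(2), of "\<lambda>i. T i - T k / ?a * v l x i"] by blast
    \<comment> \<open>the multiple of the pivot vector that corrects coordinate \<open>k\<close>\<close>
    let ?b = "T k / ?a - (\<Sum>j\<in>J. c j * v j x k)"
    let ?c = "\<lambda>j. ?a * c j + (if j = l then ?b else 0)"
    have sum: "(\<Sum>j\<in>J. ?c j * v j x i) = ?a * (\<Sum>j\<in>J. c j * v j x i) + ?b * v l x i" for i
    proof -
      have "(\<Sum>j\<in>J. ?c j * v j x i) =
          (\<Sum>j\<in>J. ?a * (c j * v j x i)) + (\<Sum>j\<in>J. if j = l then ?b * v l x i else 0)"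
        unfolding sum.distrib[symmetric] by (rule sum.cong) (auto simp: algebra_simps)
      then show ?thesis using assms(2) l(1) by (simp add: sum_distrib_left)
    qed
    have "T i = (\<Sum>j\<in>J. ?c j * v j x i)" if "i \<in> insert k I" for i
    proof (cases "i = k")
      case True
      then show ?thesis unfolding sum using a by (simp add: algebra_simps)
    next
      case False
      have "(\<Sum>j\<in>J. c j * w j x i) =
          ?a * (\<Sum>j\<in>J. c j * v j x i) - (\<Sum>j\<in>J. c j * v j x k) * v l x i"
        unfolding sum_distrib_left sum_distrib_right sum_subtractf[symmetric]
        by (rule sum.cong) (auto simp: w_def algebra_simps)
      then show ?thesis unfolding sum using c[of i] that False by (simp add: algebra_simps)
    qed
    then show ?thesis by (intro exI[of _ ?c] ballI)
  qed
  moreover have "(\<lambda>x. q x * v l x k) \<in> polyfun P"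
    using q(1) insert.prems(1)[of l k] l by (intro polyfun.mult) auto
  ultimately show ?case using q(2) l(2) by (intro bexI[of _ "\<lambda>x. q x * v l x k"]) simp_all
qed

section \<open>Coordinates on the symmetric power\<close>

text \<open>
  If \<open>T\<close> is read as the homogeneous polynomial that it represents in the symmetric power, then
  \<open>sym_coord T is\<close> is the coefficient of the monomial with indices \<open>is\<close>.
\<close>

definition sym_coord :: "(nat list \<Rightarrow> 'a::field) \<Rightarrow> nat list \<Rightarrow> 'a" where
  "sym_coord T is = (\<Sum>js | mset js = mset is. T js)"

definition sorted_indices :: "nat \<Rightarrow> nat \<Rightarrow> nat list set" where
  "sorted_indices n d = {is \<in> multi_indices n d. sorted is}"

text \<open>
  The representative of a symmetric class that is supported on sorted index lists; \<open>c\<close> lists its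
  coordinates.
\<close>

definition sorted_tensor :: "nat \<Rightarrow> nat \<Rightarrow> (nat list \<Rightarrow> 'a::field) \<Rightarrow> nat list \<Rightarrow> 'a" where
  "sorted_tensor n d c = (\<lambda>is. if is \<in> sorted_indices n d then c is else 0)"

definition unit_rep :: "nat \<Rightarrow> nat \<Rightarrow> nat list \<Rightarrow> 'a::field" where
  "unit_rep r d = (\<Sum>i<r. pure_tensor (replicate d (basis_vec i)))"

definition index_tensor :: "nat list \<Rightarrow> nat list \<Rightarrow> 'a::field" where
  "index_tensor is = (\<lambda>js. if js = is then 1 else 0)"

lemma finite_sorted_indices: "finite (sorted_indices n d)"
  by (simp add: sorted_indices_def finite_multi_indices)

lemma finite_same_mset: "finite {js. mset js = mset is}"
proof (rule finite_subset)
  show "{js. mset js = mset is} \<subseteq> {js. set js \<subseteq> set is \<and> length js = length is}"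
    by (auto dest: mset_eq_setD mset_eq_length)
qed (simp add: finite_lists_length_eq)

lemma mset_multi_indices:
  "mset is = mset js \<Longrightarrow> is \<in> multi_indices n d \<longleftrightarrow> js \<in> multi_indices n d"
  by (auto simp: multi_indices_def dest: mset_eq_setD mset_eq_length)

lemma sort_in_sorted_indices: "sort is \<in> sorted_indices n d \<longleftrightarrow> is \<in> multi_indices n d"
  by (simp add: sorted_indices_def mset_multi_indices[of "sort is" "is"])

lemma sym_coord_add: "sym_coord (S + T) = sym_coord S + sym_coord T"
  by (simp add: sym_coord_def fun_eq_iff sum.distrib)

lemma sym_coord_fscale: "sym_coord (fscale c T) = fscale c (sym_coord T)"
  by (simp add: sym_coord_def fun_eq_iff fscale_def sum_distrib_left)

lemma sym_coord_diff: "sym_coord (S - T) = sym_coord S - sym_coord T"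
  by (simp add: sym_coord_def fun_eq_iff sum_subtractf)

lemma sym_coord_zero: "sym_coord 0 = 0"
  by (simp add: sym_coord_def fun_eq_iff)

lemma sym_coord_outside:
  assumes "T \<in> tensors n d" "is \<notin> multi_indices n d"
  shows "sym_coord T is = 0"
  unfolding sym_coord_def
proof (rule sum.neutral, rule ballI)
  fix js assume "js \<in> {js. mset js = mset is}"
  then have "js \<notin> multi_indices n d" using assms(2) mset_multi_indices[of js "is" n d] by simp
  then show "T js = 0" using assms(1) by (simp add: tensors_def)
qed

lemma sym_coord_permute_tensor:
  assumes \<sigma>: "\<sigma> permutes {..<d}" and T: "T \<in> tensors n d"
  shows "sym_coord (permute_tensor \<sigma> T) = sym_coord T"
proof
  fix "is"
  show "sym_coord (permute_tensor \<sigma> T) is = sym_coord T is"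
  proof (cases "is \<in> multi_indices n d")
    case True
    then have len: "length is = d" by (simp add: multi_indices_def)
    let ?A = "{js. mset js = mset is}"
    have A: "js \<in> multi_indices n d" if "js \<in> ?A" for js
      using that True mset_multi_indices[of js "is" n d] by simp
    have "permute_list \<sigma> ` ?A \<subseteq> ?A"
      using \<sigma> A by (auto simp: multi_indices_def)
    moreover have inj: "inj_on (permute_list \<sigma>) ?A"
      using bij_betw_permute_list_multi_indices[OF \<sigma>, of n] A
      unfolding bij_betw_def by (meson inj_on_subset subsetI)
    ultimately have "permute_list \<sigma> ` ?A = ?A"
      using endo_inj_surj[OF finite_same_mset] by blast
    then have "bij_betw (permute_list \<sigma>) ?A ?A" using inj by (simp add: bij_betw_def)
    from sum.reindex_bij_betw[OF this, of T] show ?thesis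
      by (simp add: sym_coord_def permute_tensor_def)
  next
    case False
    then show ?thesis
      using sym_coord_outside[OF T] sym_coord_outside[OF permute_tensor_in_tensors[OF \<sigma> T]] by simp
  qed
qed

lemma sym_coord_sym_relations:
  assumes "T \<in> sym_relations n d"
  shows "sym_coord T = 0"
  using assms unfolding sym_relations_def
proof (induction rule: fun_vs.span_induct_alt)
  case base
  show ?case by (rule sym_coord_zero)
next
  case (step c x y)
  then have "sym_coord x = 0"
    by (auto simp: sym_coord_diff sym_coord_permute_tensor)
  then show ?case using step.IH
    by (simp only: sym_coord_add sym_coord_fscale fun_vs.scale_zero_right add_0_right)
qed

lemma index_tensor_in_tensors: "is \<in> multi_indices n d \<Longrightarrow> index_tensor is \<in> tensors n d"
  by (auto simp: index_tensor_def tensors_def)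

lemma sym_relations_sum:
  "(\<And>k. k \<in> A \<Longrightarrow> T k \<in> sym_relations n d) \<Longrightarrow> (\<Sum>k\<in>A. T k) \<in> sym_relations n d"
  unfolding sym_relations_def by (rule fun_vs.span_sum)

lemma sym_relations_fscale: "T \<in> sym_relations n d \<Longrightarrow> fscale c T \<in> sym_relations n d"
  unfolding sym_relations_def by (rule fun_vs.span_scale)

lemma sym_relations_add:
  "\<lbrakk>S \<in> sym_relations n d; T \<in> sym_relations n d\<rbrakk> \<Longrightarrow> S + T \<in> sym_relations n d"
  unfolding sym_relations_def by (rule fun_vs.span_add)

lemma sym_relations_diff:
  "\<lbrakk>S \<in> sym_relations n d; T \<in> sym_relations n d\<rbrakk> \<Longrightarrow> S - T \<in> sym_relations n d"
  unfolding sym_relations_def by (rule fun_vs.span_diff)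

lemma sym_relations_zero: "0 \<in> sym_relations n d"
  unfolding sym_relations_def by (rule fun_vs.span_zero)

lemma index_tensor_equiv:
  assumes "mset is = mset js" "is \<in> multi_indices n d"
  shows "index_tensor is - index_tensor js \<in> sym_relations n d"
proof -
  have len: "length is = d" "length js = d"
    using assms mset_multi_indices[OF assms(1), of n d] by (auto simp: multi_indices_def)
  obtain \<sigma> where \<sigma>: "\<sigma> permutes {..<d}" "permute_list \<sigma> js = is"
    using mset_eq_permutation[OF assms(1)] len by metis
  have eq: "index_tensor js = permute_tensor \<sigma> (index_tensor is)"
  proof
    fix ks
    have "permute_list \<sigma> ks = is \<longleftrightarrow> ks = js"
    proof
      assume *: "permute_list \<sigma> ks = is"
      then have "mset ks = mset is" using \<sigma>(1) len by (metis length_permute_list mset_permute_list)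
      then have "ks \<in> multi_indices n d" "js \<in> multi_indices n d"
        using assms mset_multi_indices[of ks "is" n d] mset_multi_indices[of js "is" n d] by auto
      then show "ks = js"
        using bij_betw_permute_list_multi_indices[OF \<sigma>(1), of n] \<sigma>(2) *
        unfolding bij_betw_def inj_on_def by metis
    qed (use \<sigma>(2) in simp)
    then show "index_tensor js ks = permute_tensor \<sigma> (index_tensor is) ks"
      by (simp add: permute_tensor_def index_tensor_def)
  qed
  show ?thesis
    unfolding sym_relations_def eq
    using \<sigma>(1) index_tensor_in_tensors[OF assms(2)] by (intro fun_vs.span_base) blast
qed

lemma tensor_expand:
  assumes "T \<in> tensors n d"
  shows "T = (\<Sum>is\<in>multi_indices n d. fscale (T is) (index_tensor is))"
proof
  fix js
  have "(\<Sum>is\<in>multi_indices n d. fscale (T is) (index_tensor is)) js =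
      (\<Sum>is\<in>multi_indices n d. if is = js then T js else 0)"
    unfolding sum_fun_apply by (rule sum.cong) (auto simp: fscale_def index_tensor_def)
  then show "T js = (\<Sum>is\<in>multi_indices n d. fscale (T is) (index_tensor is)) js"
    using assms by (auto simp: finite_multi_indices tensors_def)
qed

lemma sorted_tensor_in_tensors: "sorted_tensor n d c \<in> tensors n d"
  by (auto simp: sorted_tensor_def tensors_def sorted_indices_def)

lemma sorted_tensor_expand:
  "sorted_tensor n d c = (\<Sum>is\<in>sorted_indices n d. fscale (c is) (index_tensor is))"
proof
  fix js
  have "(\<Sum>is\<in>sorted_indices n d. fscale (c is) (index_tensor is)) js =
      (\<Sum>is\<in>sorted_indices n d. if is = js then c js else 0)"
    unfolding sum_fun_apply by (rule sum.cong) (auto simp: fscale_def index_tensor_def)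
  then show "sorted_tensor n d c js = (\<Sum>is\<in>sorted_indices n d. fscale (c is) (index_tensor is)) js"
    by (auto simp: finite_sorted_indices sorted_tensor_def)
qed

lemma sorted_tensor_sym_coord:
  assumes "T \<in> tensors n d"
  shows "sorted_tensor n d (sym_coord T) = (\<Sum>is\<in>multi_indices n d. fscale (T is) (index_tensor (sort
    is)))"
proof
  fix js
  have "(\<Sum>is\<in>multi_indices n d. fscale (T is) (index_tensor (sort is))) js =
      (\<Sum>is\<in>multi_indices n d. if sort is = js then T is else 0)"
    unfolding sum_fun_apply by (rule sum.cong) (auto simp: fscale_def index_tensor_def)
  also have "\<dots> = (\<Sum>is | is \<in> multi_indices n d \<and> sort is = js. T is)"
    by (simp add: sum.inter_filter[symmetric] finite_multi_indices)
  also have "\<dots> = sorted_tensor n d (sym_coord T) js"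
  proof (cases "js \<in> sorted_indices n d")
    case True
    then have js: "js \<in> multi_indices n d" "sorted js" by (simp_all add: sorted_indices_def)
    have "is \<in> multi_indices n d \<and> sort is = js \<longleftrightarrow> mset is = mset js" for "is"
    proof
      assume "mset is = mset js"
      then show "is \<in> multi_indices n d \<and> sort is = js"
        using js mset_multi_indices[of "is" js n d] properties_for_sort[of js "is"] by simp
    qed (metis mset_sort)
    then have "{is. is \<in> multi_indices n d \<and> sort is = js} = {is. mset is = mset js}" by simp
    then show ?thesis using True by (simp add: sorted_tensor_def sym_coord_def)
  next
    case False
    then have "{is. is \<in> multi_indices n d \<and> sort is = js} = {}"
      using sort_in_sorted_indices by blast
    then show ?thesis using False by (simp add: sorted_tensor_def del: Collect_empty_eq)
  qed
  finally show "sorted_tensor n d (sym_coord T) js =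
      (\<Sum>is\<in>multi_indices n d. fscale (T is) (index_tensor (sort is))) js" by simp
qed

lemma tensor_equiv_sorted_tensor:
  assumes "T \<in> tensors n d"
  shows "T - sorted_tensor n d (sym_coord T) \<in> sym_relations n d"
proof -
  have "T - sorted_tensor n d (sym_coord T) =
      (\<Sum>is\<in>multi_indices n d. fscale (T is) (index_tensor is) - fscale (T is) (index_tensor (sort
        is)))"
    by (simp only: sum_subtractf sorted_tensor_sym_coord[OF assms] tensor_expand[OF assms,
      symmetric])
  also have "\<dots> = (\<Sum>is\<in>multi_indices n d. fscale (T is) (index_tensor is - index_tensor (sort is)))"
    by (rule sum.cong) (auto simp: fscale_def fun_eq_iff algebra_simps)
  also have "\<dots> \<in> sym_relations n d"
    by (intro sym_relations_sum sym_relations_fscale index_tensor_equiv) auto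
  finally show ?thesis .
qed

lemma sym_coord_sorted_tensor:
  assumes "is \<in> sorted_indices n d"
  shows "sym_coord (sorted_tensor n d c) is = c is"
proof -
  have "js = is" if "mset js = mset is" "js \<in> sorted_indices n d" for js
    using that assms by (metis (no_types, lifting) mem_Collect_eq properties_for_sort
      sorted_indices_def)
  then have "sym_coord (sorted_tensor n d c) is = (\<Sum>js | mset js = mset is. if js = is then c is
    else 0)"
    unfolding sym_coord_def sorted_tensor_def using assms by (intro sum.cong) auto
  then show ?thesis by (simp add: finite_same_mset)
qed

lemma sym_class_eq_iff:
  assumes "S \<in> tensors n d" "T \<in> tensors n d"
  shows "sym_class n d S = sym_class n d T \<longleftrightarrow> S - T \<in> sym_relations n d"
proof -
  have "sym_class n d S = sym_class n d T \<longleftrightarrow> (S, T) \<in> sym_equiv n d"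
    unfolding sym_class_def by (rule eq_equiv_class_iff[OF equiv_sym_equiv assms])
  then show ?thesis using assms by (simp add: sym_equiv_def)
qed

lemma sym_class_eq_iff_coords:
  assumes "S \<in> tensors n d" "T \<in> tensors n d"
  shows "sym_class n d S = sym_class n d T \<longleftrightarrow> (\<forall>is\<in>sorted_indices n d. sym_coord S is = sym_coord T
    is)"
proof
  assume "sym_class n d S = sym_class n d T"
  then have "sym_coord (S - T) = 0" using sym_class_eq_iff[OF assms] sym_coord_sym_relations
    by blast
  then show "\<forall>is\<in>sorted_indices n d. sym_coord S is = sym_coord T is" by (simp add: sym_coord_diff)
next
  assume "\<forall>is\<in>sorted_indices n d. sym_coord S is = sym_coord T is"
  then have "sorted_tensor n d (sym_coord S) = sorted_tensor n d (sym_coord T)"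
    by (simp add: sorted_tensor_def fun_eq_iff)
  then have "S - T = (S - sorted_tensor n d (sym_coord S)) - (T - sorted_tensor n d (sym_coord T))"
    by simp
  also have "\<dots> \<in> sym_relations n d"
    by (intro sym_relations_diff tensor_equiv_sorted_tensor assms)
  finally show "sym_class n d S = sym_class n d T" using sym_class_eq_iff[OF assms] by simp
qed

lemma sym_power_cases:
  assumes "f \<in> sym_power n d"
  obtains T where "T \<in> tensors n d" "f = sym_class n d T"
  using assms unfolding sym_power_def sym_class_def by (rule quotientE) blast

lemma sym_class_in_sym_power: "T \<in> tensors n d \<Longrightarrow> sym_class n d T \<in> sym_power n d"
  unfolding sym_power_def sym_class_def by (rule quotientI)

section \<open>Polynomial functions on the symmetric power\<close>

lemma tensors_sum: "(\<And>k. k \<in> A \<Longrightarrow> T k \<in> tensors n d) \<Longrightarrow> (\<Sum>k\<in>A. T k) \<in> tensors n d"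
  by (rule fun_vs.subspace_sum[OF subspace_tensors])

lemma tensors_fscale: "T \<in> tensors n d \<Longrightarrow> fscale c T \<in> tensors n d"
  by (rule fun_vs.subspace_scale[OF subspace_tensors])

lemma tensors_add: "\<lbrakk>S \<in> tensors n d; T \<in> tensors n d\<rbrakk> \<Longrightarrow> S + T \<in> tensors n d"
  by (rule fun_vs.subspace_add[OF subspace_tensors])

lemma tensors_diff: "\<lbrakk>S \<in> tensors n d; T \<in> tensors n d\<rbrakk> \<Longrightarrow> S - T \<in> tensors n d"
  by (rule fun_vs.subspace_diff[OF subspace_tensors])

lemma sym_functional_sum:
  assumes l: "l \<in> sym_functionals n d" and "finite A" "\<And>k. k \<in> A \<Longrightarrow> T k \<in> tensors n d"
  shows "l (sym_class n d (\<Sum>k\<in>A. T k)) = (\<Sum>k\<in>A. l (sym_class n d (T k)))"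
  using assms(2,3)
proof (induction A rule: finite_induct)
  case empty
  have z: "0 \<in> tensors n d" by (simp add: tensors_def)
  have "l (sym_class n d (0 + 0)) = l (sym_class n d 0) + l (sym_class n d 0)"
    using l z unfolding sym_functionals_def by blast
  then have "l (sym_class n d 0) = 0" by (simp only: add_0_right add_cancel_right_right)
  then show ?case by (simp only: sum.empty)
next
  case (insert k A)
  have "l (sym_class n d (T k + (\<Sum>k\<in>A. T k))) = l (sym_class n d (T k)) + l (sym_class n d (\<Sum>k\<in>A. T
    k))"
    using l insert.prems tensors_sum[of A T n d] unfolding sym_functionals_def by blast
  moreover have "l (sym_class n d (\<Sum>k\<in>A. T k)) = (\<Sum>k\<in>A. l (sym_class n d (T k)))"
    by (rule insert.IH) (rule insert.prems, simp)
  ultimately show ?case by (simp only: sum.insert[OF insert.hyps])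
qed

lemma polynomial_function_in_coords:
  fixes P :: "(nat list \<Rightarrow> 'a::field) set \<Rightarrow> 'a"
  assumes "P \<in> polynomial_functions n d"
  shows "\<exists>p\<in>polyfun (sorted_indices n d). \<forall>T\<in>tensors n d. P (sym_class n d T) = p (sym_coord T)"
  using assms
proof induction
  case (const c)
  show ?case by (intro bexI[of _ "\<lambda>_. c"] polyfun.const) simp
next
  case (functional l)
  let ?p = "\<lambda>c. \<Sum>is\<in>sorted_indices n d. c is * l (sym_class n d (index_tensor is))"
  have "l (sym_class n d T) = ?p (sym_coord T)" if T: "T \<in> tensors n d" for T
  proof -
    have idx: "(index_tensor is :: nat list \<Rightarrow> 'a) \<in> tensors n d" if "is \<in> sorted_indices n d"
      for "is"
      using that by (intro index_tensor_in_tensors) (simp add: sorted_indices_def)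
    have "sym_class n d T = sym_class n d (sorted_tensor n d (sym_coord T))"
      using sym_class_eq_iff[OF T sorted_tensor_in_tensors] tensor_equiv_sorted_tensor[OF T] by simp
    then have "l (sym_class n d T) =
        (\<Sum>is\<in>sorted_indices n d. l (sym_class n d (fscale (sym_coord T is) (index_tensor is))))"
      by (simp only: sorted_tensor_expand
          sym_functional_sum[OF functional finite_sorted_indices tensors_fscale[OF idx]])
    also have "\<dots> = ?p (sym_coord T)"
      using functional idx unfolding sym_functionals_def by (intro sum.cong) auto
    finally show ?thesis .
  qed
  then show ?case by (intro bexI[of _ ?p]) (auto intro!: polyfun_intros)
next
  case (add P Q)
  then obtain p q where "p \<in> polyfun (sorted_indices n d)" "q \<in> polyfun (sorted_indices n d)"
    "\<forall>T\<in>tensors n d. P (sym_class n d T) = p (sym_coord T)"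
    "\<forall>T\<in>tensors n d. Q (sym_class n d T) = q (sym_coord T)" by (elim bexE)
  then show ?case by (intro bexI[of _ "\<lambda>c. p c + q c"] polyfun.add) simp_all
next
  case (mult P Q)
  then obtain p q where "p \<in> polyfun (sorted_indices n d)" "q \<in> polyfun (sorted_indices n d)"
    "\<forall>T\<in>tensors n d. P (sym_class n d T) = p (sym_coord T)"
    "\<forall>T\<in>tensors n d. Q (sym_class n d T) = q (sym_coord T)" by (elim bexE)
  then show ?case by (intro bexI[of _ "\<lambda>c. p c * q c"] polyfun.mult) simp_all
qed

text \<open>
  Conversely to the previous lemma, each coordinate is a linear functional on the symmetric power,
  hence a polynomial function in the sense of the Zariski topology.
\<close>

lemma sym_coord_functional:
  fixes n d :: nat and "is" :: "nat list"
  shows "\<exists>l\<in>sym_functionals n d :: ((nat list \<Rightarrow> 'a::field) set \<Rightarrow> 'a) set.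
    \<forall>T\<in>tensors n d. l (sym_class n d T) = sym_coord T is"
proof -
  define l :: "(nat list \<Rightarrow> 'a) set \<Rightarrow> 'a"
    where "l f = sym_coord (SOME T. T \<in> tensors n d \<and> f = sym_class n d T) is" for f
  have l: "l (sym_class n d T) = sym_coord T is" if T: "T \<in> tensors n d" for T
  proof -
    define S where "S = (SOME S. S \<in> tensors n d \<and> sym_class n d T = sym_class n d S)"
    have S: "S \<in> tensors n d" "sym_class n d T = sym_class n d S"
      unfolding S_def by (rule someI2[of _ T], use T in simp_all)+
    then have "sym_coord (T - S) = 0" using sym_class_eq_iff[OF T S(1)] sym_coord_sym_relations
      by blast
    then show ?thesis by (simp add: l_def S_def[symmetric] sym_coord_diff)
  qed
  have scale: "l (sym_class n d (fscale c T)) = c * l (sym_class n d T)" if "T \<in> tensors n d"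
    for c T
    unfolding l[OF that] l[OF tensors_fscale[OF that]] sym_coord_fscale by (simp add: fscale_def)
  have "l (sym_class n d (S + T)) = l (sym_class n d S) + l (sym_class n d T)"
    if "S \<in> tensors n d" "T \<in> tensors n d" for S T
    unfolding l[OF that(1)] l[OF that(2)] l[OF tensors_add[OF that]] sym_coord_add by simp
  with scale have "l \<in> sym_functionals n d" by (simp add: sym_functionals_def)
  then show ?thesis using l by blast
qed

lemma polyfun_as_polynomial_function:
  fixes p :: "(nat list \<Rightarrow> 'a::field) \<Rightarrow> 'a"
  assumes "p \<in> polyfun I"
  shows "\<exists>P\<in>polynomial_functions n d. \<forall>T\<in>tensors n d. P (sym_class n d T) = p (sym_coord T)"
  using assms
proof induction
  case (const c)
  show ?case by (intro bexI[of _ "\<lambda>_. c"] polynomial_functions.const) simp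
next
  case (coord i)
  show ?case using sym_coord_functional[of n d i] polynomial_functions.functional by blast
next
  case (add p q)
  then obtain P Q where "P \<in> polynomial_functions n d" "Q \<in> polynomial_functions n d"
    "\<forall>T\<in>tensors n d. P (sym_class n d T) = p (sym_coord T)"
    "\<forall>T\<in>tensors n d. Q (sym_class n d T) = q (sym_coord T)" by (elim bexE)
  then show ?case by (intro bexI[of _ "\<lambda>c. P c + Q c"] polynomial_functions.add) simp_all
next
  case (mult p q)
  then obtain P Q where "P \<in> polynomial_functions n d" "Q \<in> polynomial_functions n d"
    "\<forall>T\<in>tensors n d. P (sym_class n d T) = p (sym_coord T)"
    "\<forall>T\<in>tensors n d. Q (sym_class n d T) = q (sym_coord T)" by (elim bexE)
  then show ?case by (intro bexI[of _ "\<lambda>c. P c * Q c"] polynomial_functions.mult) simp_all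
qed

section \<open>The loci of tensors that restrict to a unit tensor\<close>

text \<open>
  The points are the coordinates of symmetric tensors, so that this is a subset of an affine space.
\<close>

definition subrank_locus :: "nat \<Rightarrow> nat \<Rightarrow> nat \<Rightarrow> (nat list \<Rightarrow> 'a::field) set" where
  "subrank_locus n d r = {c. \<exists>\<phi>\<in>linear_maps n r.
     sym_class r d (tensor_map n d \<phi> (sorted_tensor n d c)) = sym_class r d (unit_rep r d)}"

lemma unit_rep_in_tensors: "unit_rep r d \<in> tensors r d"
  unfolding unit_rep_def
proof (rule tensors_sum)
  fix i assume "i \<in> {..<r}"
  then show "pure_tensor (replicate d (basis_vec i)) \<in> tensors r d"
    by (intro pure_tensor_in_tensors) (auto simp: set_replicate_conv_if basis_vec_in_Kn)
qed

lemma unit_tensor_eq: "unit_tensor r d = sym_class r d (unit_rep r d)"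
  by (simp only: unit_tensor_def unit_rep_def)

lemma sym_class_sorted_tensor:
  "T \<in> tensors n d \<Longrightarrow> sym_class n d (sorted_tensor n d (sym_coord T)) = sym_class n d T"
  using sym_class_eq_iff[OF _ sorted_tensor_in_tensors] tensor_equiv_sorted_tensor by metis

lemma restricts_to_unit_iff:
  fixes T :: "nat list \<Rightarrow> 'a::field"
  assumes T: "T \<in> tensors n d"
  shows "(\<exists>\<phi>\<in>linear_maps n r. sym_map n r d \<phi> (sym_class n d T) = unit_tensor r d) \<longleftrightarrow>
    sym_coord T \<in> subrank_locus n d r"
proof -
  have "sym_map n r d \<phi> (sym_class n d T) =
      sym_class r d (tensor_map n d \<phi> (sorted_tensor n d (sym_coord T)))"
    if "\<phi> \<in> linear_maps n r" for \<phi>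
    using sym_map_class[OF that sorted_tensor_in_tensors, of d "sym_coord T"]
      sym_class_sorted_tensor[OF T] by simp
  then show ?thesis unfolding subrank_locus_def unit_tensor_eq by auto
qed

lemma tensor_map_sum:
  "tensor_map n d \<phi> (\<Sum>k\<in>A. T k) = (\<Sum>k\<in>A. tensor_map n d \<phi> (T k))"
proof -
  interpret L: Vector_Spaces.linear fscale fscale "tensor_map n d \<phi>" by (rule linear_tensor_map)
  show ?thesis by (rule L.sum)
qed

lemma tensor_map_fscale: "tensor_map n d \<phi> (fscale c T) = fscale c (tensor_map n d \<phi> T)"
proof -
  interpret L: Vector_Spaces.linear fscale fscale "tensor_map n d \<phi>" by (rule linear_tensor_map)
  show ?thesis by (rule L.scale)
qed

lemma tensor_map_add: "tensor_map n d \<phi> (S + T) = tensor_map n d \<phi> S + tensor_map n d \<phi> T"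
proof -
  interpret L: Vector_Spaces.linear fscale fscale "tensor_map n d \<phi>" by (rule linear_tensor_map)
  show ?thesis by (rule L.add)
qed

lemma linear_maps_comp:
  assumes "\<phi> \<in> linear_maps n r" "\<psi> \<in> linear_maps r q"
  shows "(\<lambda>v. \<psi> (\<phi> v)) \<in> linear_maps n q"
  using assms unfolding linear_maps_def by simp

lemma tensor_map_comp:
  assumes \<phi>: "\<phi> \<in> linear_maps n r" and \<psi>: "\<psi> \<in> linear_maps r q"
  shows "tensor_map r d \<psi> (tensor_map n d \<phi> T) = tensor_map n d (\<lambda>v. \<psi> (\<phi> v)) T"
proof -
  have "tensor_map r d \<psi> (tensor_map n d \<phi> T) = (\<Sum>is\<in>multi_indices n d.
      fscale (T is) (tensor_map r d \<psi> (pure_tensor (map (\<lambda>i. \<phi> (basis_vec i)) is))))"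
    unfolding tensor_map_def[of n d \<phi> T] by (simp only: tensor_map_sum tensor_map_fscale)
  also have "\<dots> = (\<Sum>is\<in>multi_indices n d.
      fscale (T is) (pure_tensor (map (\<lambda>i. \<psi> (\<phi> (basis_vec i))) is)))"
  proof (rule sum.cong[OF refl])
    fix "is" assume mi: "is \<in> multi_indices n d"
    have "set (map (\<lambda>i. \<phi> (basis_vec i)) is) \<subseteq> Kn r"
      using mi \<phi> by (auto simp: multi_indices_def linear_maps_def basis_vec_in_Kn)
    moreover have "length (map (\<lambda>i. \<phi> (basis_vec i)) is) = d"
      using mi by (simp add: multi_indices_def)
    ultimately show "fscale (T is) (tensor_map r d \<psi> (pure_tensor (map (\<lambda>i. \<phi> (basis_vec i)) is))) =
        fscale (T is) (pure_tensor (map (\<lambda>i. \<psi> (\<phi> (basis_vec i))) is))"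
      by (simp add: tensor_map_pure_tensor[OF \<psi>] comp_def)
  qed
  finally show ?thesis by (simp only: tensor_map_def[of n d "\<lambda>v. \<psi> (\<phi> v)"])
qed

text \<open>
  If \<open>T\<close> restricts to the unit tensor along \<open>\<phi>\<close>, then the image of \<open>T\<close> along any \<open>\<psi> \<circ> \<phi>\<close> is a sum of \<open>r\<close>
  powers of vectors. Three maps \<open>\<psi>\<close> will be used: coordinate projections, evaluations at a point,
    and
  left inverses of \<open>\<phi>\<close> on pivots.
\<close>

lemma unit_image_under_map:
  fixes T :: "nat list \<Rightarrow> 'a::field"
  assumes \<phi>: "\<phi> \<in> linear_maps n r" and \<psi>: "\<psi> \<in> linear_maps r q" and T: "T \<in> tensors n d"
    and eq: "sym_class r d (tensor_map n d \<phi> T) = sym_class r d (unit_rep r d)"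
  shows "sym_class q d (tensor_map n d (\<lambda>v. \<psi> (\<phi> v)) T) =
    sym_class q d (\<Sum>i<r. pure_tensor (replicate d (\<psi> (basis_vec i))))"
proof -
  have "sym_class q d (tensor_map n d (\<lambda>v. \<psi> (\<phi> v)) T) = sym_class q d (tensor_map r d \<psi> (unit_rep r
    d))"
    using sym_map_class[OF \<psi> tensor_map_in_tensors[OF \<phi>], of d T]
      sym_map_class[OF \<psi> unit_rep_in_tensors, of d] eq tensor_map_comp[OF \<phi> \<psi>, of d T] by metis
  also have "tensor_map r d \<psi> (unit_rep r d) = (\<Sum>i<r. tensor_map r d \<psi> (pure_tensor (replicate d
    (basis_vec i))))"
    unfolding unit_rep_def by (rule tensor_map_sum)
  also have "\<dots> = (\<Sum>i<r. pure_tensor (replicate d (\<psi> (basis_vec i))))"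
  proof (rule sum.cong[OF refl])
    fix i assume "i \<in> {..<r}"
    then show "tensor_map r d \<psi> (pure_tensor (replicate d (basis_vec i))) =
        pure_tensor (replicate d (\<psi> (basis_vec i)))"
      by (subst tensor_map_pure_tensor[OF \<psi>]) (auto simp: set_replicate_conv_if basis_vec_in_Kn)
  qed
  finally show ?thesis .
qed

definition truncate_vec :: "nat \<Rightarrow> (nat \<Rightarrow> 'a::zero) \<Rightarrow> nat \<Rightarrow> 'a" where
  "truncate_vec r v = (\<lambda>i. if i < r then v i else 0)"

lemma truncate_vec_linear: "truncate_vec r \<in> linear_maps n r"
  by (auto simp: linear_maps_def Kn_def truncate_vec_def fscale_def fun_eq_iff)

lemma pure_tensor_zero: "d > 0 \<Longrightarrow> pure_tensor (replicate d (\<lambda>_. 0)) = (\<lambda>_. 0)"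
  by (auto simp: pure_tensor_def fun_eq_iff)

lemma subrank_locus_antimono:
  fixes c :: "nat list \<Rightarrow> 'a::field"
  assumes "r' \<le> r" "d > 0" "c \<in> subrank_locus n d r"
  shows "c \<in> subrank_locus n d r'"
proof -
  obtain \<phi> where \<phi>: "\<phi> \<in> linear_maps n r"
    "sym_class r d (tensor_map n d \<phi> (sorted_tensor n d c)) = sym_class r d (unit_rep r d)"
    using assms(3) unfolding subrank_locus_def by blast
  have "(\<Sum>i<r. pure_tensor (replicate d (truncate_vec r' (basis_vec i)))) =
      (unit_rep r' d :: nat list \<Rightarrow> 'a)"
    unfolding unit_rep_def
  proof (rule sum.mono_neutral_cong_right)
    show "\<forall>i\<in>{..<r} - {..<r'}. pure_tensor (replicate d (truncate_vec r' (basis_vec i))) = (0 :: nat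
      list \<Rightarrow> 'a)"
    proof
      fix i assume "i \<in> {..<r} - {..<r'}"
      then have "truncate_vec r' (basis_vec i) = (\<lambda>_. 0 :: 'a)"
        by (auto simp: truncate_vec_def basis_vec_def)
      then show "pure_tensor (replicate d (truncate_vec r' (basis_vec i))) = (0 :: nat list \<Rightarrow> 'a)"
        using pure_tensor_zero[OF assms(2)] by (simp add: zero_fun_def)
    qed
    fix i assume "i \<in> {..<r'}"
    then have "truncate_vec r' (basis_vec i) = (basis_vec i :: nat \<Rightarrow> 'a)"
      by (auto simp: truncate_vec_def basis_vec_def)
    then show "pure_tensor (replicate d (truncate_vec r' (basis_vec i))) =
        (pure_tensor (replicate d (basis_vec i)) :: nat list \<Rightarrow> 'a)" by simp
  qed (use assms(1) in auto)
  then have "sym_class r' d (tensor_map n d (\<lambda>v. truncate_vec r' (\<phi> v)) (sorted_tensor n d c)) =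
      sym_class r' d (unit_rep r' d)"
    using unit_image_under_map[OF \<phi>(1) truncate_vec_linear sorted_tensor_in_tensors \<phi>(2), of r']
      by simp
  then show ?thesis
    unfolding subrank_locus_def using linear_maps_comp[OF \<phi>(1) truncate_vec_linear[of r' r]]
      by blast
qed

lemma subrank_locus_zero:
  assumes d: "d > 0"
  shows "subrank_locus n d 0 = (UNIV :: (nat list \<Rightarrow> 'a::field) set)"
proof -
  have "tensors 0 d = {\<lambda>_. 0 :: 'a}"
    using d by (auto simp: tensors_def multi_indices_def fun_eq_iff)
  then have "tensor_map n d (truncate_vec 0) T = (unit_rep 0 d :: nat list \<Rightarrow> 'a)" for T
    using tensor_map_in_tensors[OF truncate_vec_linear[of 0 n], of d T] unit_rep_in_tensors[of 0 d]
    by (metis singletonD)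
  then show ?thesis unfolding subrank_locus_def
    using truncate_vec_linear[of 0 n] by (intro set_eqI
      iffI UNIV_I CollectI bexI[of _ "truncate_vec 0"]) simp_all
qed

definition matrix_map :: "nat \<Rightarrow> nat \<Rightarrow> (nat \<Rightarrow> nat \<Rightarrow> 'a::field) \<Rightarrow> (nat \<Rightarrow> 'a) \<Rightarrow> nat \<Rightarrow> 'a" where
  "matrix_map n r A v = (\<lambda>j. if j < r then \<Sum>i<n. v i * A i j else 0)"

lemma matrix_map_linear: "matrix_map n r A \<in> linear_maps n r"
  by (auto simp: linear_maps_def Kn_def matrix_map_def fscale_def fun_eq_iff distrib_right
      sum.distrib sum_distrib_left mult.assoc)

lemma matrix_map_basis_vec:
  "i < n \<Longrightarrow> matrix_map n r A (basis_vec i) j = (if j < r then A i j else 0)"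
  by (simp add: matrix_map_def basis_vec_def if_distrib[of "\<lambda>x. x * _"] cong: if_cong)

lemma tensor_map_cong:
  assumes "\<And>i. i < n \<Longrightarrow> \<phi> (basis_vec i) = \<psi> (basis_vec i)"
  shows "tensor_map n d \<phi> T = tensor_map n d \<psi> T"
proof -
  have "map (\<lambda>i. \<phi> (basis_vec i)) is = map (\<lambda>i. \<psi> (basis_vec i)) is" if "is \<in> multi_indices n d"
    for "is"
    using that assms by (auto simp: multi_indices_def)
  then show ?thesis unfolding tensor_map_def by (intro sum.cong refl) (simp only:)
qed

lemma subrank_locus_matrix:
  fixes c :: "nat list \<Rightarrow> 'a::field"
  shows "c \<in> subrank_locus n d r \<longleftrightarrow> (\<exists>A. \<forall>js\<in>sorted_indices r d.
    sym_coord (tensor_map n d (matrix_map n r A) (sorted_tensor n d c)) js = sym_coord (unit_rep r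
      d) js)"
proof -
  have eq: "sym_class r d (tensor_map n d \<phi> (sorted_tensor n d c)) = sym_class r d (unit_rep r d) \<longleftrightarrow>
      (\<forall>js\<in>sorted_indices r d.
        sym_coord (tensor_map n d \<phi> (sorted_tensor n d c)) js = sym_coord (unit_rep r d) js)"
    if "\<phi> \<in> linear_maps n r" for \<phi>
    by (rule sym_class_eq_iff_coords[OF tensor_map_in_tensors[OF that] unit_rep_in_tensors])
  show ?thesis
  proof
    assume "c \<in> subrank_locus n d r"
    then obtain \<phi> where \<phi>: "\<phi> \<in> linear_maps n r"
      "sym_class r d (tensor_map n d \<phi> (sorted_tensor n d c)) = sym_class r d (unit_rep r d)"
      unfolding subrank_locus_def by blast
    have "tensor_map n d \<phi> T = tensor_map n d (matrix_map n r (\<lambda>i. \<phi> (basis_vec i))) T" for T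
    proof (rule tensor_map_cong)
      fix i assume i: "i < n"
      then have "\<phi> (basis_vec i) \<in> Kn r"
        using \<phi>(1) basis_vec_in_Kn[OF i] unfolding linear_maps_def by blast
      then show "\<phi> (basis_vec i) = matrix_map n r (\<lambda>i. \<phi> (basis_vec i)) (basis_vec i)"
        using i by (auto simp: matrix_map_basis_vec Kn_def fun_eq_iff)
    qed
    then show "\<exists>A. \<forall>js\<in>sorted_indices r d.
      sym_coord (tensor_map n d (matrix_map n r A) (sorted_tensor n d c)) js = sym_coord (unit_rep r
        d) js"
      using \<phi>(2) eq[OF \<phi>(1)] by metis
  next
    assume "\<exists>A. \<forall>js\<in>sorted_indices r d.
      sym_coord (tensor_map n d (matrix_map n r A) (sorted_tensor n d c)) js = sym_coord (unit_rep r
        d) js"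
    then obtain A where "sym_class r d (tensor_map n d (matrix_map n r A) (sorted_tensor n d c)) =
        sym_class r d (unit_rep r d)"
      using eq[OF matrix_map_linear] by blast
    then show "c \<in> subrank_locus n d r"
      unfolding subrank_locus_def using matrix_map_linear[of n r A] by blast
  qed
qed

lemma sym_coord_tensor_map:
  assumes "length js = d"
  shows "sym_coord (tensor_map n d \<phi> T) js = (\<Sum>ks | mset ks = mset js.
    \<Sum>is\<in>multi_indices n d. T is * (\<Prod>k<d. \<phi> (basis_vec (is ! k)) (ks ! k)))"
  unfolding sym_coord_def
proof (rule sum.cong[OF refl])
  fix ks assume "ks \<in> {ks. mset ks = mset js}"
  then have "length ks = d" using assms by (auto dest: mset_eq_length)
  then show "tensor_map n d \<phi> T ks =
      (\<Sum>is\<in>multi_indices n d. T is * (\<Prod>k<d. \<phi> (basis_vec (is ! k)) (ks ! k)))"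
    by (simp add: tensor_map_apply)
qed

text \<open>
  The matrix entries of \<open>\<phi>\<close> become the coordinates \<open>Inr (i, j)\<close> next to the coordinates \<open>Inl is\<close> of the
  tensor. The condition that \<open>\<phi>\<close> produces the unit tensor is algebraic in both, and the locus is the
  projection that forgets the matrix.
\<close>

lemma subrank_locus_dichotomy:
  "\<exists>q\<in>polyfun (sorted_indices n d). (\<exists>c. q c \<noteq> 0) \<and>
    ({c. q c \<noteq> 0} \<subseteq> subrank_locus n d r \<or>
     {c. q c \<noteq> 0} \<inter> (subrank_locus n d r :: (nat list \<Rightarrow> 'a::alg_closed_field) set) = {})"
proof -
  define I J where "I = (Inl ` sorted_indices n d :: (nat list + nat \<times> nat) set)"
    and "J = (Inr ` ({..<n} \<times> {..<r}) :: (nat list + nat \<times> nat) set)"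
  define p where "p js x = sym_coord (tensor_map n d (matrix_map n r (\<lambda>i j. x (Inr (i, j))))
      (sorted_tensor n d (\<lambda>is. x (Inl is)))) js" for js and x :: "nat list + nat \<times> nat \<Rightarrow> 'a"
  define S where "S = (\<Inter>js\<in>sorted_indices r d. {x. p js x - sym_coord (unit_rep r d) js = 0})"
  have p: "p js \<in> polyfun (I \<union> J)" if js: "js \<in> sorted_indices r d" for js
  proof -
    have len: "length js = d" using js by (simp add: sorted_indices_def multi_indices_def)
    have 1: "(\<lambda>x. sorted_tensor n d (\<lambda>is. x (Inl is)) is) \<in> polyfun (I \<union> J)" for "is"
      unfolding sorted_tensor_def I_def by (intro polyfun_if polyfun.const polyfun.coord) auto
    have 2: "(\<lambda>x. matrix_map n r (\<lambda>i j. x (Inr (i, j))) (basis_vec (is ! k)) j) \<in> polyfun (I \<union> J)"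
      if "is \<in> multi_indices n d" "k < d" for "is" k j
    proof -
      have "is ! k < n" using that by (auto simp: multi_indices_def subset_iff)
      then show ?thesis unfolding matrix_map_basis_vec[OF \<open>is ! k < n\<close>] J_def
        by (intro polyfun_if polyfun.const polyfun.coord) auto
    qed
    show ?thesis
      unfolding p_def sym_coord_tensor_map[OF len]
        by (intro polyfun_sum polyfun.mult polyfun_prod 1 2) auto
  qed
  have S: "S \<in> constructible (I \<union> J)"
    unfolding S_def
    by (intro constructible_INT finite_sorted_indices constructible.zero polyfun_diff polyfun.const
      p)
  have proj: "{x. \<exists>y. (\<lambda>i. if i \<in> J then y i else x i) \<in> S} \<in> constructible I"
    by (rule constructible_project[OF _ S]) (auto simp: I_def J_def)
  have eq: "(\<exists>y. (\<lambda>i. if i \<in> J then y i else x i) \<in> S) \<longleftrightarrow> (\<lambda>is. x (Inl is)) \<in> subrank_locus n d r"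
    for x
  proof -
    have in_S: "(\<lambda>i. if i \<in> J then y i else x i) \<in> S \<longleftrightarrow> (\<forall>js\<in>sorted_indices r d.
        sym_coord (tensor_map n d (matrix_map n r (\<lambda>i j. y (Inr (i, j))))
          (sorted_tensor n d (\<lambda>is. x (Inl is)))) js = sym_coord (unit_rep r d) js)" for y
    proof -
      have "tensor_map n d (matrix_map n r (\<lambda>i j. if Inr (i, j) \<in> J then y (Inr (i, j)) else x (Inr
        (i, j)))) T =
          tensor_map n d (matrix_map n r (\<lambda>i j. y (Inr (i, j)))) T" for T
        by (rule tensor_map_cong) (auto simp: matrix_map_basis_vec fun_eq_iff J_def)
      moreover have "Inl is \<notin> J" for "is" by (auto simp: J_def)
      ultimately show ?thesis by (simp add: S_def p_def)
    qed
    have "\<exists>y. A = (\<lambda>i j. y (Inr (i, j) :: nat list + nat \<times> nat))" for A :: "nat \<Rightarrow> nat \<Rightarrow> 'a"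
      by (rule exI[of _ "case_sum (\<lambda>_. 0) (\<lambda>(i, j). A i j)"]) simp
    then show ?thesis unfolding in_S subrank_locus_matrix by metis
  qed
  from constructible_dichotomy[OF proj, unfolded eq]
  obtain q :: "(nat list + nat \<times> nat \<Rightarrow> 'a) \<Rightarrow> 'a" where
    *: "(\<exists>x. q x \<noteq> 0) \<and> ({x. q x \<noteq> 0} \<subseteq> {x. (\<lambda>is. x (Inl is)) \<in> subrank_locus n d r} \<or>
      {x. q x \<noteq> 0} \<inter> {x. (\<lambda>is. x (Inl is)) \<in> subrank_locus n d r} = {})"
    and "q \<in> polyfun I" by (rule bexE)
  from *[THEN conjunct1] obtain x where "q x \<noteq> 0" by (rule exE)
  note q = \<open>q \<in> polyfun I\<close> \<open>q x \<noteq> 0\<close> *[THEN conjunct2]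
  \<comment> \<open>\<open>q\<close> does not involve the matrix entries, so any values may be inserted for them\<close>
  define q' where "q' c = q (case_sum c (\<lambda>_. 0))" for c
  have "q' \<in> polyfun (sorted_indices n d)"
    unfolding q'_def by (rule polyfun_compose[OF q(1)]) (auto simp: I_def intro: polyfun.coord)
  moreover have "q' (\<lambda>is. x (Inl is)) = q x"
    unfolding q'_def by (rule polyfun_cong[OF q(1)]) (auto simp: I_def)
  moreover have "{c. q' c \<noteq> 0} \<subseteq> subrank_locus n d r \<or> {c. q' c \<noteq> 0} \<inter> subrank_locus n d r = {}"
  proof -
    have "q' c \<noteq> 0 \<Longrightarrow> case_sum c (\<lambda>_. 0) \<in> {x. q x \<noteq> 0}" for c by (simp add: q'_def)
    moreover have "case_sum c (\<lambda>_. 0) \<in> {x. (\<lambda>is. x (Inl is)) \<in> subrank_locus n d r} \<longleftrightarrow>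
        c \<in> subrank_locus n d r" for c by simp
    ultimately show ?thesis using q(3) by blast
  qed
  ultimately show ?thesis using q(2) by metis
qed

section \<open>Existence of the generic symmetric subrank\<close>

definition generically :: "nat \<Rightarrow> nat \<Rightarrow> (nat list \<Rightarrow> 'a::field) set \<Rightarrow> bool" where
  "generically n d S \<longleftrightarrow> (\<exists>q\<in>polyfun (sorted_indices n d). (\<exists>c. q c \<noteq> 0) \<and> {c. q c \<noteq> 0} \<subseteq> S)"

lemma generically_mono: "\<lbrakk>generically n d S; S \<subseteq> T\<rbrakk> \<Longrightarrow> generically n d T"
  unfolding generically_def by (meson order_trans)

text \<open>
  On the intersection of the two open sets the subrank is \<open>r\<close>, because the loci decrease with \<open>r\<close>.
  The intersection is nonempty and dense by irreducibility, and any other dense open set meets it,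
  which gives uniqueness.
\<close>

lemma generic_subrank_eqI:
  fixes n d r :: nat
  assumes d: "d > 0"
    and yes: "generically n d (subrank_locus n d r :: (nat list \<Rightarrow> 'a::alg_closed_field) set)"
    and no: "generically n d (- subrank_locus n d (Suc r) :: (nat list \<Rightarrow> 'a) set)"
  shows "generic_symmetric_subrank TYPE('a) d n = r"
proof -
  let ?Z = "zariski_topology n d :: (nat list \<Rightarrow> 'a) set topology"
  obtain q1 c1 where q1: "q1 \<in> polyfun (sorted_indices n d)" "q1 c1 \<noteq> (0 :: 'a)"
    "{c. q1 c \<noteq> 0} \<subseteq> subrank_locus n d r" using yes unfolding generically_def
      by (elim bexE conjE exE)
  obtain q2 c2 where q2: "q2 \<in> polyfun (sorted_indices n d)" "q2 c2 \<noteq> (0 :: 'a)"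
    "{c. q2 c \<noteq> 0} \<subseteq> - subrank_locus n d (Suc r)" using no unfolding generically_def
      by (elim bexE conjE exE)
  define q where "q = (\<lambda>c. q1 c * q2 c)"
  have q: "q \<in> polyfun (sorted_indices n d)" unfolding q_def by (intro polyfun.mult q1 q2)
  obtain c0 where c0: "q c0 \<noteq> 0"
    using polyfun_mult_nonzero[of q1 "sorted_indices n d" q2 c1 c2, OF q1(1) q2(1) q1(2) q2(2)]
    unfolding q_def by blast
  obtain P where P: "P \<in> polynomial_functions n d" "\<forall>T\<in>tensors n d. P (sym_class n d T) = q
    (sym_coord T)"
    using polyfun_as_polynomial_function[OF q] by blast
  define U where "U = {f \<in> sym_power n d. P f \<noteq> 0}"
  have openU: "openin ?Z U"
    unfolding openin_zariski_topology zariski_open_iff U_def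
    by (rule exI[of _ "{P}"]) (use P(1) in simp)
  \<comment> \<open>a point with prescribed coordinates\<close>
  have at: "p (sym_coord (sorted_tensor n d c)) = p c" if "p \<in> polyfun (sorted_indices n d)" for p
    and c :: "nat list \<Rightarrow> 'a"
    by (rule polyfun_cong[OF that]) (rule sym_coord_sorted_tensor)
  have meets: "U \<inter> V \<noteq> {}" if V: "openin ?Z V" "V \<noteq> {}" for V
  proof -
    obtain Ps where Ps: "Ps \<subseteq> polynomial_functions n d" "V = {f \<in> sym_power n d. \<exists>p\<in>Ps. p f \<noteq> 0}"
      using V(1) unfolding openin_zariski_topology zariski_open_iff by (elim exE conjE)
    obtain f p where f: "f \<in> sym_power n d" "p \<in> Ps" "p f \<noteq> 0" using V(2) Ps(2) by blast
    obtain T where T: "T \<in> tensors n d" "f = sym_class n d T" using f(1) by (rule sym_power_cases)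
    obtain p' where p': "p' \<in> polyfun (sorted_indices n d)" "\<forall>T\<in>tensors n d. p (sym_class n d T) =
      p' (sym_coord T)"
      using polynomial_function_in_coords[of p n d] f(2) Ps(1) by blast
    have "p' (sym_coord T) \<noteq> 0" using p'(2) T f(3) by simp
    then obtain z where z: "q z * p' z \<noteq> 0"
      using polyfun_mult_nonzero[of q "sorted_indices n d" p' c0, OF q p'(1) c0] by blast
    have "sym_class n d (sorted_tensor n d z) \<in> U \<inter> V"
      unfolding U_def Ps(2)
      using z f(2) P(2) p'(2) at[OF q] at[OF p'(1)] sorted_tensor_in_tensors[of n d z]
      by (auto intro: sym_class_in_sym_power intro!: bexI[of _ p])
    then show ?thesis by blast
  qed
  then have dense: "?Z closure_of U = topspace ?Z"
    using dense_intersects_open[of ?Z U] by blast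
  have sub: "symmetric_subrank n d f = r" if "f \<in> U" for f
  proof -
    have "f \<in> sym_power n d" using that by (simp add: U_def)
    then obtain T where T: "T \<in> tensors n d" "f = sym_class n d T" by (rule sym_power_cases)
    have "q (sym_coord T) \<noteq> 0" using that P(2) T unfolding U_def by simp
    then have "sym_coord T \<in> subrank_locus n d r" "sym_coord T \<notin> subrank_locus n d (Suc r)"
      using q1(3) q2(3) unfolding q_def by auto
    then have "sym_coord T \<in> subrank_locus n d r' \<longleftrightarrow> r' \<le> r" for r'
      using subrank_locus_antimono[OF _ d] by (metis not_less_eq_eq)
    then show ?thesis
      unfolding symmetric_subrank_def T(2) restricts_to_unit_iff[OF T(1)]
        by (auto intro!: Max_eqI simp: atMost_def[symmetric])
  qed
  show ?thesis
    unfolding generic_symmetric_subrank_def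
  proof (rule the_equality)
    show "\<exists>U. openin ?Z U \<and> ?Z closure_of U = topspace ?Z \<and> (\<forall>f\<in>U. symmetric_subrank n d f = r)"
      using openU dense sub by blast
    fix r' assume "\<exists>U. openin ?Z U \<and> ?Z closure_of U = topspace ?Z \<and> (\<forall>f\<in>U. symmetric_subrank n d f
      = r')"
    then obtain U' where U': "openin ?Z U'" "?Z closure_of U' = topspace ?Z" "\<forall>f\<in>U'.
      symmetric_subrank n d f = r'"
      by blast
    have "sym_class n d (sorted_tensor n d c0) \<in> U"
      unfolding U_def using P(2) at[OF q] c0 sorted_tensor_in_tensors[of n d c0]
        by (auto intro: sym_class_in_sym_power)
    then have "U' \<inter> U \<noteq> {}" using U'(2) openU dense_intersects_open[of ?Z U'] by blast
    then obtain f where "f \<in> U'" "f \<in> U" by blast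
    then show "r' = r" using U'(3) sub[of f] by simp
  qed
qed

lemma generic_subrank_characterization:
  fixes n d B :: nat
  assumes d: "d > 0"
    and bound: "\<And>r. generically n d (subrank_locus n d r :: (nat list \<Rightarrow> 'a::alg_closed_field) set) \<Longrightarrow>
      r \<le> B"
  shows "generically n d (subrank_locus n d r :: (nat list \<Rightarrow> 'a) set) \<longleftrightarrow>
    r \<le> generic_symmetric_subrank TYPE('a) d n"
proof -
  let ?G = "\<lambda>r. generically n d (subrank_locus n d r :: (nat list \<Rightarrow> 'a) set)"
  have "(\<exists>c :: nat list \<Rightarrow> 'a. (\<lambda>_. 1) c \<noteq> (0 :: 'a)) \<and>
      {c :: nat list \<Rightarrow> 'a. (\<lambda>_. 1) c \<noteq> (0 :: 'a)} \<subseteq> UNIV" by simp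
  then have "generically n d (UNIV :: (nat list \<Rightarrow> 'a) set)"
    unfolding generically_def by (rule bexI[OF _ polyfun.const])
  then have G0: "?G 0" by (simp only: subrank_locus_zero[OF d])
  define g where "g = Max {r. ?G r}"
  have fin: "finite {r. ?G r}" using bound by (auto intro: finite_subset[OF _ finite_atMost[of B]])
  have Gg: "?G g" using Max_in[OF fin] G0 unfolding g_def by blast
  have "\<not> ?G (Suc g)" using Max_ge[OF fin, of "Suc g"] unfolding g_def by auto
  then have "generically n d (- subrank_locus n d (Suc g) :: (nat list \<Rightarrow> 'a) set)"
    using subrank_locus_dichotomy[of n d "Suc g", where 'a='a] unfolding generically_def
    by (metis disjoint_eq_subset_Compl)
  then have "generic_symmetric_subrank TYPE('a) d n = g"
    by (rule generic_subrank_eqI[OF d Gg])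
  moreover have "?G r" if "r \<le> g" for r
    by (rule generically_mono[OF Gg]) (use subrank_locus_antimono[OF that d] in blast)
  moreover have "r \<le> g" if "?G r" for r using Max_ge[OF fin] that unfolding g_def by blast
  ultimately show ?thesis by blast
qed

section \<open>Unit tensors are concise\<close>

text \<open>
  Write \<open>d = q m\<close> with \<open>q\<close> a power of the characteristic exponent and \<open>m\<close> not divisible by the
  characteristic; then \<open>m \<ge> 2\<close>. Taking \<open>q\<close>-th powers is additive and surjective, so the hypothesis
  becomes a polynomial identity \<open>(s + u\<^sup>q)\<^sup>m - s\<^sup>m = C\<close> in \<open>s\<close>, and its derivative at \<open>s = 0\<close> shows
  \<open>u = 0\<close>.
\<close>

lemma power_shift_constant:
  fixes u C :: "'a::alg_closed_field"
  assumes "d > 0" and notpow: "\<And>k. d \<noteq> char_exponent TYPE('a) ^ k"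
    and const: "\<And>t. (t + u) ^ d - t ^ d = C"
  shows "u = 0"
proof -
  obtain k m where dm: "d = char_exponent TYPE('a) ^ k * m" and m: "of_nat m \<noteq> (0 :: 'a)"
    and dream: "\<And>a b :: 'a. (a + b) ^ (char_exponent TYPE('a) ^ k) =
      a ^ (char_exponent TYPE('a) ^ k) + b ^ (char_exponent TYPE('a) ^ k)"
  proof (cases "CHAR('a) = 0")
    case True
    then show ?thesis
      using that[of 0 d] assms(1) by (simp add: char_exponent_def CHAR_eq0_iff)
  next
    case False
    then have p: "prime CHAR('a)" using prime_CHAR_semidom by auto
    obtain m where "d = CHAR('a) ^ multiplicity CHAR('a) d * m" "\<not> CHAR('a) dvd m"
      using multiplicity_decompose'[of d "CHAR('a)"] assms(1) p
        by (metis not_prime_unit less_irrefl)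
    then show ?thesis
      using that[of "multiplicity CHAR('a) d" m] False freshmans_dream'[OF p]
      by (simp add: char_exponent_def of_nat_eq_0_iff_char_dvd)
  qed
  define q where "q = char_exponent TYPE('a) ^ k"
  have q: "q > 0" using assms(1) dm unfolding q_def by (cases "char_exponent TYPE('a) ^ k") auto
  have "m \<noteq> 1" using notpow[of k] dm by auto
  moreover have "m \<noteq> 0" using m by (metis of_nat_0)
  ultimately have "m \<ge> 2" by linarith
  have "(s + u ^ q) ^ m - s ^ m = C" for s
  proof -
    obtain t where "s = t ^ q" using nth_root_exists[OF q, of s] by metis
    then have "s + u ^ q = (t + u) ^ q" using dream unfolding q_def by simp
    then show ?thesis
      using const[of t] \<open>s = t ^ q\<close> dm by (simp add: q_def power_mult)
  qed
  then have "poly ([:u ^ q, 1:] ^ m - monom 1 m - [:C:]) s = 0" for s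
    by (simp add: poly_power poly_monom add.commute)
  then have "[:u ^ q, 1:] ^ m - monom 1 m - [:C:] = 0" by (intro poly_zero_off_finite[of "{}"]) auto
  then have "[:u ^ q, 1:] ^ m = monom 1 m + [:C:]" by (simp add: algebra_simps)
  then have "pderiv ([:u ^ q, 1:] ^ m) = pderiv (monom 1 m + [:C:])" by simp
  then have "poly (pderiv ([:u ^ q, 1:] ^ m)) 0 = poly (pderiv (monom 1 m + [:C:])) 0" by simp
  then have "of_nat m * (u ^ q) ^ (m - 1) = 0"
    using \<open>m \<ge> 2\<close> by (simp add: power_0_left pderiv_power pderiv_add pderiv_monom poly_monom
      pderiv_pCons poly_power mult.commute)
  then show "u = 0" using m q \<open>m \<ge> 2\<close> by (simp add: power_eq_0_iff)
qed

lemma sym_coord_replicate: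
  "sym_coord T (replicate d 0) = T (replicate d 0)"
proof -
  have "{js. mset js = mset (replicate d (0 :: nat))} = {replicate d 0}"
  proof (intro set_eqI iffI)
    fix js assume "js \<in> {js. mset js = mset (replicate d (0 :: nat))}"
    then have "mset js = mset (replicate d 0)" by simp
    then have "length js = d" "set js \<subseteq> {0}"
      using mset_eq_length[of js "replicate d 0"] mset_eq_setD[of js "replicate d 0"]
      by (auto simp: set_replicate_conv_if split: if_splits)
    then show "js \<in> {replicate d 0}" by (auto intro!: replicate_eqI)
  qed simp
  then show ?thesis by (simp add: sym_coord_def)
qed

text \<open>
  If \<open>u\<close> annihilates the image of \<open>\<phi>\<close>, then evaluating the image of \<open>T\<close> at \<open>y\<close> and at \<open>y + u\<close> gives the
  same value, so the polynomial \<open>\<Sum>\<^sub>i y\<^sub>i\<^sup>d\<close> is invariant under translation by \<open>u\<close>. Evaluation at a point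
  is the map induced by a linear map to \<open>K\<^sup>1\<close>.
\<close>

lemma unit_tensor_concise:
  fixes T :: "nat list \<Rightarrow> 'a::alg_closed_field"
  assumes "d > 0" and notpow: "\<And>k. d \<noteq> char_exponent TYPE('a) ^ k"
    and \<phi>: "\<phi> \<in> linear_maps n r" and T: "T \<in> tensors n d"
    and eq: "sym_class r d (tensor_map n d \<phi> T) = sym_class r d (unit_rep r d)"
    and u: "\<And>i. i < n \<Longrightarrow> (\<Sum>j<r. \<phi> (basis_vec i) j * u j) = 0" and "j < r"
  shows "u j = 0"
proof -
  \<comment> \<open>evaluation at \<open>y\<close>, as a linear map to \<open>K\<^sup>1\<close>\<close>
  define ev where "ev y = matrix_map r 1 (\<lambda>i (_::nat). y i)" for y :: "nat \<Rightarrow> 'a"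
  have lin: "ev y \<in> linear_maps r 1" for y unfolding ev_def by (rule matrix_map_linear)
  have same: "tensor_map n d (\<lambda>v. ev (\<lambda>i. y i + u i) (\<phi> v)) T = tensor_map n d (\<lambda>v. ev y (\<phi> v)) T"
    for y
  proof (rule tensor_map_cong, rule ext)
    fix i l assume "i < n"
    then show "ev (\<lambda>i. y i + u i) (\<phi> (basis_vec i)) l = ev y (\<phi> (basis_vec i)) l"
      using u[of i] by (simp add: ev_def matrix_map_def distrib_left sum.distrib)
  qed
  have at_point: "sym_coord (\<Sum>i<r. pure_tensor (replicate d (ev y (basis_vec i)))) (replicate d 0) =
    (\<Sum>i<r. y i ^ d)" for y
  proof -
    have "pure_tensor (replicate d (ev y (basis_vec i))) (replicate d 0) = y i ^ d" if "i < r" for i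
    proof -
      have "ev y (basis_vec i) 0 = y i" using that by (simp add: ev_def matrix_map_basis_vec)
      then show ?thesis by (simp add: pure_tensor_def)
    qed
    then show ?thesis by (simp add: sym_coord_replicate sum_fun_apply)
  qed
  have mem: "(\<Sum>i<r. pure_tensor (replicate d (ev y (basis_vec i)))) \<in> tensors 1 d" for y
  proof (intro tensors_sum pure_tensor_in_tensors)
    fix i assume "i \<in> {..<r}"
    then have "(basis_vec i :: nat \<Rightarrow> 'a) \<in> Kn r" by (simp add: basis_vec_in_Kn)
    then have "ev y (basis_vec i) \<in> Kn 1" using lin unfolding linear_maps_def by blast
    then show "set (replicate d (ev y (basis_vec i))) \<subseteq> Kn 1" by (auto simp: set_replicate_conv_if)
  qed simp
  have sums: "(\<Sum>i<r. (y i + u i) ^ d) = (\<Sum>i<r. y i ^ d)" for y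
  proof -
    have "sym_class 1 d (\<Sum>i<r. pure_tensor (replicate d (ev (\<lambda>i. y i + u i) (basis_vec i)))) =
        sym_class 1 d (\<Sum>i<r. pure_tensor (replicate d (ev y (basis_vec i))))"
      using unit_image_under_map[OF \<phi> lin T eq, of "\<lambda>i. y i + u i"] unit_image_under_map[OF \<phi> lin T
        eq, of y] same[of y]
      by simp
    then have "\<forall>is\<in>sorted_indices 1 d.
        sym_coord (\<Sum>i<r. pure_tensor (replicate d (ev (\<lambda>i. y i + u i) (basis_vec i)))) is =
        sym_coord (\<Sum>i<r. pure_tensor (replicate d (ev y (basis_vec i)))) is"
      using sym_class_eq_iff_coords[OF mem mem] by blast
    moreover have "replicate d 0 \<in> sorted_indices 1 d"
      by (simp add: sorted_indices_def multi_indices_def set_replicate_conv_if)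
    ultimately show ?thesis unfolding at_point[symmetric] by (rule bspec)
  qed
  define C where "C = (\<Sum>i<r. (if i = j then 0 else 0 :: 'a) ^ d) - (\<Sum>i\<in>{..<r} - {j}. u i ^ d)"
  have "(t + u j) ^ d - t ^ d = C" for t
  proof -
    have "(\<Sum>i<r. ((if i = j then t else 0) + u i) ^ d) = (t + u j) ^ d + (\<Sum>i\<in>{..<r} - {j}. u i ^ d)"
      using \<open>j < r\<close> by (subst sum.remove[of _ j]) (auto intro!: sum.cong)
    moreover have "(\<Sum>i<r. (if i = j then t else 0) ^ d) = t ^ d"
      using \<open>j < r\<close> \<open>d > 0\<close> by (subst sum.remove[of _ j]) (auto intro!: sum.neutral)
    moreover have "(\<Sum>i<r. (if i = j then 0 else 0 :: 'a) ^ d) = 0" using \<open>d > 0\<close> by simp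
    ultimately show ?thesis using sums[of "\<lambda>i. if i = j then t else 0"]
      by (simp add: C_def algebra_simps)
  qed
  then show ?thesis using power_shift_constant[OF \<open>d > 0\<close> notpow] by blast
qed

section \<open>Pivots of a surjective linear map\<close>

lemma span_basis_vecs: "fun_vs.span (basis_vec ` {..<r}) = (Kn r :: (nat \<Rightarrow> 'a::field) set)"
proof
  have "fun_vs.subspace (Kn r :: (nat \<Rightarrow> 'a) set)"
    by (auto simp: fun_vs.subspace_def Kn_def fscale_def)
  then show "fun_vs.span (basis_vec ` {..<r}) \<subseteq> (Kn r :: (nat \<Rightarrow> 'a) set)"
    by (intro fun_vs.span_minimal) (auto simp: basis_vec_in_Kn)
  show "(Kn r :: (nat \<Rightarrow> 'a) set) \<subseteq> fun_vs.span (basis_vec ` {..<r})"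
  proof
    fix v :: "nat \<Rightarrow> 'a" assume v: "v \<in> Kn r"
    have "v = (\<Sum>i<r. fscale (v i) (basis_vec i))"
    proof
      fix j
      have "(\<Sum>i<r. fscale (v i) (basis_vec i)) j = (\<Sum>i<r. if i = j then v j else 0)"
        unfolding sum_fun_apply by (rule sum.cong) (auto simp: fscale_def basis_vec_def)
      then show "v j = (\<Sum>i<r. fscale (v i) (basis_vec i)) j" using v by (simp add: Kn_def)
    qed
    also have "\<dots> \<in> fun_vs.span (basis_vec ` {..<r})"
      by (intro fun_vs.span_sum fun_vs.span_scale fun_vs.span_base) auto
    finally show "v \<in> fun_vs.span (basis_vec ` {..<r})" .
  qed
qed

lemma inj_basis_vec: "inj (basis_vec :: nat \<Rightarrow> nat \<Rightarrow> 'a::field)"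
proof (rule injI)
  fix i j assume "basis_vec i = (basis_vec j :: nat \<Rightarrow> 'a)"
  then have "basis_vec i i = (basis_vec j i :: 'a)" by simp
  then show "i = j" by (simp add: basis_vec_def split: if_splits)
qed

lemma independent_basis_vecs: "fun_vs.independent (basis_vec ` {..<r} :: (nat \<Rightarrow> 'a::field) set)"
proof (rule fun_vs.independent_if_scalars_zero)
  fix f :: "(nat \<Rightarrow> 'a) \<Rightarrow> 'a" and v :: "nat \<Rightarrow> 'a"
  assume *: "(\<Sum>x\<in>basis_vec ` {..<r}. fscale (f x) x) = 0" and v: "v \<in> basis_vec ` {..<r}"
  obtain j where j: "j < r" "v = basis_vec j" using v by auto
  have "(\<Sum>i<r. fscale (f (basis_vec i)) (basis_vec i)) = 0"
    using * by (subst (asm) sum.reindex) (auto simp: inj_on_def inj_eq[OF inj_basis_vec])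
  from fun_cong[OF this, of j] have "(\<Sum>i<r. if i = j then f (basis_vec j) else 0) = 0"
    unfolding sum_fun_apply by (simp add: fscale_def basis_vec_def if_distrib cong: if_cong)
  then show "f v = 0" using j by simp
qed simp

text \<open>
  Either the images of the basis vectors fail to span \<open>K\<^sup>r\<close>, and a linear functional vanishes on all
  of them, or some \<open>r\<close> of them form a basis, on which \<open>\<psi>\<close> is defined as the inverse of \<open>\<phi>\<close>.
\<close>

lemma pivots_or_relation:
  fixes \<phi> :: "(nat \<Rightarrow> 'a::field) \<Rightarrow> nat \<Rightarrow> 'a"
  assumes \<phi>: "\<phi> \<in> linear_maps n r"
  obtains
    (relation) u j where "j < r" "u j \<noteq> 0" "\<And>i. i < n \<Longrightarrow> (\<Sum>j<r. \<phi> (basis_vec i) j * u j) = 0"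
  | (pivots) I \<psi> where "I \<subseteq> {..<n}" "card I = r" "\<psi> \<in> linear_maps r n"
      "\<And>i. i \<in> I \<Longrightarrow> \<psi> (\<phi> (basis_vec i)) = basis_vec i" "\<And>v i. v \<in> Kn r \<Longrightarrow> i \<notin> I \<Longrightarrow> \<psi> v i = 0"
proof -
  interpret vp: vector_space_pair "fscale :: 'a \<Rightarrow> (nat \<Rightarrow> 'a) \<Rightarrow> nat \<Rightarrow> 'a" "fscale :: 'a \<Rightarrow> (nat \<Rightarrow> 'a)
    \<Rightarrow> nat \<Rightarrow> 'a"
    by (rule vector_space_pair.intro[OF fun_vs.vector_space_axioms fun_vs.vector_space_axioms])
  define S where "S = (\<lambda>i. \<phi> (basis_vec i)) ` {..<n}"
  have SK: "S \<subseteq> Kn r" unfolding S_def using \<phi> basis_vec_in_Kn unfolding linear_maps_def by blast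
  obtain B where B: "B \<subseteq> S" "fun_vs.independent B" "S \<subseteq> fun_vs.span B"
    using fun_vs.maximal_independent_subset[of S] by blast
  have "\<exists>i. i < n \<and> \<phi> (basis_vec i) = b" if "b \<in> B" for b using that B(1) unfolding S_def by blast
  then obtain idx where idx: "\<And>b. b \<in> B \<Longrightarrow> idx b < n" "\<And>b. b \<in> B \<Longrightarrow> \<phi> (basis_vec (idx b)) = b"
    by metis
  have inj: "inj_on idx B" using idx(2) by (metis inj_onI)
  have finB: "finite B" using B(1) finite_subset[of B S] unfolding S_def by auto
  show thesis
  proof (cases "Kn r \<subseteq> fun_vs.span B")
    case True
    have "card B \<le> card (basis_vec ` {..<r} :: (nat \<Rightarrow> 'a) set)"
      using fun_vs.independent_span_bound[OF _ B(2), of "basis_vec ` {..<r}"] B(1) SK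
      unfolding span_basis_vecs by auto
    moreover have "card (basis_vec ` {..<r} :: (nat \<Rightarrow> 'a) set) \<le> card B"
      using fun_vs.independent_span_bound[OF finB independent_basis_vecs[of r]] True basis_vec_in_Kn
        by blast
    moreover have "card (basis_vec ` {..<r} :: (nat \<Rightarrow> 'a) set) = r"
      by (subst card_image) (auto simp: inj_on_def inj_eq[OF inj_basis_vec])
    ultimately have cardB: "card B = r" by simp
    obtain g where g: "Vector_Spaces.linear fscale fscale g" "\<forall>b\<in>B. g b = basis_vec (idx b)"
      using vp.linear_independent_extend[OF B(2), of "\<lambda>b. basis_vec (idx b)"] by blast
    interpret g: Vector_Spaces.linear fscale fscale g by (rule g(1))
    have zero: "g v i = 0" if v: "v \<in> fun_vs.span B" and i: "i \<notin> idx ` B" for v i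
      using v
    proof (induction rule: fun_vs.span_induct_alt)
      case base
      show ?case using fun_cong[OF g.zero, of i] unfolding zero_fun_def .
    next
      case (step c x y)
      have "g (fscale c x + y) = fscale c (g x) + g y" by (simp only: g.add g.scale)
      from fun_cong[OF this, of i] have "g (fscale c x + y) i = c * g x i + g y i"
        by (simp only: fscale_def plus_fun_def)
      moreover have "g x i = 0" using step.hyps g(2) i by (auto simp: basis_vec_def)
      ultimately show ?case using step.IH by (simp only: mult_zero_right add_0_right)
    qed
    have idxI: "idx ` B \<subseteq> {..<n}" using idx(1) by auto
    show thesis
    proof (rule pivots[of "idx ` B" g])
      show "card (idx ` B) = r" using card_image[OF inj] cardB by simp
      have "g v \<in> Kn n" if "v \<in> Kn r" for v
        unfolding Kn_def
      proof (intro CollectI allI impI)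
        fix i assume "n \<le> i"
        then have "i \<notin> idx ` B" using idxI by auto
        then show "g v i = 0" using zero[of v i] that True by blast
      qed
      then show "g \<in> linear_maps r n"
        unfolding linear_maps_def by (simp only: g.add g.scale mem_Collect_eq) simp
      show "g (\<phi> (basis_vec i)) = basis_vec i" if "i \<in> idx ` B" for i using that idx(2) g(2) by auto
    qed (use zero idxI True in auto)
  next
    case False
    have "\<not> basis_vec ` {..<r} \<subseteq> fun_vs.span B"
      using False fun_vs.span_mono[of "basis_vec ` {..<r}" "fun_vs.span B"]
      unfolding span_basis_vecs fun_vs.span_span by blast
    then obtain j where j: "j < r" "basis_vec j \<notin> fun_vs.span B" by auto
    have "fun_vs.independent (insert (basis_vec j) B)"
      by (rule fun_vs.independent_insertI[OF j(2) B(2)])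
    then obtain g where g: "Vector_Spaces.linear fscale fscale g"
      "\<forall>b\<in>insert (basis_vec j) B. g b = (if b = basis_vec j then basis_vec 0 else 0)"
      using vp.linear_independent_extend[of "insert (basis_vec j) B"
          "\<lambda>b. if b = basis_vec j then basis_vec 0 else 0"] by blast
    interpret g: Vector_Spaces.linear fscale fscale g by (rule g(1))
    have gB: "g b = 0" if "b \<in> B" for b
      using g(2) that j(2) fun_vs.span_base[of b B] by auto
    have zero: "g v = 0" if "v \<in> fun_vs.span B" for v
      using that by (rule g.eq_0_on_span[OF gB, rotated])
    have lin: "(\<lambda>v. truncate_vec 1 (g v)) \<in> linear_maps r 1"
      unfolding linear_maps_def mem_Collect_eq g.add g.scale
      by (auto simp: truncate_vec_def Kn_def fscale_def fun_eq_iff)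
    show thesis
    proof (rule relation[of j "\<lambda>i. g (basis_vec i) 0"])
      have "g (basis_vec j) = basis_vec 0" using g(2) by simp
      then show "g (basis_vec j) 0 \<noteq> 0" by (simp add: basis_vec_def)
      fix i assume i: "i < n"
      have S: "\<phi> (basis_vec i) \<in> S" using i unfolding S_def by auto
      have "truncate_vec 1 (g (\<phi> (basis_vec i))) 0 =
          (\<Sum>j<r. \<phi> (basis_vec i) j * truncate_vec 1 (g (basis_vec j)) 0)"
        using linear_map_expand[OF lin, of "\<phi> (basis_vec i)" 0] S SK by blast
      moreover have "g (\<phi> (basis_vec i)) = 0" using zero S B(3) by blast
      ultimately show "(\<Sum>j<r. \<phi> (basis_vec i) j * g (basis_vec j) 0) = 0"
        by (simp add: truncate_vec_def)
    qed (rule j(1))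
  qed
qed

section \<open>The upper bound\<close>

lemma card_same_mset_le: "card {js. mset js = mset is} \<le> fact (length is)"
proof -
  have "{js. mset js = mset is} \<subseteq> (\<lambda>\<sigma>. permute_list \<sigma> is) ` {\<sigma>. \<sigma> permutes {..<length is}}"
  proof
    fix js assume "js \<in> {js. mset js = mset is}"
    then obtain \<sigma> where "\<sigma> permutes {..<length is}" "permute_list \<sigma> is = js"
      using mset_eq_permutation[of js "is"] by auto
    then show "js \<in> (\<lambda>\<sigma>. permute_list \<sigma> is) ` {\<sigma>. \<sigma> permutes {..<length is}}" by blast
  qed
  then have "card {js. mset js = mset is} \<le> card ((\<lambda>\<sigma>. permute_list \<sigma> is) ` {\<sigma>. \<sigma> permutes
    {..<length is}})"
    by (intro card_mono finite_imageI finite_permutations) auto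
  also have "\<dots> \<le> card {\<sigma>. \<sigma> permutes {..<length is}}"
    by (intro card_image_le finite_permutations) auto
  also have "\<dots> = fact (length is)" using card_permutations[of "{..<length is}"] by simp
  finally show ?thesis .
qed

text \<open>
  Sorting maps all lists over \<open>I\<close> to sorted ones, and at most \<open>d!\<close> lists have the same sorted list.
\<close>

lemma card_sorted_lists_ge:
  assumes "finite I"
  shows "card I ^ d \<le> fact d * card {is. length is = d \<and> sorted is \<and> set is \<subseteq> (I :: nat set)}"
proof -
  let ?L = "{is. length is = d \<and> sorted is \<and> set is \<subseteq> I}"
  have fin: "finite ?L"
    by (rule finite_subset[OF _ finite_lists_length_eq[OF assms, of d]]) auto
  have "{js. set js \<subseteq> I \<and> length js = d} \<subseteq> (\<Union>is\<in>?L. {js. mset js = mset is})"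
  proof
    fix js assume "js \<in> {js. set js \<subseteq> I \<and> length js = d}"
    then show "js \<in> (\<Union>is\<in>?L. {js. mset js = mset is})"
      by (intro UN_I[of "sort js"]) auto
  qed
  then have "card {js. set js \<subseteq> I \<and> length js = d} \<le> card (\<Union>is\<in>?L. {js. mset js = mset is})"
    using fin by (intro card_mono) (auto intro: finite_same_mset)
  also have "\<dots> \<le> (\<Sum>is\<in>?L. card {js. mset js = mset is})" by (rule card_UN_le[OF fin])
  also have "\<dots> \<le> (\<Sum>is\<in>?L. fact d)"
  proof (rule sum_mono)
    fix "is" assume "is \<in> ?L"
    then show "card {js. mset js = mset is} \<le> fact d" using card_same_mset_le[of "is"] by simp
  qed
  finally show ?thesis using card_lists_length_eq[OF assms, of d] by (simp add: mult.commute)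
qed

lemma pure_tensor_basis_vecs: "pure_tensor (map basis_vec is) = index_tensor is"
proof
  fix js
  show "pure_tensor (map basis_vec is) js = (index_tensor is js :: 'a::field)"
  proof (cases "length js = length is")
    case True
    then show ?thesis
      by (auto simp: pure_tensor_def index_tensor_def basis_vec_def list_eq_iff_nth_eq
          intro!: prod.neutral prod_zero)
  qed (auto simp: pure_tensor_def index_tensor_def)
qed

text \<open>
  The part of the subrank locus where \<open>\<phi>\<close> maps the basis vectors with index in \<open>I\<close> to linearly
  independent vectors. The left inverse \<open>\<psi>\<close> takes values in the span of these basis vectors.
\<close>

definition pivot_locus :: "nat \<Rightarrow> nat \<Rightarrow> nat \<Rightarrow> nat set \<Rightarrow> (nat list \<Rightarrow> 'a::field) set" where
  "pivot_locus n d r I = {c. \<exists>\<phi>\<in>linear_maps n r. \<exists>\<psi>\<in>linear_maps r n.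
     sym_class r d (tensor_map n d \<phi> (sorted_tensor n d c)) = sym_class r d (unit_rep r d) \<and>
     (\<forall>i\<in>I. \<psi> (\<phi> (basis_vec i)) = basis_vec i) \<and> (\<forall>v\<in>Kn r. \<forall>i. i \<notin> I \<longrightarrow> \<psi> v i = 0)}"

text \<open>
  Split the tensor into its part \<open>B\<close> in the variables from \<open>I\<close> and the rest \<open>A\<close>. The map \<open>\<psi> \<circ> \<phi>\<close> fixes
  \<open>B\<close>, and it takes \<open>A + B\<close> to the sum of the powers of the vectors \<open>\<psi> e\<^sub>j\<close>. So \<open>B\<close> is the difference of
  that sum and the image of \<open>A\<close>.
\<close>

lemma coordinates_from_pivots:
  fixes c :: "nat list \<Rightarrow> 'a::field"
  assumes \<phi>: "\<phi> \<in> linear_maps n r" and \<psi>: "\<psi> \<in> linear_maps r n"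
    and unit: "sym_class r d (tensor_map n d \<phi> (sorted_tensor n d c)) = sym_class r d (unit_rep r
      d)"
    and pivot: "\<And>i. i \<in> I \<Longrightarrow> \<psi> (\<phi> (basis_vec i)) = basis_vec i"
    and m: "m \<in> sorted_indices n d" "set m \<subseteq> I"
  shows "c m = sym_coord (\<Sum>j<r. pure_tensor (replicate d (\<psi> (basis_vec j)))) m -
    sym_coord (tensor_map n d (\<lambda>v. \<psi> (\<phi> v)) (sorted_tensor n d (\<lambda>is.
      if set is \<subseteq> I then 0 else c is))) m"
proof -
  let ?g = "\<lambda>v. \<psi> (\<phi> v)"
  let ?A = "sorted_tensor n d (\<lambda>is. if set is \<subseteq> I then 0 else c is)"
  let ?B = "sorted_tensor n d (\<lambda>is. if set is \<subseteq> I then c is else 0)"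
  have split: "sorted_tensor n d c = ?A + ?B" by (auto simp: sorted_tensor_def fun_eq_iff)
  have "tensor_map n d ?g ?B = (\<Sum>is\<in>multi_indices n d. fscale (?B is) (index_tensor is))"
    unfolding tensor_map_def
  proof (rule sum.cong[OF refl])
    fix "is" assume "is \<in> multi_indices n d"
    show "fscale (?B is) (pure_tensor (map (\<lambda>i. ?g (basis_vec i)) is)) = fscale (?B is)
      (index_tensor is)"
    proof (cases "set is \<subseteq> I")
      case True
      then have "map (\<lambda>i. ?g (basis_vec i)) is = map basis_vec is" using pivot by auto
      then show ?thesis by (simp only: pure_tensor_basis_vecs)
    next
      case False
      then have "?B is = 0" by (simp add: sorted_tensor_def)
      then show ?thesis by (simp add: fscale_def)
    qed
  qed
  then have fixed: "tensor_map n d ?g ?B = ?B"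
    using tensor_expand[OF sorted_tensor_in_tensors[of n d "\<lambda>is. if set is \<subseteq> I then c is else 0"]]
      by simp
  have lin: "?g \<in> linear_maps n n" by (rule linear_maps_comp[OF \<phi> \<psi>])
  have "(\<Sum>j<r. pure_tensor (replicate d (\<psi> (basis_vec j)))) \<in> tensors n d"
  proof (intro tensors_sum pure_tensor_in_tensors)
    fix j assume "j \<in> {..<r}"
    then have "\<psi> (basis_vec j) \<in> Kn n" using \<psi> basis_vec_in_Kn[of j r] unfolding linear_maps_def
      by blast
    then show "set (replicate d (\<psi> (basis_vec j))) \<subseteq> Kn n" by (auto simp: set_replicate_conv_if)
  qed simp
  then have "sym_coord (tensor_map n d ?g (sorted_tensor n d c)) m =
      sym_coord (\<Sum>j<r. pure_tensor (replicate d (\<psi> (basis_vec j)))) m"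
    using unit_image_under_map[OF \<phi> \<psi> sorted_tensor_in_tensors unit] m(1)
      sym_class_eq_iff_coords[OF tensor_map_in_tensors[OF lin]] by blast
  moreover have "sym_coord (tensor_map n d ?g (sorted_tensor n d c)) m = sym_coord (tensor_map n d
    ?g ?A) m + sym_coord ?B m"
    unfolding split tensor_map_add fixed sym_coord_add by simp
  moreover have "sym_coord ?B m = c m" unfolding sym_coord_sorted_tensor[OF m(1)] using m(2) by simp
  ultimately show ?thesis by (simp only: eq_diff_eq add.commute)
qed

text \<open>
  By the previous lemma a point of the pivot locus is determined by its coordinates outside \<open>I\<close>, the
  \<open>r \<times> r\<close> entries of \<open>\<psi>\<close> and the \<open>(n - r) \<times> r\<close> entries of \<open>\<psi> \<circ> \<phi>\<close> that are not prescribed. These are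
  \<open>r n\<close> parameters in place of the coordinates inside \<open>I\<close>.
\<close>

lemma pivot_locus_in_hypersurface:
  fixes n d r :: nat
  assumes I: "I \<subseteq> {..<n}" "card I = r"
    and few: "r * n < card {is \<in> sorted_indices n d. set is \<subseteq> I}"
  shows "\<exists>P\<in>polyfun (sorted_indices n d). (\<exists>y. P y \<noteq> (0 :: 'a::alg_closed_field)) \<and>
    (\<forall>c\<in>pivot_locus n d r I. P c = 0)"
proof -
  let ?N = "sorted_indices n d"
  let ?L = "{is \<in> ?N. set is \<subseteq> I}"
  have finI: "finite I" using I(1) finite_subset by blast
  define J :: "(nat list + (nat \<times> nat) + (nat \<times> nat)) set"
    where "J = Inl ` (?N - ?L) \<union> Inr ` (Inl ` ({..<r} \<times> I) \<union> Inr ` (({..<n} - I) \<times> I))"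
  have cardJ: "card J < card ?N"
  proof -
    have "card J \<le> card (Inl ` (?N - ?L) :: (nat list + (nat \<times> nat) + (nat \<times> nat)) set) +
        card (Inr ` (Inl ` ({..<r} \<times> I) \<union> Inr ` (({..<n} - I) \<times> I)) :: (nat list + (nat \<times> nat) +
          (nat \<times> nat)) set)"
      unfolding J_def by (rule card_Un_le)
    also have "\<dots> \<le> card (?N - ?L) + card ((Inl ` ({..<r} \<times> I) \<union> Inr ` (({..<n} - I) \<times> I)) :: ((nat \<times>
      nat) + (nat \<times> nat)) set)"
      by (intro add_mono card_image_le finite_Diff finite_UnI finite_imageI finite_cartesian_product
          finite_sorted_indices finI) auto
    also have "\<dots> \<le> card (?N - ?L) + (card (Inl ` ({..<r} \<times> I) :: ((nat \<times> nat) + (nat \<times> nat)) set) +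
        card (Inr ` (({..<n} - I) \<times> I) :: ((nat \<times> nat) + (nat \<times> nat)) set))"
      by (intro add_left_mono card_Un_le)
    also have "\<dots> \<le> card (?N - ?L) + (card ({..<r} \<times> I) + card (({..<n} - I) \<times> I))"
      by (intro add_mono card_image_le finite_cartesian_product finI) auto
    also have "\<dots> = card (?N - ?L) + (r * r + (n - r) * r)"
      using I finI by (simp add: card_cartesian_product card_Diff_subset)
    also have "r * r + (n - r) * r = r * n"
    proof -
      have "r \<le> n" using card_mono[OF _ I(1)] I(2) by simp
      then have "r * r + (n - r) * r = (r + (n - r)) * r" by (simp only: distrib_right)
      then show ?thesis using \<open>r \<le> n\<close> by simp
    qed
    also have "card (?N - ?L) + r * n < card (?N - ?L) + card ?L" using few by simp
    also have "\<dots> = card ?N"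
    proof -
      have "card (?N - ?L) = card ?N - card ?L"
        by (rule card_Diff_subset) (auto intro: finite_subset[OF _ finite_sorted_indices[of n d]])
      moreover have "card ?L \<le> card ?N" by (rule card_mono[OF finite_sorted_indices]) auto
      ultimately show ?thesis by simp
    qed
    finally show ?thesis .
  qed
  define U where "U x j = (\<lambda>i. if i \<in> I then x (Inr (Inl (j, i))) else 0)"
    for x :: "nat list + (nat \<times> nat) + (nat \<times> nat) \<Rightarrow> 'a" and j
  define C where "C x = matrix_map n n (\<lambda>k i. if k \<in> I then (if i = k then 1 else 0)
      else if i \<in> I then x (Inr (Inr (k, i))) else 0)"
    for x :: "nat list + (nat \<times> nat) + (nat \<times> nat) \<Rightarrow> 'a"
  define A where "A x = sorted_tensor n d (\<lambda>is. if set is \<subseteq> I then 0 else x (Inl is))"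
    for x :: "nat list + (nat \<times> nat) + (nat \<times> nat) \<Rightarrow> 'a"
  define F where "F m x = (if set m \<subseteq> I then sym_coord (\<Sum>j<r. pure_tensor (replicate d (U x j))) m -
      sym_coord (tensor_map n d (C x) (A x)) m else x (Inl m))" for m x
  have F: "F m \<in> polyfun J" if m: "m \<in> ?N" for m
  proof (cases "set m \<subseteq> I")
    case False
    then show ?thesis using m unfolding F_def J_def by (auto intro!: polyfun.coord)
  next
    case True
    have len: "length m = d" and mn: "set m \<subseteq> {..<n}" using m
      by (auto simp: sorted_indices_def multi_indices_def)
    have U: "(\<lambda>x. U x j i) \<in> polyfun J" if "j < r" for j i
      unfolding U_def J_def using that by (intro polyfun_if polyfun.coord polyfun.const) auto
    have "(\<lambda>x. sym_coord (\<Sum>j<r. pure_tensor (replicate d (U x j))) m) =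
        (\<lambda>x. \<Sum>ks | mset ks = mset m. \<Sum>j<r. \<Prod>k<d. U x j (ks ! k))"
    proof
      fix x
      have "length ks = d" if "mset ks = mset m" for ks using that len mset_eq_length by metis
      then show "sym_coord (\<Sum>j<r. pure_tensor (replicate d (U x j))) m =
          (\<Sum>ks | mset ks = mset m. \<Sum>j<r. \<Prod>k<d. U x j (ks ! k))"
        unfolding sym_coord_def sum_fun_apply by (intro sum.cong refl) (simp add: pure_tensor_def)
    qed
    moreover have "(\<lambda>x. \<Sum>ks | mset ks = mset m. \<Sum>j<r. \<Prod>k<d. U x j (ks ! k)) \<in> polyfun J"
      by (intro polyfun_sum polyfun_prod U) simp
    ultimately have 1: "(\<lambda>x. sym_coord (\<Sum>j<r. pure_tensor (replicate d (U x j))) m) \<in> polyfun J"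
      by simp
    have A: "(\<lambda>x. A x is) \<in> polyfun J" for "is"
      unfolding A_def sorted_tensor_def J_def by (intro polyfun_if polyfun.coord polyfun.const) auto
    have C: "(\<lambda>x. C x (basis_vec (is ! k)) i) \<in> polyfun J" if "is \<in> multi_indices n d" "k < d"
      for "is" k i
    proof -
      have "is ! k < n" using that by (auto simp: multi_indices_def subset_iff)
      then show ?thesis unfolding C_def matrix_map_basis_vec[OF \<open>is ! k < n\<close>] J_def
        by (intro polyfun_if polyfun.const polyfun.coord) auto
    qed
    have 2: "(\<lambda>x. sym_coord (tensor_map n d (C x) (A x)) m) \<in> polyfun J"
      unfolding sym_coord_tensor_map[OF len]
        by (intro polyfun_sum polyfun.mult polyfun_prod A C) auto
    show ?thesis unfolding F_def using True polyfun_diff[OF 1 2] by simp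
  qed
  have "finite J" unfolding J_def using finI finite_sorted_indices[of n d] by auto
  then obtain P where P: "P \<in> polyfun ?N" "\<exists>y. P y \<noteq> 0" "\<And>x. P (\<lambda>m. F m x) = 0"
    using polynomial_image_in_hypersurface[of J ?N F, OF _ finite_sorted_indices cardJ F] by blast
  have "P c = 0" if "c \<in> pivot_locus n d r I" for c
  proof -
    from that obtain \<phi> \<psi> where \<phi>: "\<phi> \<in> linear_maps n r" and \<psi>: "\<psi> \<in> linear_maps r n"
      and unit: "sym_class r d (tensor_map n d \<phi> (sorted_tensor n d c)) = sym_class r d (unit_rep r
        d)"
      and pivot: "\<forall>i\<in>I. \<psi> (\<phi> (basis_vec i)) = basis_vec i"
      and supp: "\<forall>v\<in>Kn r. \<forall>i. i \<notin> I \<longrightarrow> \<psi> v i = 0"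
      unfolding pivot_locus_def by blast
    \<comment> \<open>the parameters of the given point\<close>
    define x where "x = case_sum c (case_sum (\<lambda>(j, i). \<psi> (basis_vec j) i) (\<lambda>(k, i). \<psi> (\<phi> (basis_vec
      k)) i))"
    have U: "U x j = \<psi> (basis_vec j)" if "j < r" for j
      using supp basis_vec_in_Kn[OF that] by (auto simp: U_def x_def fun_eq_iff)
    have C: "tensor_map n d (C x) T = tensor_map n d (\<lambda>v. \<psi> (\<phi> v)) T" for T
    proof (rule tensor_map_cong, rule ext)
      fix k i assume k: "k < n"
      have \<phi>k: "\<phi> (basis_vec k) \<in> Kn r" using \<phi> basis_vec_in_Kn[OF k] unfolding linear_maps_def
        by blast
      then have "\<psi> (\<phi> (basis_vec k)) \<in> Kn n" using \<psi> unfolding linear_maps_def by blast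
      then have "\<psi> (\<phi> (basis_vec k)) i = 0" if "i \<ge> n" using that by (simp add: Kn_def)
      then show "C x (basis_vec k) i = \<psi> (\<phi> (basis_vec k)) i"
        using pivot supp \<phi>k k unfolding C_def matrix_map_basis_vec[OF k]
        by (auto simp: x_def basis_vec_def not_less)
    qed
    have "c m = F m x" if m: "m \<in> ?N" for m
    proof (cases "set m \<subseteq> I")
      case True
      have "A x = sorted_tensor n d (\<lambda>is. if set is \<subseteq> I then 0 else c is)"
        by (simp add: A_def x_def cong: if_cong)
      moreover have "(\<Sum>j<r. pure_tensor (replicate d (U x j))) = (\<Sum>j<r. pure_tensor (replicate d (\<psi>
        (basis_vec j))))"
        using U by (intro sum.cong) auto
      ultimately show ?thesis
        using coordinates_from_pivots[OF \<phi> \<psi> unit _ m True] pivot True unfolding F_def C by simp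
    qed (simp add: F_def x_def)
    then have "P c = P (\<lambda>m. F m x)" by (rule polyfun_cong[OF P(1)])
    then show ?thesis using P(3) by simp
  qed
  then show ?thesis using P(1,2) by blast
qed

lemma subrank_locus_pivots:
  assumes d: "d > 0" and notpow: "\<And>k. d \<noteq> char_exponent TYPE('a::alg_closed_field) ^ k"
  shows "(subrank_locus n d r :: (nat list \<Rightarrow> 'a) set) \<subseteq> (\<Union>I\<in>{I. I \<subseteq> {..<n} \<and> card I = r}.
    pivot_locus n d r I)"
proof
  fix c :: "nat list \<Rightarrow> 'a" assume "c \<in> subrank_locus n d r"
  then obtain \<phi> where \<phi>: "\<phi> \<in> linear_maps n r"
    "sym_class r d (tensor_map n d \<phi> (sorted_tensor n d c)) = sym_class r d (unit_rep r d)"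
    unfolding subrank_locus_def by blast
  show "c \<in> (\<Union>I\<in>{I. I \<subseteq> {..<n} \<and> card I = r}. pivot_locus n d r I)"
  proof (cases rule: pivots_or_relation[OF \<phi>(1)])
    case (1 u j)
    then show ?thesis
      using unit_tensor_concise[OF d notpow \<phi>(1) sorted_tensor_in_tensors \<phi>(2), of u j] by blast
  next
    case (2 I \<psi>)
    then have "c \<in> pivot_locus n d r I" unfolding pivot_locus_def using \<phi> by blast
    then show ?thesis using 2(1,2) by blast
  qed
qed

text \<open>
  If \<open>r n\<close> were too small for every choice of pivots, the product of the equations of all pivot loci
  would vanish on a nonempty open set.
\<close>

theorem subrank_locus_upper_bound:
  fixes n d r :: nat
  assumes d: "d > 0" and notpow: "\<And>k. d \<noteq> char_exponent TYPE('a::alg_closed_field) ^ k"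
    and gen: "generically n d (subrank_locus n d r :: (nat list \<Rightarrow> 'a) set)"
  shows "r \<le> n" "r ^ d \<le> fact d * (r * n)"
proof -
  let ?\<I> = "{I. I \<subseteq> {..<n} \<and> card I = r}"
  have cover: "(subrank_locus n d r :: (nat list \<Rightarrow> 'a) set) \<subseteq> (\<Union>I\<in>?\<I>. pivot_locus n d r I)"
    by (rule subrank_locus_pivots[OF d notpow])
  obtain q c0 where q: "q \<in> polyfun (sorted_indices n d)" "q c0 \<noteq> (0 :: 'a)"
    "{c. q c \<noteq> 0} \<subseteq> subrank_locus n d r" using gen unfolding generically_def
      by (elim bexE conjE exE)
  obtain I0 where "I0 \<subseteq> {..<n}" "card I0 = r" using q(2,3) cover by blast
  then show "r \<le> n" using card_mono[of "{..<n}" I0] by simp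
  have "\<exists>I\<in>?\<I>. card {is \<in> sorted_indices n d. set is \<subseteq> I} \<le> r * n"
  proof (rule ccontr)
    assume "\<not> ?thesis"
    then have few: "r * n < card {is \<in> sorted_indices n d. set is \<subseteq> I}" if "I \<in> ?\<I>" for I
      using that by (meson not_le)
    have "\<exists>P. P \<in> polyfun (sorted_indices n d) \<and> (\<exists>y. P y \<noteq> (0 :: 'a)) \<and> (\<forall>c\<in>pivot_locus n d r I. P
      c = 0)"
      if I: "I \<in> ?\<I>" for I
      using pivot_locus_in_hypersurface[of I n r d] I few[OF I] unfolding Bex_def by simp
    then have "\<forall>I\<in>?\<I>. \<exists>P. P \<in> polyfun (sorted_indices n d) \<and> (\<exists>y. P y \<noteq> (0 :: 'a)) \<and>
        (\<forall>c\<in>pivot_locus n d r I. P c = 0)" by (rule ballI)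
    from bchoice[OF this] obtain P where
      *: "\<forall>I\<in>?\<I>. P I \<in> polyfun (sorted_indices n d) \<and> (\<exists>y. P I y \<noteq> (0 :: 'a)) \<and>
        (\<forall>c\<in>pivot_locus n d r I. P I c = 0)" by (rule exE)
    note P = *[rule_format, THEN conjunct1] *[rule_format, THEN conjunct2, THEN conjunct1]
      *[THEN bspec, THEN conjunct2, THEN conjunct2]
    have fin: "finite ?\<I>" by (rule finite_subset[of _ "Pow {..<n}"]) auto
    obtain y where y: "(\<Prod>I\<in>?\<I>. P I y) \<noteq> 0" using polyfun_prod_nonzero[of ?\<I> P, OF fin P(1,2)]
      by blast
    have "(\<lambda>c. \<Prod>I\<in>?\<I>. P I c) \<in> polyfun (sorted_indices n d)" by (intro polyfun_prod P(1))
    from polyfun_mult_nonzero[of q _ _ c0 y, OF q(1) this q(2) y]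
    obtain z where z: "q z * (\<Prod>I\<in>?\<I>. P I z) \<noteq> 0" by blast
    then have "z \<in> subrank_locus n d r" using q(3) by auto
    then obtain I where I: "I \<in> ?\<I>" "z \<in> pivot_locus n d r I" using cover by blast
    then have "P I z = 0" using P(3) by blast
    then show False using z fin I(1) by auto
  qed
  then obtain I where I: "I \<subseteq> {..<n}" "card I = r" "card {is \<in> sorted_indices n d. set is \<subseteq> I} \<le> r *
    n"
    by blast
  have "{is. length is = d \<and> sorted is \<and> set is \<subseteq> I} = {is \<in> sorted_indices n d. set is \<subseteq> I}"
    using I(1) by (auto simp: sorted_indices_def multi_indices_def)
  then have "r ^ d \<le> fact d * card {is \<in> sorted_indices n d. set is \<subseteq> I}"
    using card_sorted_lists_ge[of I d] I(1,2) finite_subset[OF I(1)] by auto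
  also have "\<dots> \<le> fact d * (r * n)" using I(3) by simp
  finally show "r ^ d \<le> fact d * (r * n)" .
qed

section \<open>A criterion for the lower bound\<close>

definition cons_tensor :: "(nat \<Rightarrow> 'a::field) \<Rightarrow> (nat list \<Rightarrow> 'a) \<Rightarrow> nat list \<Rightarrow> 'a" where
  "cons_tensor v w is = (case is of [] \<Rightarrow> 0 | i # js \<Rightarrow> v i * w js)"

text \<open>
  The products of linear forms with the forms \<open>w k\<close> of degree \<open>e\<close> span the forms of degree \<open>e + 1\<close>.
\<close>

definition products_span :: "nat \<Rightarrow> nat \<Rightarrow> 'k set \<Rightarrow> ('k \<Rightarrow> nat list \<Rightarrow> 'a::field) \<Rightarrow> bool" where
  "products_span r e K w \<longleftrightarrow> (\<forall>k\<in>K. w k \<in> tensors r e) \<and>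
     (\<forall>T\<in>tensors r (Suc e). \<exists>l. (\<forall>k\<in>K. l k \<in> Kn r) \<and>
        T - (\<Sum>k\<in>K. cons_tensor (l k) (w k)) \<in> sym_relations r (Suc e))"

lemma cons_tensor_expand:
  assumes "w \<in> tensors r e"
  shows "cons_tensor v w = (\<Sum>is\<in>multi_indices r e. fscale (w is) (pure_tensor (v # map basis_vec
    is)))"
proof
  fix js
  show "cons_tensor v w js =
      (\<Sum>is\<in>multi_indices r e. fscale (w is) (pure_tensor (v # map basis_vec is))) js"
  proof (cases js)
    case Nil
    then show ?thesis by (simp add: cons_tensor_def sum_fun_apply fscale_def pure_tensor_def)
  next
    case (Cons j ks)
    have "pure_tensor (v # map basis_vec is) (j # ks) = v j * index_tensor is ks" for "is"
      unfolding pure_tensor_basis_vecs[symmetric] pure_tensor_def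
      by (simp add: prod.lessThan_Suc_shift del: prod.lessThan_Suc)
    then have "(\<Sum>is\<in>multi_indices r e. fscale (w is) (pure_tensor (v # map basis_vec is))) js =
        v j * (\<Sum>is\<in>multi_indices r e. fscale (w is) (index_tensor is)) ks"
      by (simp add: Cons sum_fun_apply fscale_def sum_distrib_left mult.left_commute)
    then show ?thesis using tensor_expand[OF assms] by (simp add: cons_tensor_def Cons)
  qed
qed

lemma cons_tensor_in_tensors:
  assumes "v \<in> Kn n" "w \<in> tensors n e"
  shows "cons_tensor v w \<in> tensors n (Suc e)"
  unfolding cons_tensor_expand[OF assms(2)]
proof (intro tensors_sum tensors_fscale pure_tensor_in_tensors)
  fix "is" assume "is \<in> multi_indices n e"
  then show "length (v # map basis_vec is) = Suc e" "set (v # map basis_vec is) \<subseteq> Kn n"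
    using assms(1) by (auto simp: multi_indices_def basis_vec_in_Kn)
qed

lemma tensors_mono: "r \<le> n \<Longrightarrow> tensors r e \<subseteq> tensors n e"
  by (auto simp: tensors_def multi_indices_def subset_iff) (meson less_le_trans)

lemma Kn_mono: "r \<le> n \<Longrightarrow> Kn r \<subseteq> Kn n"
  by (auto simp: Kn_def)

lemma tensor_map_cons_tensor:
  assumes \<phi>: "\<phi> \<in> linear_maps n m" and v: "v \<in> Kn n" and w: "w \<in> tensors r e" and "r \<le> n"
    and fixed: "\<And>i. i < r \<Longrightarrow> \<phi> (basis_vec i) = basis_vec i"
  shows "tensor_map n (Suc e) \<phi> (cons_tensor v w) = cons_tensor (\<phi> v) w"
  unfolding cons_tensor_expand[OF w] tensor_map_sum tensor_map_fscale
proof (rule sum.cong[OF refl])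
  fix "is" assume mi: "is \<in> multi_indices r e"
  then have "set (v # map basis_vec is) \<subseteq> Kn n" "length (v # map basis_vec is) = Suc e"
    using v \<open>r \<le> n\<close> by (auto simp: multi_indices_def subset_iff intro!: basis_vec_in_Kn
      less_le_trans[of _ r n])
  then have "tensor_map n (Suc e) \<phi> (pure_tensor (v # map basis_vec is)) =
      pure_tensor (map \<phi> (v # map basis_vec is))"
    by (rule tensor_map_pure_tensor[OF \<phi>])
  also have "map \<phi> (v # map basis_vec is) = \<phi> v # map basis_vec is"
    using fixed mi by (auto simp: multi_indices_def)
  finally show "fscale (w is) (tensor_map n (Suc e) \<phi> (pure_tensor (v # map basis_vec is))) =
      fscale (w is) (pure_tensor (\<phi> v # map basis_vec is))" by simp
qed

lemma tensor_map_fixing: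
  assumes "T \<in> tensors n d" "\<And>i. i < n \<Longrightarrow> \<phi> (basis_vec i) = basis_vec i"
  shows "tensor_map n d \<phi> T = T"
proof -
  have "tensor_map n d \<phi> T = (\<Sum>is\<in>multi_indices n d. fscale (T is) (index_tensor is))"
    unfolding tensor_map_def
  proof (rule sum.cong[OF refl])
    fix "is" assume "is \<in> multi_indices n d"
    then have "map (\<lambda>i. \<phi> (basis_vec i)) is = map basis_vec is"
      using assms(2) by (auto simp: multi_indices_def)
    then show "fscale (T is) (pure_tensor (map (\<lambda>i. \<phi> (basis_vec i)) is)) = fscale (T is)
      (index_tensor is)"
      by (simp only: pure_tensor_basis_vecs)
  qed
  then show ?thesis using tensor_expand[OF assms(1)] by simp
qed

lemma tensor_map_unit_rep:
  assumes \<phi>: "\<phi> \<in> linear_maps n m" and "r \<le> n"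
    and fixed: "\<And>i. i < r \<Longrightarrow> \<phi> (basis_vec i) = basis_vec i"
  shows "tensor_map n d \<phi> (unit_rep r d) = unit_rep r d"
  unfolding unit_rep_def tensor_map_sum
proof (rule sum.cong[OF refl])
  fix i assume "i \<in> {..<r}"
  then show "tensor_map n d \<phi> (pure_tensor (replicate d (basis_vec i))) = pure_tensor (replicate d
    (basis_vec i))"
    using \<open>r \<le> n\<close> fixed by (subst tensor_map_pure_tensor[OF \<phi>]) (auto simp: set_replicate_conv_if
      basis_vec_in_Kn)
qed

lemma tensor_map_truncate_zero:
  assumes "\<And>is. set is \<subseteq> {..<r} \<Longrightarrow> h is = 0"
  shows "tensor_map n d (truncate_vec r) h = 0"
  unfolding tensor_map_def
proof (rule sum.neutral, rule ballI)
  fix "is" assume "is \<in> multi_indices n d"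
  show "fscale (h is) (pure_tensor (map (\<lambda>i. truncate_vec r (basis_vec i)) is)) = 0"
  proof (cases "set is \<subseteq> {..<r}")
    case True
    then show ?thesis using assms by (simp add: fscale_def zero_fun_def)
  next
    case False
    then obtain k where k: "k < length is" "is ! k \<ge> r"
      by (metis in_set_conv_nth lessThan_iff not_less subsetI)
    then have "truncate_vec r (basis_vec (is ! k)) = (\<lambda>_. 0 :: 'a)"
      by (auto simp: truncate_vec_def basis_vec_def)
    then have "pure_tensor (map (\<lambda>i. truncate_vec r (basis_vec i)) is) js = (0 :: 'a)" for js
      using k(1) by (auto simp: pure_tensor_def intro!: prod_zero bexI[of _ k])
    then show ?thesis by (simp add: fscale_def zero_fun_def)
  qed
qed

text \<open>
  For each direction \<open>y\<close> a curve in the locus through \<open>f0\<close> with tangent vector \<open>y\<close> is constructed.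
  The part of \<open>y\<close> in the first \<open>r\<close> variables is written as \<open>\<Sum>\<^sub>k l\<^sub>k w\<^sub>k\<close>, and the rest is \<open>h\<close>. The curve is
  the image of \<open>f0 + t h\<close> under the shear \<open>g t\<close> that takes \<open>e\<^bsub>r+k\<^esub>\<close> to \<open>e\<^bsub>r+k\<^esub> + t l\<^sub>k\<close>. The inverse shear
  followed by the projection to \<open>K\<^sup>r\<close> carries it to the unit tensor.
\<close>

theorem generic_unit_if_products_span:
  fixes w :: "nat \<Rightarrow> nat list \<Rightarrow> 'a::alg_closed_field"
  assumes span: "products_span r e {..<N} w" and n: "r + N \<le> n"
  shows "generically n (Suc e) (subrank_locus n (Suc e) r :: (nat list \<Rightarrow> 'a) set)"
proof (rule ccontr)
  let ?d = "Suc e"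
  let ?S = "sorted_indices n ?d"
  assume not: "\<not> ?thesis"
  obtain q where "q \<in> polyfun ?S" and *: "(\<exists>c. q c \<noteq> (0 :: 'a)) \<and>
      ({c. q c \<noteq> 0} \<subseteq> subrank_locus n ?d r \<or> {c. q c \<noteq> 0} \<inter> subrank_locus n ?d r = {})"
    using subrank_locus_dichotomy[of n ?d r, where 'a='a] by (rule bexE)
  then have "\<not> {c. q c \<noteq> 0} \<subseteq> subrank_locus n ?d r" using not unfolding generically_def by blast
  then have q: "q \<in> polyfun ?S" "\<exists>c. q c \<noteq> 0" "\<And>c. c \<in> subrank_locus n ?d r \<Longrightarrow> q c = 0"
    using * \<open>q \<in> polyfun ?S\<close> by blast+
  have rn: "r \<le> n" using n by simp
  have w: "w k \<in> tensors r e" if "k < N" for k using span that unfolding products_span_def by blast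
  have wn: "w k \<in> tensors n e" if "k < N" for k using w[OF that] tensors_mono[OF rn] by blast
  have bn: "(basis_vec (r + k) :: nat \<Rightarrow> 'a) \<in> Kn n" if "k < N" for k
    using n that by (intro basis_vec_in_Kn) simp
  \<comment> \<open>the point through which all curves pass\<close>
  define f0 where "f0 = unit_rep r ?d + (\<Sum>k<N. cons_tensor (basis_vec (r + k)) (w k))"
  have f0: "f0 \<in> tensors n ?d"
    unfolding f0_def using unit_rep_in_tensors[of r ?d] tensors_mono[OF rn, of ?d] wn bn
    by (intro tensors_add tensors_sum cons_tensor_in_tensors) auto
  have "\<exists>Y. (\<forall>i\<in>?S. poly (Y i) 0 = y i) \<and> (\<forall>t. q (\<lambda>i. sym_coord f0 i + t * poly (Y i) t) = 0)" for y
  proof -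
    define T where "T = sorted_tensor n ?d y"
    define Tr where "Tr = (\<lambda>is. if set is \<subseteq> {..<r} then T is else 0)"
    define h where "h = T - Tr"
    have T: "T \<in> tensors n ?d" unfolding T_def by (rule sorted_tensor_in_tensors)
    then have Tr: "Tr \<in> tensors r ?d" by (auto simp: Tr_def tensors_def multi_indices_def)
    have h: "h \<in> tensors n ?d" unfolding h_def
      using T Tr tensors_mono[OF rn, of ?d] by (intro tensors_diff) auto
    have h0: "h is = 0" if "set is \<subseteq> {..<r}" for "is" using that by (simp add: h_def Tr_def)
    obtain l where l: "\<And>k. k < N \<Longrightarrow> l k \<in> Kn r"
      "Tr - (\<Sum>k<N. cons_tensor (l k) (w k)) \<in> sym_relations r ?d"
      using span Tr unfolding products_span_def by (metis lessThan_iff)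
    have ln: "l k \<in> Kn n" if "k < N" for k using l(1)[OF that] Kn_mono[OF rn] by blast
    define g where "g t v = (\<lambda>i. v i + t * (\<Sum>k<N. v (r + k) * l k i))" for t and v :: "nat \<Rightarrow> 'a"
    have g: "g t \<in> linear_maps n n" for t
      using ln by (auto simp: g_def linear_maps_def Kn_def fscale_def fun_eq_iff algebra_simps
          sum.distrib sum_distrib_left)
    have gid: "g t v = v" if "v \<in> Kn r" for t v
      using that by (simp add: g_def Kn_def)
    \<comment> \<open>the inverse shear followed by the projection to the first \<open>r\<close> coordinates\<close>
    define \<phi> where "\<phi> t = (\<lambda>v. truncate_vec r (g (- t) v))" for t
    have \<phi>: "\<phi> t \<in> linear_maps n r" for t unfolding \<phi>_def
      by (rule linear_maps_comp[OF g truncate_vec_linear])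
    have \<phi>r: "\<phi> t v = v" if "v \<in> Kn r" for t v
      using that unfolding \<phi>_def gid[OF that] by (auto simp: truncate_vec_def Kn_def)
    have \<phi>b: "\<phi> t (basis_vec i) = basis_vec i" if "i < r" for t i
      by (rule \<phi>r[OF basis_vec_in_Kn[OF that]])
    have \<phi>k: "\<phi> t (basis_vec (r + k)) = fscale (- t) (l k)" if k: "k < N" for t k
    proof
      fix i
      have "(\<Sum>k'<N. basis_vec (r + k) (r + k') * l k' i) = (\<Sum>k'<N. if k' = k then l k i else 0)"
        by (rule sum.cong) (auto simp: basis_vec_def)
      then show "\<phi> t (basis_vec (r + k)) i = fscale (- t) (l k) i"
        using l(1)[OF k] k by (auto simp: \<phi>_def g_def truncate_vec_def fscale_def Kn_def
          basis_vec_def)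
    qed
    \<comment> \<open>the image of \<open>f0 + t h\<close> under the shear\<close>
    define Ft where "Ft t = f0 + (fscale t (\<Sum>k<N. cons_tensor (l k) (w k)) + fscale t (tensor_map n
      ?d (g t) h))" for t
    have Ft: "Ft t \<in> tensors n ?d" for t
      unfolding Ft_def using f0 wn ln
      by (intro tensors_add tensors_fscale tensors_sum cons_tensor_in_tensors
        tensor_map_in_tensors[OF g]) auto
    have restrict: "tensor_map n ?d (\<phi> t) (Ft t) = unit_rep r ?d" for t
    proof -
      have 0: "tensor_map n ?d (\<phi> t) (unit_rep r ?d) = unit_rep r ?d"
        by (rule tensor_map_unit_rep[OF \<phi> rn \<phi>b])
      have 1: "tensor_map n ?d (\<phi> t) (cons_tensor (basis_vec (r + k)) (w k)) = fscale (- t)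
        (cons_tensor (l k) (w k))"
        if "k < N" for k
      proof -
        have "tensor_map n ?d (\<phi> t) (cons_tensor (basis_vec (r + k)) (w k)) = cons_tensor (fscale (-
          t) (l k)) (w k)"
          unfolding \<phi>k[OF that, symmetric]
          by (rule tensor_map_cons_tensor[OF \<phi> bn[OF that] w[OF that] rn \<phi>b])
        also have "\<dots> = fscale (- t) (cons_tensor (l k) (w k))"
          by (auto simp: cons_tensor_def fscale_def fun_eq_iff split: list.split)
        finally show ?thesis .
      qed
      have 2: "tensor_map n ?d (\<phi> t) (cons_tensor (l k) (w k)) = cons_tensor (l k) (w k)" if "k < N"
        for k
        using tensor_map_cons_tensor[OF \<phi> ln[OF that] w[OF that] rn \<phi>b] \<phi>r[OF l(1)[OF that]] by simp
      have 3: "tensor_map n ?d (\<phi> t) (tensor_map n ?d (g t) h) = 0"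
      proof -
        have "tensor_map n ?d (\<phi> t) (tensor_map n ?d (g t) h) = tensor_map n ?d (\<lambda>v. \<phi> t (g t v)) h"
          by (rule tensor_map_comp[OF g \<phi>])
        also have "\<dots> = tensor_map n ?d (truncate_vec r) h"
        proof (rule tensor_map_cong)
          fix i assume "i < n"
          have "g (- t) (g t v) = v" for v
          proof
            fix j
            have "(\<Sum>k<N. (\<Sum>k'<N. v (r + k') * l k' (r + k)) * l k j) = 0"
              using l(1) by (intro sum.neutral) (auto simp: Kn_def)
            then show "g (- t) (g t v) j = v j"
              by (simp add: g_def distrib_right sum.distrib mult.assoc sum_distrib_left[symmetric])
          qed
          then show "\<phi> t (g t (basis_vec i)) = truncate_vec r (basis_vec i)" by (simp add: \<phi>_def)
        qed
        also have "\<dots> = 0" by (rule tensor_map_truncate_zero) (rule h0)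
        finally show ?thesis .
      qed
      have "tensor_map n ?d (\<phi> t) (Ft t) = unit_rep r ?d + (\<Sum>k<N. fscale (- t) (cons_tensor (l k) (w
        k))) +
          (fscale t (\<Sum>k<N. cons_tensor (l k) (w k)) + fscale t 0)"
        unfolding Ft_def f0_def tensor_map_add tensor_map_fscale tensor_map_sum 3
        by (intro arg_cong2[where f = "(+)"] arg_cong[where f = "fscale t"] sum.cong refl) (simp_all
          only: 0 1 2 lessThan_iff)
      also have "\<dots> = unit_rep r ?d"
        by (rule ext) (simp add: sum_fun_apply fscale_def sum_negf sum_distrib_left)
      finally show ?thesis .
    qed
    have vanish: "q (sym_coord (Ft t)) = 0" for t
    proof (rule q(3))
      have "sym_map n r ?d (\<phi> t) (sym_class n ?d (Ft t)) = unit_tensor r ?d"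
        unfolding sym_map_class[OF \<phi> Ft] restrict unit_tensor_eq ..
      then show "sym_coord (Ft t) \<in> subrank_locus n ?d r"
        using restricts_to_unit_iff[where r = r, OF Ft[of t]] \<phi>[of t] by blast
    qed
    define G where "G j i = [:basis_vec j i, \<Sum>k<N. basis_vec j (r + k) * l k i:]" for j i
    have G: "poly (G j i) t = g t (basis_vec j) i" for j i t by (simp add: G_def g_def mult.commute)
    define Y where "Y is = [:sym_coord (\<Sum>k<N. cons_tensor (l k) (w k)) is:] +
      (\<Sum>ks | mset ks = mset is. \<Sum>js\<in>multi_indices n ?d. smult (h js) (\<Prod>k<?d. G (js ! k) (ks ! k)))"
        for "is"
    have Y: "poly (Y is) t = sym_coord (\<Sum>k<N. cons_tensor (l k) (w k)) is + sym_coord (tensor_map n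
      ?d (g t) h) is"
      if "is \<in> ?S" for "is" t
    proof -
      have len: "length is = ?d" using that by (simp add: sorted_indices_def multi_indices_def)
      show ?thesis unfolding Y_def sym_coord_tensor_map[OF len]
        by (simp only: poly_add poly_sum poly_smult poly_prod G poly_pCons poly_0 mult_zero_right
          add_0_right)
    qed
    have "poly (Y i) 0 = y i" if i: "i \<in> ?S" for i
    proof -
      have "tensor_map n ?d (g 0) h = h" by (rule tensor_map_fixing[OF h]) (simp add: g_def)
      moreover have "sym_coord Tr = sym_coord (\<Sum>k<N. cons_tensor (l k) (w k))"
        using sym_coord_sym_relations[OF l(2)] unfolding sym_coord_diff
          by (simp only: right_minus_eq)
      moreover have "sym_coord T = sym_coord Tr + sym_coord h" unfolding h_def sym_coord_diff
        by simp
      moreover have "sym_coord T i = y i" unfolding T_def by (rule sym_coord_sorted_tensor[OF i])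
      ultimately show ?thesis unfolding Y[OF i] by simp
    qed
    moreover have "q (\<lambda>i. sym_coord f0 i + t * poly (Y i) t) = 0" for t
    proof -
      have "q (\<lambda>i. sym_coord f0 i + t * poly (Y i) t) = q (sym_coord (Ft t))"
      proof (rule polyfun_cong[OF q(1)])
        fix i assume "i \<in> ?S"
        then show "sym_coord f0 i + t * poly (Y i) t = sym_coord (Ft t) i"
          unfolding Y[OF \<open>i \<in> ?S\<close>] Ft_def sym_coord_add sym_coord_fscale
          by (simp add: fscale_def distrib_left)
      qed
      then show ?thesis using vanish by simp
    qed
    ultimately show ?thesis by blast
  qed
  then have "q c = 0" for c by (rule polyfun_zero_if_curves_in_all_directions[OF q(1)])
  then show False using q(2) by blast
qed

section \<open>Slot systems\<close>

definition delete_nth :: "nat \<Rightarrow> 'b list \<Rightarrow> 'b list" where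
  "delete_nth b xs = take b xs @ drop (Suc b) xs"

text \<open>
  The tensors of order \<open>d\<close> are spanned by the products of a vector in slot \<open>b\<close> with a tensor \<open>w b l\<close>
  in the remaining \<open>d - 1\<close> slots, where \<open>b\<close> ranges over all slots and \<open>l\<close> over \<open>K b\<close>. If \<open>K b\<close> has
  \<open>k\<close> elements for each \<open>b\<close>, then \<open>d k s \<ge> s\<^sup>d\<close> by counting, so \<open>k = s\<^bsup>d-1\<^esup> / d\<close> is optimal.
\<close>

definition slots_span :: "nat \<Rightarrow> nat \<Rightarrow> (nat \<Rightarrow> 'k set) \<Rightarrow> (nat \<Rightarrow> 'k \<Rightarrow> nat list \<Rightarrow> 'a::field) \<Rightarrow> bool"
  where
  "slots_span d s K w \<longleftrightarrow> (\<forall>T. \<exists>u. \<forall>is\<in>multi_indices s d.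
     T is = (\<Sum>b<d. \<Sum>l\<in>K b. u b l (is ! b) * w b l (delete_nth b is)))"

lemma delete_nth_0 [simp]: "delete_nth 0 (x # xs) = xs"
  by (simp add: delete_nth_def)

lemma delete_nth_Suc [simp]: "delete_nth (Suc b) (x # xs) = x # delete_nth b xs"
  by (simp add: delete_nth_def)

lemma length_delete_nth: "b < length xs \<Longrightarrow> length (delete_nth b xs) = length xs - 1"
  by (simp add: delete_nth_def)

lemma map_delete_nth: "map f (delete_nth b xs) = delete_nth b (map f xs)"
  by (simp add: delete_nth_def take_map drop_map)

lemma set_delete_nth: "set (delete_nth b xs) \<subseteq> set xs"
  using set_take_subset[of b xs] set_drop_subset[of "Suc b" xs] by (auto simp: delete_nth_def)

lemma delete_nth_multi_indices:
  "\<lbrakk>is \<in> multi_indices s d; b < d\<rbrakk> \<Longrightarrow> delete_nth b is \<in> multi_indices s (d - 1)"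
  using set_delete_nth[of b "is"] by (auto simp: multi_indices_def length_delete_nth)

lemma insert_delete_nth:
  assumes "b < length xs"
  shows "take b (delete_nth b xs) @ xs ! b # drop b (delete_nth b xs) = xs"
  using assms id_take_nth_drop[OF assms] by (simp add: delete_nth_def min_def)

lemma slots_span_reindex:
  fixes w :: "nat \<Rightarrow> 'k \<Rightarrow> nat list \<Rightarrow> 'a::field"
  assumes span: "slots_span d s K w" and fin: "\<And>b. b < d \<Longrightarrow> finite (K b)"
    and card: "\<And>b. b < d \<Longrightarrow> card (K b) \<le> k"
  shows "\<exists>w' :: nat \<Rightarrow> nat \<Rightarrow> nat list \<Rightarrow> 'a. slots_span d s (\<lambda>_. {..<k}) w'"
proof -
  have "\<exists>f. inj_on f (K b) \<and> f ` K b \<subseteq> {..<k}" if "b < d" for b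
    using card_le_inj[OF fin[OF that], of "{..<k}"] card[OF that] by auto
  then obtain f where f: "\<And>b. b < d \<Longrightarrow> inj_on (f b) (K b)" "\<And>b. b < d \<Longrightarrow> f b ` K b \<subseteq> {..<k}"
    by metis
  define w' where "w' b l = w b (inv_into (K b) (f b) l)" for b l
  have "slots_span d s (\<lambda>_. {..<k}) w'"
    unfolding slots_span_def
  proof
    fix T :: "nat list \<Rightarrow> 'a"
    obtain u where u: "\<forall>is\<in>multi_indices s d. T is = (\<Sum>b<d. \<Sum>l\<in>K b. u b l (is ! b) * w b l
      (delete_nth b is))"
      using span unfolding slots_span_def by blast
    let ?u = "\<lambda>b l i. if l \<in> f b ` K b then u b (inv_into (K b) (f b) l) i else 0"
    have "(\<Sum>l<k. ?u b l (is ! b) * w' b l (delete_nth b is)) = (\<Sum>l\<in>K b. u b l (is ! b) * w b l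
      (delete_nth b is))"
      if b: "b < d" for b "is"
    proof -
      have "(\<Sum>l<k. ?u b l (is ! b) * w' b l (delete_nth b is)) =
          (\<Sum>l\<in>f b ` K b. ?u b l (is ! b) * w' b l (delete_nth b is))"
        using f(2)[OF b] by (intro sum.mono_neutral_right) auto
      also have "\<dots> = (\<Sum>l\<in>K b. ?u b (f b l) (is ! b) * w' b (f b l) (delete_nth b is))"
        by (subst sum.reindex[OF f(1)[OF b]]) simp
      also have "\<dots> = (\<Sum>l\<in>K b. u b l (is ! b) * w b l (delete_nth b is))"
        by (rule sum.cong) (auto simp: w'_def inv_into_f_f[OF f(1)[OF b]])
      finally show ?thesis .
    qed
    then have "(\<Sum>b<d. \<Sum>l\<in>K b. u b l (is ! b) * w b l (delete_nth b is)) =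
        (\<Sum>b<d. \<Sum>l<k. ?u b l (is ! b) * w' b l (delete_nth b is))" for "is"
      by (intro sum.cong refl) (simp only: lessThan_iff)
    then show "\<exists>u. \<forall>is\<in>multi_indices s d. T is = (\<Sum>b<d. \<Sum>l<k. u b l (is ! b) * w' b l (delete_nth b
      is))"
      using u by (intro exI[of _ ?u]) simp
  qed
  then show ?thesis by blast
qed

text \<open>
  The \<open>27\<close> products of a unit vector with one of the nine matrices are basis tensors
  \<open>e\<^sub>i \<otimes> e\<^sub>j \<otimes> e\<^sub>k\<close> or differences of two of them. The graph on all basis tensors with these
  differences as edges is a forest, and each of its trees contains exactly one product that is a
  single basis tensor. Solving
  along the trees gives the coefficients \<open>u\<close>. Matrices \<open>w\<close> that are all single basis tensors cannot
  work.
\<close>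

lemma slots_span_3_3: "\<exists>w :: nat \<Rightarrow> nat \<Rightarrow> nat list \<Rightarrow> 'a::field. slots_span 3 3 (\<lambda>_. {..<3}) w"
proof -
  define w :: "nat \<Rightarrow> nat \<Rightarrow> nat list \<Rightarrow> 'a" where "w b l is =
    [[index_tensor [1, 0] is, index_tensor [1, 1] is - index_tensor [2, 0] is, index_tensor [0, 1]
      is],
     [index_tensor [2, 2] is, index_tensor [1, 2] is, index_tensor [0, 0] is - index_tensor [2, 1]
       is],
     [index_tensor [0, 0] is - index_tensor [1, 2] is, index_tensor [0, 1] is - index_tensor [1, 0]
       is,
      index_tensor [0, 2] is - index_tensor [2, 0] is]] ! b ! l" for b l "is"
  have "slots_span 3 3 (\<lambda>_. {..<3}) w"
    unfolding slots_span_def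
  proof
    fix T :: "nat list \<Rightarrow> 'a"
    define u where "u b l i = [
      [[T [0, 1, 0] + T [1, 0, 0] + T [2, 1, 1] + T [2, 2, 0], T [1, 1, 0], T [2, 1, 0]],
       [- T [0, 2, 0] - T [2, 0, 0] - T [2, 2, 1], T [1, 1, 1], - T [2, 2, 0]],
       [T [0, 0, 1] + T [1, 2, 1], T [0, 1, 1] + T [0, 2, 0] + T [1, 0, 1] + T [2, 0, 0] + T [2, 2,
         1],
        T [0, 0, 0] + T [0, 2, 1] + T [1, 1, 1] + T [1, 2, 0] + T [2, 0, 1]]],
      [[T [0, 2, 2] + T [2, 0, 2], T [2, 1, 2], T [2, 2, 2]],
       [T [0, 1, 2] + T [1, 0, 2], T [1, 1, 2], T [0, 0, 2] + T [1, 2, 2]],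
       [T [0, 0, 0] + T [1, 1, 1] + T [1, 2, 0], - T [2, 1, 1] - T [2, 2, 0], - T [2, 2, 1]]],
      [[- T [1, 1, 1] - T [1, 2, 0], - T [1, 2, 1], T [0, 0, 2]],
       [- T [1, 0, 0], T [0, 1, 1] + T [0, 2, 0] + T [2, 0, 0] + T [2, 2, 1], T [0, 1, 2]],
       [- T [2, 0, 0], T [0, 2, 1], T [0, 2, 2]]]] ! b ! l ! i" for b l i :: nat
    have sum3: "(\<Sum>i<3. f i) = f 0 + f 1 + f 2" for f :: "nat \<Rightarrow> 'a"
      by (simp add: numeral_3_eq_3 numeral_2_eq_2)
    have *: "T [i, j, k] = (\<Sum>b<3. \<Sum>l<3. u b l ([i, j, k] ! b) * w b l (delete_nth b [i, j, k]))"
      if "i \<in> {0, 1, 2}" "j \<in> {0, 1, 2}" "k \<in> {0, 1, 2}" for i j k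
      using that unfolding sum3 u_def w_def
      by (auto simp: index_tensor_def delete_nth_def numeral_2_eq_2)
    have "T is = (\<Sum>b<3. \<Sum>l<3. u b l (is ! b) * w b l (delete_nth b is))"
      if mi: "is \<in> multi_indices 3 3" for "is"
    proof -
      have "length is = Suc (Suc (Suc 0))" using mi by (simp add: multi_indices_def)
      then obtain i j k where isE: "is = [i, j, k]" unfolding length_Suc_conv by blast
      have "i < 3" "j < 3" "k < 3" using mi by (simp_all add: multi_indices_def isE)
      then have "i \<in> {0, 1, 2}" "j \<in> {0, 1, 2}" "k \<in> {0, 1, 2}" by auto
      then show ?thesis unfolding isE by (rule *)
    qed
    then show "\<exists>u. \<forall>is\<in>multi_indices 3 3. T is = (\<Sum>b<3. \<Sum>l<3. u b l (is ! b) * w b l (delete_nth b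
      is))"
      by (intro exI[of _ u] ballI)
  qed
  then show ?thesis by blast
qed

text \<open>
  View \<open>K\<^bsup>s t\<^esup>\<close> as \<open>K\<^sup>s \<otimes> K\<^sup>t\<close>, by division with remainder on indices, and tensor \<open>w\<close> with all tensors of
  order \<open>d - 1\<close> over \<open>K\<^sup>t\<close>.
\<close>

lemma slots_span_scale:
  fixes w :: "nat \<Rightarrow> nat \<Rightarrow> nat list \<Rightarrow> 'a::field"
  assumes span: "slots_span d s (\<lambda>_. {..<k}) w" and t: "t > 0"
  shows "\<exists>w' :: nat \<Rightarrow> nat \<Rightarrow> nat list \<Rightarrow> 'a. slots_span d (s * t) (\<lambda>_. {..<k * t ^ (d - 1)}) w'"
proof -
  define w' where "w' b = (\<lambda>(l, a) is. w b l (map (\<lambda>x. x div t) is) * index_tensor a (map (\<lambda>x. x mod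
    t) is))" for b
  have "slots_span d (s * t) (\<lambda>_. {..<k} \<times> multi_indices t (d - 1)) w'"
    unfolding slots_span_def
  proof
    fix T :: "nat list \<Rightarrow> 'a"
    have "\<forall>c. \<exists>u. \<forall>is\<in>multi_indices s d. T (map2 (\<lambda>x y. x * t + y) is c) =
        (\<Sum>b<d. \<Sum>l<k. u b l (is ! b) * w b l (delete_nth b is))"
      by (rule allI, rule span[unfolded slots_span_def, THEN spec])
    from choice[OF this] obtain u
      where "\<forall>c. \<forall>is\<in>multi_indices s d. T (map2 (\<lambda>x y. x * t + y) is c) =
        (\<Sum>b<d. \<Sum>l<k. u c b l (is ! b) * w b l (delete_nth b is))" by (rule exE)
    note u = this[rule_format]
    define u' where "u' b = (\<lambda>(l, a) x. u (take b a @ x mod t # drop b a) b l (x div t))" for b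
    have "T is = (\<Sum>b<d. \<Sum>la\<in>{..<k} \<times> multi_indices t (d - 1). u' b la (is ! b) * w' b la (delete_nth
      b is))"
      if mi: "is \<in> multi_indices (s * t) d" for "is"
    proof -
      define q c where "q = map (\<lambda>x. x div t) is" and "c = map (\<lambda>x. x mod t) is"
      have len: "length is = d" and small: "\<And>x. x \<in> set is \<Longrightarrow> x < s * t" using mi
        by (auto simp: multi_indices_def)
      have q: "q \<in> multi_indices s d"
        using len small by (auto simp: multi_indices_def q_def less_mult_imp_div_less)
      have c: "c \<in> multi_indices t d" using len t by (auto simp: multi_indices_def c_def)
      have "map2 (\<lambda>x y. x * t + y) q c = is"
        by (simp add: q_def c_def zip_map_map zip_same_conv_map map_idI)
      then have "T is = (\<Sum>b<d. \<Sum>l<k. u c b l (q ! b) * w b l (delete_nth b q))" using u[OF q, of c]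
        by simp
      also have "\<dots> = (\<Sum>b<d. \<Sum>la\<in>{..<k} \<times> multi_indices t (d - 1). u' b la (is ! b) * w' b la
        (delete_nth b is))"
      proof (rule sum.cong[OF refl])
        fix b assume "b \<in> {..<d}"
        then have b: "b < d" by simp
        have summand: "u' b (l, a) (is ! b) * w' b (l, a) (delete_nth b is) =
            (if a = delete_nth b c then u c b l (q ! b) * w b l (delete_nth b q) else 0)" for l a
          using b len insert_delete_nth[of b c]
          by (auto simp: u'_def w'_def map_delete_nth index_tensor_def q_def c_def)
        have "(\<Sum>la\<in>{..<k} \<times> multi_indices t (d - 1). u' b la (is ! b) * w' b la (delete_nth b is)) =
            (\<Sum>l<k. \<Sum>a\<in>multi_indices t (d - 1). u' b (l, a) (is ! b) * w' b (l, a) (delete_nth b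
              is))"
          by (simp add: sum.cartesian_product)
        also have "\<dots> = (\<Sum>l<k. u c b l (q ! b) * w b l (delete_nth b q))"
          unfolding summand using delete_nth_multi_indices[OF c b]
            by (simp add: finite_multi_indices)
        finally show "(\<Sum>l<k. u c b l (q ! b) * w b l (delete_nth b q)) =
            (\<Sum>la\<in>{..<k} \<times> multi_indices t (d - 1). u' b la (is ! b) * w' b la (delete_nth b is))" ..
      qed
      finally show ?thesis .
    qed
    then show "\<exists>u. \<forall>is\<in>multi_indices (s * t) d. T is =
        (\<Sum>b<d. \<Sum>l\<in>{..<k} \<times> multi_indices t (d - 1). u b l (is ! b) * w' b l (delete_nth b is))"
      by (intro exI[of _ u'] ballI)
  qed
  moreover have "card (multi_indices t (d - 1)) = t ^ (d - 1)"
    using card_lists_length_eq[of "{..<t}" "d - 1"] by (simp add: multi_indices_def conj_commute)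
  ultimately show ?thesis
    using slots_span_reindex[of d "s * t" "\<lambda>_. {..<k} \<times> multi_indices t (d - 1)" w' "k * t ^ (d -
      1)"]
    by (simp add: finite_multi_indices card_cartesian_product finite_cartesian_product del:
      One_nat_def)
qed

text \<open>
  Expand each slice \<open>T (i # _)\<close> with the given system. In the terms with \<open>l < k'\<close> the
  vector stays where it is, in one of the last \<open>d\<close> slots, and \<open>e\<^sub>i \<otimes> w b l\<close> fills the others. In the
  terms with \<open>k' \<le> l\<close> the coefficients, as functions of \<open>i\<close>, form a vector in the first slot, and the
  product of a unit vector in slot \<open>c\<close> with \<open>w c l\<close> fills the others. The two kinds need \<open>s k'\<close> and \<open>d s (k - k')\<close> tensors per slot.
\<close>

lemma slots_span_Suc:
  fixes w :: "nat \<Rightarrow> nat \<Rightarrow> nat list \<Rightarrow> 'a::field"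
  assumes span: "slots_span d s (\<lambda>_. {..<k}) w" and k': "k' \<le> k"
    and K: "s * k' \<le> K" "d * (s * (k - k')) \<le> K"
  shows "\<exists>w' :: nat \<Rightarrow> nat \<Rightarrow> nat list \<Rightarrow> 'a. slots_span (Suc d) s (\<lambda>_. {..<K}) w'"
proof -
  define S :: "nat \<Rightarrow> (nat \<times> nat \<times> nat) set"
    where "S b = (if b = 0 then {..<d} \<times> {..<s} \<times> {k'..<k} else {0} \<times> {..<s} \<times> {..<k'})" for b
  define w' where "w' b = (\<lambda>(c, j, l) is. if b = 0 then (if is ! c = j then w c l (delete_nth c is)
    else 0)
      else (if hd is = j then w (b - 1) l (tl is) else 0))" for b
  have "slots_span (Suc d) s S w'"
    unfolding slots_span_def
  proof
    fix T :: "nat list \<Rightarrow> 'a"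
    have "\<forall>i. \<exists>u. \<forall>is\<in>multi_indices s d. T (i # is) =
        (\<Sum>b<d. \<Sum>l<k. u b l (is ! b) * w b l (delete_nth b is))"
      by (rule allI, rule span[unfolded slots_span_def, THEN spec])
    from choice[OF this] obtain u where "\<forall>i. \<forall>is\<in>multi_indices s d. T (i # is) =
        (\<Sum>b<d. \<Sum>l<k. u i b l (is ! b) * w b l (delete_nth b is))" by (rule exE)
    note u = this[rule_format]
    define u' where "u' b = (\<lambda>(c, j, l) x. if b = 0 then u x c l j else u j (b - 1) l x)" for b
    have "T is = (\<Sum>b<Suc d. \<Sum>l\<in>S b. u' b l (is ! b) * w' b l (delete_nth b is))"
      if mi: "is \<in> multi_indices s (Suc d)" for "is"
    proof -
      obtain i js where isE: "is = i # js" "i < s" "js \<in> multi_indices s d"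
        using mi unfolding multi_indices_Suc by auto
      have js: "js ! b < s" if "b < d" for b using that isE(3)
        by (auto simp: multi_indices_def subset_iff)
      have "(\<Sum>l\<in>S 0. u' 0 l (is ! 0) * w' 0 l (delete_nth 0 is)) =
          (\<Sum>b<d. \<Sum>j<s. \<Sum>l=k'..<k. if js ! b = j then u i b l j * w b l (delete_nth b js) else 0)"
      proof -
        have "u' 0 x i * w' 0 x js = (case x of (b, j, l) \<Rightarrow>
            if js ! b = j then u i b l j * w b l (delete_nth b js) else 0)" for x
          by (cases x) (simp add: u'_def w'_def)
        then show ?thesis by (simp add: S_def isE(1) sum.cartesian_product case_prod_unfold)
      qed
      also have "\<dots> = (\<Sum>b<d. \<Sum>j<s. if js ! b = j then (\<Sum>l=k'..<k. u i b l j * w b l (delete_nth b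
        js)) else 0)"
        by (intro sum.cong refl) auto
      also have "\<dots> = (\<Sum>b<d. \<Sum>l=k'..<k. u i b l (js ! b) * w b l (delete_nth b js))"
        by (rule sum.cong[OF refl]) (simp add: js)
      finally have 1: "(\<Sum>l\<in>S 0. u' 0 l (is ! 0) * w' 0 l (delete_nth 0 is)) =
          (\<Sum>b<d. \<Sum>l=k'..<k. u i b l (js ! b) * w b l (delete_nth b js))" .
      have 2: "(\<Sum>l\<in>S (Suc b). u' (Suc b) l (is ! Suc b) * w' (Suc b) l (delete_nth (Suc b) is)) =
          (\<Sum>l<k'. u i b l (js ! b) * w b l (delete_nth b js))" for b
      proof -
        have "(\<Sum>l\<in>S (Suc b). u' (Suc b) l (is ! Suc b) * w' (Suc b) l (delete_nth (Suc b) is)) =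
            (\<Sum>j<s. \<Sum>l<k'. if i = j then u j b l (js ! b) * w b l (delete_nth b js) else 0)"
        proof -
          have "u' (Suc b) x (js ! b) * w' (Suc b) x (i # delete_nth b js) = (case x of (c, j, l) \<Rightarrow>
              if i = j then u j b l (js ! b) * w b l (delete_nth b js) else 0)" for x
            by (cases x) (simp add: u'_def w'_def)
          then show ?thesis by (simp add: S_def isE(1) sum.cartesian_product[symmetric])
        qed
        also have "\<dots> = (\<Sum>j<s. if i = j then (\<Sum>l<k'. u j b l (js ! b) * w b l (delete_nth b js)) else
          0)"
          by (intro sum.cong refl) auto
        finally show ?thesis using isE(2) by simp
      qed
      have "T is = (\<Sum>b<d. (\<Sum>l=k'..<k. u i b l (js ! b) * w b l (delete_nth b js)) +
          (\<Sum>l<k'. u i b l (js ! b) * w b l (delete_nth b js)))"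
      proof -
        have split: "{..<k} = {k'..<k} \<union> {..<k'}" using k' by auto
        have "sum f {..<k} = sum f {k'..<k} + sum f {..<k'}" for f :: "nat \<Rightarrow> 'a"
          unfolding split by (rule sum.union_disjoint) auto
        then show ?thesis using u[OF isE(3), of i] unfolding isE(1) by simp
      qed
      then show ?thesis unfolding sum.lessThan_Suc_shift 1 2 by (simp add: sum.distrib)
    qed
    then show "\<exists>u. \<forall>is\<in>multi_indices s (Suc d). T is =
        (\<Sum>b<Suc d. \<Sum>l\<in>S b. u b l (is ! b) * w' b l (delete_nth b is))"
      by (intro exI[of _ u'] ballI)
  qed
  then show ?thesis
  proof (rule slots_span_reindex)
    fix b
    show "finite (S b)" by (simp add: S_def)
    show "card (S b) \<le> K" using K by (simp add: S_def card_cartesian_product)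
  qed
qed

text \<open>
  The two numbers in the previous lemma agree for \<open>k' = d k / (d + 1)\<close>, and then the optimal ratio
  \<open>k = s\<^bsup>d-1\<^esup> / d\<close> is preserved. The factor \<open>fact d\<close> in the size makes all divisions exact.
\<close>

lemma slots_span_exists:
  assumes "d \<ge> 3"
  shows "\<exists>w :: nat \<Rightarrow> nat \<Rightarrow> nat list \<Rightarrow> 'a::field.
    slots_span d (3 * fact d) (\<lambda>_. {..<(3 * fact d) ^ (d - 1) div d}) w"
proof -
  let ?s = "3 * fact d :: nat"
  have "\<exists>w :: nat \<Rightarrow> nat \<Rightarrow> nat list \<Rightarrow> 'a. slots_span e ?s (\<lambda>_. {..<?s ^ (e - 1) div e}) w"
    if "e \<ge> 3" "e \<le> d" for e
    using that
  proof (induction e rule: dec_induct)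
    case base
    have "?s ^ (3 - 1) div 3 = 3 * fact d ^ (3 - 1)" by (simp add: power2_eq_square)
    then show ?case using slots_span_scale[of 3 3 3 _ "fact d"] slots_span_3_3
      by (metis fact_gt_zero)
  next
    case (step e)
    let ?q = "?s ^ (e - 1)"
    have "e dvd fact d" "Suc e dvd fact d" using step by (auto intro!: dvd_fact)
    then have "e dvd ?s" "Suc e dvd ?s" by (auto intro: dvd_mult)
    moreover have "?s dvd ?q" using step(1) by (intro dvd_power) simp
    ultimately have dvd: "e dvd ?q" "Suc e dvd ?q" by (blast intro: dvd_trans)+
    obtain a where a: "?q = Suc e * a" using dvd(2) by blast
    have "e dvd a" using dvd(1) a
      by (metis coprime_Suc_right_nat coprime_commute coprime_dvd_mult_right_iff)
    then obtain b where b: "a = e * b" by blast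
    have e: "e > 0" using step(1) by simp
    obtain w :: "nat \<Rightarrow> nat \<Rightarrow> nat list \<Rightarrow> 'a" where w: "slots_span e ?s (\<lambda>_. {..<?q div e}) w"
      using step by auto
    have "?q = e * (Suc e * b)" unfolding a b by (rule mult.left_commute)
    then have k: "?q div e = Suc e * b" using e by (simp only: nonzero_mult_div_cancel_left)
    have "?s ^ (Suc e - 1) = ?s * ?q" using e by (simp add: power_eq_if)
    also have "\<dots> = Suc e * (?s * (e * b))" unfolding a b by (rule mult.left_commute)
    finally have K: "?s ^ (Suc e - 1) div Suc e = ?s * (e * b)"
      by (simp only: nonzero_mult_div_cancel_left)
    show ?case
      unfolding K
    proof (rule slots_span_Suc[OF w])
      show "e * b \<le> ?q div e" unfolding k by simp
      show "?s * (e * b) \<le> ?s * (e * b)" ..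
      have "?q div e - e * b = b" unfolding k by simp
      then show "e * (?s * (?q div e - e * b)) \<le> ?s * (e * b)" by simp
    qed
  qed
  from this[OF assms order_refl] show ?thesis .
qed

section \<open>Generic slot systems for all sets of blocks\<close>

text \<open>
  Spanning by finitely many vectors that depend polynomially on \<open>w\<close>, in the form required for the
  openness of spanning.
\<close>

lemma slots_span_iff:
  fixes w :: "nat \<Rightarrow> nat \<Rightarrow> nat list \<Rightarrow> 'a::field"
  shows "slots_span d s (\<lambda>_. {..<k}) w \<longleftrightarrow> (\<forall>T. \<exists>c. \<forall>is\<in>multi_indices s d.
     T is = (\<Sum>j\<in>{..<d} \<times> {..<s} \<times> {..<k}.
       c j * (case j of (b, i, l) \<Rightarrow> if is ! b = i then w b l (delete_nth b is) else 0)))"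
proof -
  have sum: "(\<Sum>j\<in>{..<d} \<times> {..<s} \<times> {..<k}.
        c j * (case j of (b, i, l) \<Rightarrow> if is ! b = i then w b l (delete_nth b is) else 0)) =
      (\<Sum>b<d. \<Sum>l<k. c (b, is ! b, l) * w b l (delete_nth b is))"
    if "is \<in> multi_indices s d" for c :: "nat \<times> nat \<times> nat \<Rightarrow> 'a" and "is"
  proof -
    have small: "is ! b < s" if "b < d" for b
      using that \<open>is \<in> multi_indices s d\<close> by (auto simp: multi_indices_def subset_iff)
    have "(\<Sum>j\<in>{..<d} \<times> {..<s} \<times> {..<k}.
        c j * (case j of (b, i, l) \<Rightarrow> if is ! b = i then w b l (delete_nth b is) else 0)) =
      (\<Sum>b<d. \<Sum>i<s. \<Sum>l<k. c (b, i, l) * (if is ! b = i then w b l (delete_nth b is) else 0))"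
      by (simp add: sum.cartesian_product case_prod_unfold)
    also have "\<dots> = (\<Sum>b<d. \<Sum>i<s. if is ! b = i then (\<Sum>l<k. c (b, i, l) * w b l (delete_nth b is))
      else 0)"
      by (intro sum.cong refl) simp
    also have "\<dots> = (\<Sum>b<d. \<Sum>l<k. c (b, is ! b, l) * w b l (delete_nth b is))"
      by (rule sum.cong[OF refl]) (simp add: small)
    finally show ?thesis .
  qed
  show ?thesis
  proof
    assume span: "slots_span d s (\<lambda>_. {..<k}) w"
    show "\<forall>T. \<exists>c. \<forall>is\<in>multi_indices s d.
     T is = (\<Sum>j\<in>{..<d} \<times> {..<s} \<times> {..<k}.
       c j * (case j of (b, i, l) \<Rightarrow> if is ! b = i then w b l (delete_nth b is) else 0))"
    proof
      fix T
      obtain u where u: "\<forall>is\<in>multi_indices s d. T is = (\<Sum>b<d. \<Sum>l<k. u b l (is ! b) * w b l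
        (delete_nth b is))"
        using span[unfolded slots_span_def, THEN spec, of T] by (rule exE)
      show "\<exists>c. \<forall>is\<in>multi_indices s d. T is = (\<Sum>j\<in>{..<d} \<times> {..<s} \<times> {..<k}.
          c j * (case j of (b, i, l) \<Rightarrow> if is ! b = i then w b l (delete_nth b is) else 0))"
        by (rule exI[of _ "\<lambda>(b, i, l). u b l i"]) (use u in \<open>simp add: sum\<close>)
    qed
  next
    assume *: "\<forall>T. \<exists>c. \<forall>is\<in>multi_indices s d.
     T is = (\<Sum>j\<in>{..<d} \<times> {..<s} \<times> {..<k}.
       c j * (case j of (b, i, l) \<Rightarrow> if is ! b = i then w b l (delete_nth b is) else 0))"
    show "slots_span d s (\<lambda>_. {..<k}) w"
      unfolding slots_span_def
    proof
      fix T
      obtain c where c: "\<forall>is\<in>multi_indices s d. T is = (\<Sum>j\<in>{..<d} \<times> {..<s} \<times> {..<k}.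
          c j * (case j of (b, i, l) \<Rightarrow> if is ! b = i then w b l (delete_nth b is) else 0))"
        using *[THEN spec, of T] by (rule exE)
      show "\<exists>u. \<forall>is\<in>multi_indices s d. T is = (\<Sum>b<d. \<Sum>l<k. u b l (is ! b) * w b l (delete_nth b
        is))"
        by (rule exI[of _ "\<lambda>b l i. c (b, i, l)"]) (use c in \<open>simp add: sum\<close>)
    qed
  qed
qed

lemma set_delete_nth_distinct:
  assumes "distinct xs" "b < length xs"
  shows "set (delete_nth b xs) = set xs - {xs ! b}"
proof -
  have "distinct (take b xs @ xs ! b # drop (Suc b) xs)" "set xs = set (take b xs @ xs ! b # drop
    (Suc b) xs)"
    using assms id_take_nth_drop[OF assms(2)] by simp_all
  then show ?thesis by (auto simp: delete_nth_def)
qed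

lemma inj_on_delete_nth:
  assumes "distinct xs"
  shows "inj_on (\<lambda>b. delete_nth b xs) {..<length xs}"
proof (rule inj_onI)
  fix a b assume ab: "a \<in> {..<length xs}" "b \<in> {..<length xs}"
    and eq: "delete_nth a xs = delete_nth b xs"
  have "set xs - {xs ! a} = set xs - {xs ! b}"
    using arg_cong[OF eq, of set] ab by (simp add: set_delete_nth_distinct[OF assms])
  moreover have "xs ! a \<in> set xs" "xs ! b \<in> set xs" using ab by auto
  ultimately have "xs ! a = xs ! b" by blast
  then show "a = b" using assms ab by (simp add: nth_eq_iff_index_eq)
qed

text \<open>
  For a single list \<open>A\<close> of distinct blocks, \<open>W\<close> can be chosen to agree with the given system, because
  deleting different entries of \<open>A\<close> leaves different lists. By openness the values of \<open>W\<close> that are good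
  for \<open>A\<close> contain a nonempty open set, and finitely many of these have a common point.
\<close>

lemma slots_span_simultaneously:
  fixes w :: "nat \<Rightarrow> nat \<Rightarrow> nat list \<Rightarrow> 'a::alg_closed_field"
  assumes span: "slots_span d s (\<lambda>_. {..<k}) w"
  shows "\<exists>W :: nat list \<Rightarrow> nat \<Rightarrow> nat list \<Rightarrow> 'a. \<forall>A\<in>{A \<in> multi_indices m d. distinct A}.
    slots_span d s (\<lambda>_. {..<k}) (\<lambda>b. W (delete_nth b A))"
proof -
  let ?\<A> = "{A \<in> multi_indices m d. distinct A}"
  let ?J = "{..<d} \<times> {..<s} \<times> {..<k}"
  let ?good = "\<lambda>A x. slots_span d s (\<lambda>_. {..<k}) (\<lambda>b l is. x (delete_nth b A, l, is))"
  have open_cond: "\<exists>q. q \<in> polyfun UNIV \<and> (\<exists>x. q x \<noteq> 0) \<and> (\<forall>x :: nat list \<times> nat \<times> nat list \<Rightarrow> 'a. q x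
    \<noteq> 0 \<longrightarrow> ?good A x)"
    if A: "A \<in> ?\<A>" for A
  proof -
    define v where "v = (\<lambda>(b, i, l) (x :: nat list \<times> nat \<times> nat list \<Rightarrow> 'a) is.
      if is ! b = i then x (delete_nth b A, l, delete_nth b is) else 0)"
    \<comment> \<open>the given system, read off from the list of blocks with the slot deleted\<close>
    define x0 where "x0 = (\<lambda>(B, l, is). w (inv_into {..<d} (\<lambda>b. delete_nth b A) B) l is)"
    have good: "?good A x \<longleftrightarrow> (\<forall>T. \<exists>c. \<forall>is\<in>multi_indices s d. T is = (\<Sum>j\<in>?J. c j * v j x is))" for x
      unfolding slots_span_iff v_def by (simp add: case_prod_unfold)
    have inj: "inj_on (\<lambda>b. delete_nth b A) {..<d}"
      using A inj_on_delete_nth[of A] by (auto simp: multi_indices_def)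
    have "(\<Sum>b<d. \<Sum>l<k. u b l (is ! b) * x0 (delete_nth b A, l, delete_nth b is)) =
        (\<Sum>b<d. \<Sum>l<k. u b l (is ! b) * w b l (delete_nth b is))" for u "is"
      by (rule sum.cong[OF refl]) (simp add: x0_def inv_into_f_f[OF inj])
    then have "?good A x0" using span unfolding slots_span_def by simp
    then have spans: "\<exists>c. \<forall>is\<in>multi_indices s d. T is = (\<Sum>j\<in>?J. c j * v j x0 is)" for T
      unfolding good by (rule spec)
    have "(\<lambda>x. v j x is) \<in> polyfun UNIV" for j "is"
      by (cases j) (auto simp: v_def intro!: polyfun_if polyfun.coord polyfun.const)
    from spanning_open[of "multi_indices s d" ?J v UNIV x0, OF finite_multi_indices _ this spans]
    obtain q where "q \<in> polyfun UNIV"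
      "q x0 \<noteq> 0 \<and> (\<forall>x. q x \<noteq> 0 \<longrightarrow> (\<forall>T. \<exists>c. \<forall>is\<in>multi_indices s d. T is = (\<Sum>j\<in>?J. c j * v j x is)))"
      by (auto simp del: split_paired_All)
    then show ?thesis unfolding good by (elim conjE) (intro exI[of _ q] conjI exI[of _ x0])
  qed
  then have "\<forall>A\<in>?\<A>. \<exists>q. q \<in> polyfun UNIV \<and> (\<exists>x. q x \<noteq> 0) \<and>
    (\<forall>x :: nat list \<times> nat \<times> nat list \<Rightarrow> 'a. q x \<noteq> 0 \<longrightarrow> ?good A x)" by (rule ballI)
  from bchoice[OF this] obtain q where *: "\<forall>A\<in>?\<A>. q A \<in> polyfun UNIV \<and> (\<exists>x. q A x \<noteq> 0) \<and>
    (\<forall>x :: nat list \<times> nat \<times> nat list \<Rightarrow> 'a. q A x \<noteq> 0 \<longrightarrow> ?good A x)" by (rule exE)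
  note q = *[rule_format, THEN conjunct1] *[rule_format, THEN conjunct2, THEN conjunct1]
    *[THEN bspec, THEN conjunct2, THEN conjunct2, rule_format]
  have fin: "finite ?\<A>" by (simp add: finite_multi_indices)
  obtain x where "(\<Prod>A\<in>?\<A>. q A x) \<noteq> 0" using polyfun_prod_nonzero[of ?\<A> q, OF fin q(1,2)] by blast
  then have "?good A x" if "A \<in> ?\<A>" for A using q(3)[OF that] fin that by auto
  then show ?thesis by (intro exI[of _ "\<lambda>B l is. x (B, l, is)"] ballI)
qed

section \<open>Products of linear forms with a small space of forms\<close>

lemma sym_relations_if_sym_coord_eq:
  assumes "S \<in> tensors n d" "T \<in> tensors n d" "sym_coord S = sym_coord T"
  shows "S - T \<in> sym_relations n d"
  using sym_class_eq_iff[OF assms(1,2)] sym_class_eq_iff_coords[OF assms(1,2)] assms(3) by simp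

lemma mset_delete_nth: "b < length xs \<Longrightarrow> mset (xs ! b # delete_nth b xs) = mset xs"
  using arg_cong[OF id_take_nth_drop, of b xs mset] by (simp add: delete_nth_def)

text \<open>
  In the symmetric power the slot of a factor is immaterial.
\<close>

lemma cons_tensor_rotate:
  assumes b: "b \<le> e" and v: "v \<in> Kn r" and w: "w \<in> tensors r e"
  shows "(\<lambda>is. if is \<in> multi_indices r (Suc e) then v (is ! b) * w (delete_nth b is) else 0) -
    cons_tensor v w
    \<in> sym_relations r (Suc e)" (is "?X - _ \<in> _")
proof (rule sym_relations_if_sym_coord_eq)
  show "?X \<in> tensors r (Suc e)" by (simp add: tensors_def)
  show C: "cons_tensor v w \<in> tensors r (Suc e)" by (rule cons_tensor_in_tensors[OF v w])
  show "sym_coord ?X = sym_coord (cons_tensor v w)"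
  proof
    fix "is"
    show "sym_coord ?X is = sym_coord (cons_tensor v w) is"
    proof (cases "is \<in> multi_indices r (Suc e)")
      case True
      let ?A = "{js. mset js = mset is}"
      let ?f = "\<lambda>js. js ! b # delete_nth b js"
      have len: "length js = Suc e" if "js \<in> ?A" for js
        using that True mset_eq_length[of js "is"] by (simp add: multi_indices_def)
      have inj: "inj_on ?f ?A"
      proof (rule inj_onI)
        fix xs ys assume *: "xs \<in> ?A" "ys \<in> ?A" "?f xs = ?f ys"
        have "b < length xs" "b < length ys" using len[OF *(1)] len[OF *(2)] b by simp_all
        moreover have "xs ! b = ys ! b" "delete_nth b xs = delete_nth b ys" using *(3) by simp_all
        ultimately show "xs = ys" by (metis insert_delete_nth)
      qed
      have "?f ` ?A \<subseteq> ?A"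
      proof
        fix ks assume "ks \<in> ?f ` ?A"
        then obtain js where js: "js \<in> ?A" "ks = ?f js" by blast
        then have "mset ks = mset js" using mset_delete_nth[of b js] len[OF js(1)] b by simp
        then show "ks \<in> ?A" using js(1) by simp
      qed
      then have "?f ` ?A = ?A" using endo_inj_surj[OF finite_same_mset _ inj] by blast
      then have "bij_betw ?f ?A ?A" using inj by (simp add: bij_betw_def)
      from sum.reindex_bij_betw[OF this, of "cons_tensor v w"]
      have "sym_coord (cons_tensor v w) is = (\<Sum>js\<in>?A. v (js ! b) * w (delete_nth b js))"
        by (simp add: sym_coord_def cons_tensor_def)
      also have "\<dots> = sym_coord ?X is"
        unfolding sym_coord_def
      proof (rule sum.cong[OF refl])
        fix js assume "js \<in> ?A"
        then have "js \<in> multi_indices r (Suc e)" using True mset_multi_indices[of js "is" r "Suc e"]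
          by simp
        then show "v (js ! b) * w (delete_nth b js) = ?X js" by simp
      qed
      finally show ?thesis ..
    next
      case False
      have X: "?X \<in> tensors r (Suc e)" by (simp add: tensors_def)
      show ?thesis unfolding sym_coord_outside[OF X False] sym_coord_outside[OF C False] ..
    qed
  qed
qed

text \<open>
  Index \<open>x < m * s\<close> is the entry \<open>x mod s\<close> of block \<open>x div s\<close>; a tensor of order \<open>e\<close> over \<open>K\<^sup>s\<close> is placed
  into the blocks listed in \<open>B\<close>.
\<close>

definition block_embed :: "nat \<Rightarrow> nat \<Rightarrow> nat \<Rightarrow> nat list \<Rightarrow> (nat list \<Rightarrow> 'a::field) \<Rightarrow> nat list \<Rightarrow> 'a"
  where
  "block_embed m s e B f is =
    (if is \<in> multi_indices (m * s) e \<and> map (\<lambda>x. x div s) is = B then f (map (\<lambda>x. x mod s) is) else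
      0)"

text \<open>
  \<open>Inl (B, l)\<close> stands for the \<open>l\<close>-th tensor of the system placed into the blocks \<open>B\<close>, and \<open>Inr is\<close> for a
  monomial that uses a block more than once.
\<close>

definition block_generators :: "nat \<Rightarrow> nat \<Rightarrow> nat \<Rightarrow> nat \<Rightarrow> ((nat list \<times> nat) + nat list) set" where
  "block_generators m s e k = Inl ` ({B \<in> multi_indices m e. sorted B \<and> distinct B} \<times> {..<k}) \<union>
     Inr ` {is \<in> multi_indices (m * s) e. \<not> distinct (map (\<lambda>x. x div s) is)}"

lemma finite_block_generators: "finite (block_generators m s e k)"
  unfolding block_generators_def by (simp add: finite_multi_indices)

lemma sorted_delete_nth: "\<lbrakk>sorted xs; b < length xs\<rbrakk> \<Longrightarrow> sorted (delete_nth b xs)"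
  by (subst (asm) id_take_nth_drop[of b xs]) (auto simp: delete_nth_def sorted_append)

lemma distinct_delete_nth: "\<lbrakk>distinct xs; b < length xs\<rbrakk> \<Longrightarrow> distinct (delete_nth b xs)"
  by (subst (asm) id_take_nth_drop[of b xs]) (auto simp: delete_nth_def)

text \<open>
  With a third entry available, one can be deleted while a repeated pair is kept.
\<close>

lemma not_distinct_delete_nth:
  assumes "\<not> distinct xs" "length xs \<ge> 3"
  shows "\<exists>b<length xs. \<not> distinct (delete_nth b xs)"
proof -
  obtain as bs cs y where xs: "xs = as @ [y] @ bs @ [y] @ cs"
    using not_distinct_decomp[OF assms(1)] by blast
  consider (a) a as' where "as = a # as'" | (b) c bs' where "bs = c # bs'" "as = []" | (c) c cs'
    where "cs = c # cs'" "as = []" "bs = []"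
    using assms(2) xs by (cases as; cases bs; cases cs) auto
  then show ?thesis
  proof cases
    case a
    then show ?thesis unfolding xs by (intro exI[of _ 0]) (auto simp: delete_nth_def)
  next
    case b
    then show ?thesis unfolding xs by (intro exI[of _ 1]) (auto simp: delete_nth_def)
  next
    case c
    then show ?thesis unfolding xs by (intro exI[of _ 2]) (auto simp: delete_nth_def)
  qed
qed

text \<open>
  A monomial of degree \<open>e + 1\<close> with a repeated block is a variable times a monomial of degree \<open>e\<close> that
  still has a repeated block. All other monomials can be sorted by blocks, and then they lie in a
  product of \<open>e + 1\<close> distinct blocks, where the system for these blocks applies.
\<close>

theorem products_span_blocks:
  fixes W :: "nat list \<Rightarrow> nat \<Rightarrow> nat list \<Rightarrow> 'a::field"
  assumes W: "\<And>A. A \<in> multi_indices m (Suc e) \<Longrightarrow> distinct A \<Longrightarrow>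
      slots_span (Suc e) s (\<lambda>_. {..<k}) (\<lambda>b. W (delete_nth b A))"
    and e: "e \<ge> 2" and s: "s > 0"
  shows "products_span (m * s) e (block_generators m s e k)
    (case_sum (\<lambda>(B, l). block_embed m s e B (W B l)) index_tensor)"
proof -
  define r d K where "r = m * s" and "d = Suc e" and "K = block_generators m s e k"
  define w where "w = case_sum (\<lambda>(B, l). block_embed m s e B (W B l)) index_tensor"
  have wt: "w j \<in> tensors r e" if "j \<in> K" for j
    using that by (auto simp: w_def K_def block_generators_def tensors_def block_embed_def
      index_tensor_def r_def)
  \<comment> \<open>the tensors that are sums of products, up to symmetry\<close>
  define Rep where "Rep T \<longleftrightarrow> (\<exists>l. (\<forall>j\<in>K. l j \<in> Kn r) \<and> T - (\<Sum>j\<in>K. cons_tensor (l j) (w j)) \<in>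
    sym_relations r d)"
    for T
  have finK: "finite K" unfolding K_def by (rule finite_block_generators)
  have Rep_lin: "Rep (fscale a S + T)" if ST: "Rep S" "Rep T" for a S T
  proof -
    obtain l l' where l: "\<forall>j\<in>K. l j \<in> Kn r" "S - (\<Sum>j\<in>K. cons_tensor (l j) (w j)) \<in> sym_relations r
      d"
      and l': "\<forall>j\<in>K. l' j \<in> Kn r" "T - (\<Sum>j\<in>K. cons_tensor (l' j) (w j)) \<in> sym_relations r d"
      using ST unfolding Rep_def by blast
    let ?l = "\<lambda>j. fscale a (l j) + l' j"
    have "cons_tensor (?l j) (w j) = fscale a (cons_tensor (l j) (w j)) + cons_tensor (l' j) (w j)"
      for j
      by (rule ext) (simp add: cons_tensor_def fscale_def algebra_simps split: list.split)
    then have "(\<Sum>j\<in>K. cons_tensor (?l j) (w j)) =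
        fscale a (\<Sum>j\<in>K. cons_tensor (l j) (w j)) + (\<Sum>j\<in>K. cons_tensor (l' j) (w j))"
      by (simp only: sum.distrib fun_vs.scale_sum_right)
    then have "fscale a S + T - (\<Sum>j\<in>K. cons_tensor (?l j) (w j)) =
        fscale a (S - (\<Sum>j\<in>K. cons_tensor (l j) (w j))) + (T - (\<Sum>j\<in>K. cons_tensor (l' j) (w j)))"
      by (simp only: fun_vs.scale_right_diff_distrib add_diff_add)
    also have "\<dots> \<in> sym_relations r d" by (intro sym_relations_add sym_relations_fscale l(2) l'(2))
    finally show ?thesis unfolding Rep_def using l(1) l'(1)
      by (intro exI[of _ ?l]) (simp add: Kn_def fscale_def)
  qed
  have Rep_rel: "Rep T" if "T \<in> sym_relations r d" for T
  proof -
    have "cons_tensor (\<lambda>_. 0) (w j) = 0" for j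
      by (rule ext) (simp add: cons_tensor_def split: list.split)
    then have "(\<Sum>j\<in>K. cons_tensor (\<lambda>_. 0) (w j)) = 0" by (simp only: sum.neutral_const)
    then have "T - (\<Sum>j\<in>K. cons_tensor (\<lambda>_. 0) (w j)) \<in> sym_relations r d" using that
      by (simp only: diff_0_right)
    then show ?thesis unfolding Rep_def by (intro exI[of _ "\<lambda>_ _. 0"]) (simp add: Kn_def)
  qed
  have Rep_add: "Rep (S + T)" if "Rep S" "Rep T" for S T
    using Rep_lin[OF that, of 1] by (simp only: fun_vs.scale_one)
  have Rep_scale: "Rep (fscale a S)" if "Rep S" for a S
    using Rep_lin[OF that Rep_rel[OF sym_relations_zero], of a] by (simp only: add_0_right)
  have Rep_sum: "Rep (\<Sum>x\<in>A. T x)" if "\<And>x. x \<in> A \<Longrightarrow> Rep (T x)" for A :: "'b set" and T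
    using that
    by (induction A rule: infinite_finite_induct)
      (simp_all only: sum.infinite sum.empty sum.insert not_False_eq_True Rep_rel[OF
        sym_relations_zero] Rep_add insert_iff simp_thms)
  have Rep_equiv: "Rep S" if "S - T \<in> sym_relations r d" "Rep T" for S T
    using Rep_add[OF Rep_rel[OF that(1)] that(2)] by (simp only: diff_add_cancel)
  have Rep_cons: "Rep (cons_tensor v (w j))" if "j \<in> K" "v \<in> Kn r" for v j
  proof -
    let ?l = "\<lambda>i. if i = j then v else (\<lambda>_. 0)"
    have "cons_tensor (?l i) (w i) = (if i = j then cons_tensor v (w j) else 0)" for i
      by (rule ext) (simp add: cons_tensor_def split: list.split)
    then have "(\<Sum>i\<in>K. cons_tensor (?l i) (w i)) = cons_tensor v (w j)"
      using finK that(1) by (simp only: sum.delta if_True)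
    then have "cons_tensor v (w j) - (\<Sum>i\<in>K. cons_tensor (?l i) (w i)) \<in> sym_relations r d"
      using sym_relations_zero by (simp only: diff_self)
    then show ?thesis unfolding Rep_def using that(2) by (intro exI[of _ ?l]) (simp add: Kn_def)
  qed
  have repeated: "Rep (index_tensor is)"
    if mi: "is \<in> multi_indices r d" and nd: "\<not> distinct (map (\<lambda>x. x div s) is)" for "is"
  proof -
    have len: "length is = d" using mi by (simp add: multi_indices_def)
    obtain b where b: "b < d" "\<not> distinct (map (\<lambda>x. x div s) (delete_nth b is))"
      using not_distinct_delete_nth[OF nd] len e by (auto simp: map_delete_nth d_def)
    let ?js = "is ! b # delete_nth b is"
    have mset: "mset is = mset ?js" using mset_delete_nth[of b "is"] b(1) len by simp
    have "delete_nth b is \<in> multi_indices r e" using delete_nth_multi_indices[OF mi b(1)]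
      by (simp add: d_def)
    then have K: "Inr (delete_nth b is) \<in> K" unfolding K_def block_generators_def r_def using b(2)
      by blast
    have "is ! b < r" using mi b(1) by (auto simp: multi_indices_def subset_iff)
    then have "Rep (cons_tensor (basis_vec (is ! b)) (w (Inr (delete_nth b is))))"
      by (intro Rep_cons K basis_vec_in_Kn)
    also have "cons_tensor (basis_vec (is ! b)) (w (Inr (delete_nth b is))) = index_tensor ?js"
      by (rule ext) (auto simp: cons_tensor_def w_def index_tensor_def basis_vec_def split:
        list.split)
    finally show ?thesis by (rule Rep_equiv[OF index_tensor_equiv[OF mset mi]])
  qed
  have spread: "Rep (index_tensor is)"
    if mi: "is \<in> multi_indices r d"
      and A: "sorted (map (\<lambda>x. x div s) is)" "distinct (map (\<lambda>x. x div s) is)" for "is"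
  proof -
    define A C where "A = map (\<lambda>x. x div s) is" and "C = map (\<lambda>x. x mod s) is"
    have len: "length is = d" "length A = d" using mi by (auto simp: multi_indices_def A_def)
    have Am: "A \<in> multi_indices m d"
      using mi by (auto simp: multi_indices_def A_def r_def less_mult_imp_div_less)
    obtain u where u: "\<forall>ks\<in>multi_indices s d. index_tensor C ks =
        (\<Sum>b<d. \<Sum>l<k. u b l (ks ! b) * W (delete_nth b A) l (delete_nth b ks))"
      using W[of A] Am A(2) unfolding slots_span_def d_def A_def by blast
    \<comment> \<open>the vector \<open>u b l\<close> placed into the block in slot \<open>b\<close>\<close>
    define v where "v b l x = (if x < r \<and> x div s = A ! b then u b l (x mod s) else 0)" for b l x
    define X where "X b l ks = (if ks \<in> multi_indices r (Suc e)
        then v b l (ks ! b) * w (Inl (delete_nth b A, l)) (delete_nth b ks) else 0)" for b l ks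
    have vK: "v b l \<in> Kn r" for b l by (simp add: v_def Kn_def)
    have jK: "Inl (delete_nth b A, l) \<in> K" if "b < d" "l < k" for b l
    proof -
      have "sorted (delete_nth b A)" "distinct (delete_nth b A)"
        using A len(2) that(1) unfolding A_def[symmetric]
        by (simp_all add: sorted_delete_nth distinct_delete_nth)
      then show ?thesis using delete_nth_multi_indices[OF Am that(1)] that(2)
        unfolding K_def block_generators_def by (auto simp: d_def)
    qed
    have RX: "Rep (X b l)" if "b < d" "l < k" for b l
    proof (rule Rep_equiv)
      have "b \<le> e" using that(1) by (simp add: d_def)
      from cons_tensor_rotate[OF this vK wt[OF jK[OF that]]]
      show "X b l - cons_tensor (v b l) (w (Inl (delete_nth b A, l))) \<in> sym_relations r d"
        unfolding X_def d_def .
      show "Rep (cons_tensor (v b l) (w (Inl (delete_nth b A, l))))"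
        by (rule Rep_cons[OF jK[OF that] vK])
    qed
    have "index_tensor is = (\<Sum>b<d. \<Sum>l<k. X b l)"
    proof
      fix ks
      show "index_tensor is ks = (\<Sum>b<d. \<Sum>l<k. X b l) ks"
      proof (cases "ks \<in> multi_indices r d \<and> map (\<lambda>x. x div s) ks = A")
        case True
        have lenk: "length ks = d" using True by (simp add: multi_indices_def)
        have Cm: "map (\<lambda>x. x mod s) ks \<in> multi_indices s d" using lenk s
          by (auto simp: multi_indices_def)
        have "X b l ks = u b l (map (\<lambda>x. x mod s) ks ! b) * W (delete_nth b A) l (delete_nth b (map
          (\<lambda>x. x mod s) ks))"
          if b: "b < d" for b l
        proof -
          have "ks ! b < r" using True b by (auto simp: multi_indices_def subset_iff)
          moreover have "ks ! b div s = A ! b" using True b lenk by auto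
          moreover have "delete_nth b ks \<in> multi_indices (m * s) e"
            using delete_nth_multi_indices[of ks r d b] True b by (simp add: d_def r_def)
          moreover have "map (\<lambda>x. x div s) (delete_nth b ks) = delete_nth b A" using True
            by (simp add: map_delete_nth)
          ultimately show ?thesis
            using True b lenk by (simp add: X_def v_def w_def block_embed_def d_def map_delete_nth)
        qed
        then have "(\<Sum>b<d. \<Sum>l<k. X b l) ks = index_tensor C (map (\<lambda>x. x mod s) ks)"
          using u Cm by (simp add: sum_fun_apply)
        also have "\<dots> = index_tensor is ks"
        proof -
          have "ks = is" if "map (\<lambda>x. x mod s) ks = C"
          proof (rule nth_equalityI)
            show "length ks = length is" using lenk len by simp
            fix i assume i: "i < length ks"
            have "ks ! i div s = is ! i div s"
              using True i len lenk unfolding A_def by (metis nth_map)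
            moreover have "ks ! i mod s = is ! i mod s"
              using that i len lenk unfolding C_def by (metis nth_map)
            ultimately show "ks ! i = is ! i" by (metis div_mult_mod_eq)
          qed
          then show ?thesis by (auto simp: index_tensor_def C_def)
        qed
        finally show ?thesis ..
      next
        case False
        then have "ks \<noteq> is" using mi by (auto simp: A_def)
        have "X b l ks = 0" if b: "b < d" for b l
        proof (cases "ks \<in> multi_indices r d")
          case True
          then have lenk: "length ks = d" by (simp add: multi_indices_def)
          have "\<not> (ks ! b div s = A ! b \<and> map (\<lambda>x. x div s) (delete_nth b ks) = delete_nth b A)"
          proof
            assume *: "ks ! b div s = A ! b \<and> map (\<lambda>x. x div s) (delete_nth b ks) = delete_nth b A"
            have "b < length (map (\<lambda>x. x div s) ks)" "b < length A" using lenk len(2) b by simp_all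
            moreover have "map (\<lambda>x. x div s) ks ! b = A ! b" using * lenk b by simp
            moreover have "delete_nth b (map (\<lambda>x. x div s) ks) = delete_nth b A"
              using * by (simp only: map_delete_nth)
            ultimately have "map (\<lambda>x. x div s) ks = A" by (metis insert_delete_nth)
            then show False using False True by simp
          qed
          then show ?thesis by (auto simp: X_def v_def w_def block_embed_def)
        qed (simp add: X_def d_def)
        then show ?thesis using \<open>ks \<noteq> is\<close> by (simp add: sum_fun_apply index_tensor_def)
      qed
    qed
    then show ?thesis using RX by (simp only:) (intro Rep_sum, simp)
  qed
  have idx: "Rep (index_tensor is)" if mi: "is \<in> multi_indices r d" for "is"
  proof (cases "distinct (map (\<lambda>x. x div s) is)")
    case True
    \<comment> \<open>order the factors by their blocks\<close>
    define js where "js = sort_key (\<lambda>x. x div s) is"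
    have js: "mset is = mset js" by (simp add: js_def)
    then have "distinct (map (\<lambda>x. x div s) js)"
      using True by (metis mset_eq_imp_distinct_iff mset_map)
    then have "Rep (index_tensor js)"
      using mi mset_multi_indices[OF js, of r d] by (intro spread) (simp_all add: js_def)
    then show ?thesis by (rule Rep_equiv[OF index_tensor_equiv[OF js mi]])
  next
    case False
    then show ?thesis by (rule repeated[OF mi])
  qed
  have "Rep T" if "T \<in> tensors r d" for T
    by (subst tensor_expand[OF that]) (intro Rep_sum Rep_scale idx)
  then show ?thesis
    using wt unfolding products_span_def Rep_def d_def r_def K_def w_def by blast
qed

section \<open>The number of generators\<close>

lemma card_ascending_lists: "fact e * card {B \<in> multi_indices m e. sorted B \<and> distinct B} \<le> m ^ e"
proof -
  let ?S = "{B \<in> multi_indices m e. sorted B \<and> distinct B}"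
  have "inj_on set ?S"
    by (rule inj_onI, rule sorted_distinct_set_unique) simp_all
  then have "card ?S = card (set ` ?S)" by (simp add: card_image)
  also have "\<dots> \<le> card {X. X \<subseteq> {..<m} \<and> card X = e}"
  proof (rule card_mono)
    show "finite {X. X \<subseteq> {..<m} \<and> card X = e}" by (rule finite_subset[of _ "Pow {..<m}"]) auto
    show "set ` ?S \<subseteq> {X. X \<subseteq> {..<m} \<and> card X = e}"
      by (auto simp: multi_indices_def distinct_card)
  qed
  also have "\<dots> = m choose e" using n_subsets[of "{..<m}" e] by simp
  finally have "fact e * card ?S \<le> fact e * (m choose e)" by simp
  also have "\<dots> \<le> m ^ e" using binomial_fact_pow[of m e] by (simp add: mult.commute)
  finally show ?thesis .
qed

lemma card_multi_indices: "card (multi_indices n d) = n ^ d"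
  using card_lists_length_eq[of "{..<n}" d] by (simp add: multi_indices_def conj_commute)

text \<open>
  If positions \<open>a < b\<close> lie in the same block, then the list is determined by \<open>a\<close>, \<open>b\<close>, the entry at \<open>b\<close>
  modulo \<open>s\<close> and the other entries.
\<close>

lemma card_repeated_block_lists:
  assumes "s > 0"
  shows "card {is \<in> multi_indices (m * s) e. \<not> distinct (map (\<lambda>x. x div s) is)} \<le> e * e * s * (m *
    s) ^ (e - 1)"
proof -
  let ?S = "{is \<in> multi_indices (m * s) e. \<not> distinct (map (\<lambda>x. x div s) is)}"
  let ?R = "{..<e} \<times> {..<e} \<times> {..<s} \<times> multi_indices (m * s) (e - 1)"
  let ?f = "\<lambda>(a, b, y, js). take b js @ (js ! a div s * s + y) # drop b js"
  have "?S \<subseteq> ?f ` ?R"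
  proof
    fix "is" assume S: "is \<in> ?S"
    then have mi: "is \<in> multi_indices (m * s) e" and len: "length is = e"
      by (auto simp: multi_indices_def)
    obtain i j where "i < e" "j < e" "i \<noteq> j" "is ! i div s = is ! j div s"
      using S len by (auto simp: distinct_conv_nth)
    then obtain a b where ab: "a < b" "b < e" "is ! a div s = is ! b div s"
      by (cases i j rule: linorder_cases) auto
    have "delete_nth b is ! a = is ! a" using ab len by (simp add: delete_nth_def nth_append)
    then have "is = ?f (a, b, is ! b mod s, delete_nth b is)"
      using insert_delete_nth[of b "is"] ab len by (simp add: mult.commute)
    moreover have "(a, b, is ! b mod s, delete_nth b is) \<in> ?R"
      using ab assms delete_nth_multi_indices[OF mi ab(2)] by simp
    ultimately show "is \<in> ?f ` ?R" by (rule image_eqI)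
  qed
  then have "card ?S \<le> card (?f ` ?R)" by (intro card_mono) (simp_all add: finite_multi_indices)
  also have "\<dots> \<le> card ?R" by (rule card_image_le) (simp add: finite_multi_indices)
  finally show ?thesis by (simp add: card_cartesian_product card_multi_indices mult.assoc)
qed

text \<open>
  Each of the at most \<open>m\<^sup>e / e!\<close> sets of \<open>e\<close> blocks contributes at most \<open>s\<^sup>e / (e + 1)\<close> generators, so the
  leading term is \<open>(m s)\<^sup>e / (e + 1)!\<close>.
\<close>

lemma card_block_generators:
  assumes "s > 0"
  shows "fact (Suc e) * card (block_generators m s e (s ^ e div Suc e)) \<le>
    (m * s) ^ e + fact (Suc e) * e * e * s * (m * s) ^ (e - 1)"
proof -
  let ?A = "{B \<in> multi_indices m e. sorted B \<and> distinct B}"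
  let ?C = "{is \<in> multi_indices (m * s) e. \<not> distinct (map (\<lambda>x. x div s) is)}"
  let ?k = "s ^ e div Suc e"
  have "card (block_generators m s e ?k) \<le>
      card (Inl ` (?A \<times> {..<?k}) :: ((nat list \<times> nat) + nat list) set) + card (Inr ` ?C :: ((nat
        list \<times> nat) + nat list) set)"
    unfolding block_generators_def by (rule card_Un_le)
  also have "\<dots> \<le> card (?A \<times> {..<?k}) + card ?C"
    by (intro add_mono card_image_le) (simp_all add: finite_multi_indices)
  also have "\<dots> = card ?A * ?k + card ?C" by (simp add: card_cartesian_product)
  finally have "fact (Suc e) * card (block_generators m s e ?k) \<le> fact (Suc e) * (card ?A * ?k +
    card ?C)"
    by (rule mult_left_mono) simp
  also have "\<dots> = (fact e * card ?A) * (Suc e * ?k) + fact (Suc e) * card ?C"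
    by (simp add: algebra_simps)
  also have "\<dots> \<le> m ^ e * s ^ e + fact (Suc e) * (e * e * s * (m * s) ^ (e - 1))"
    by (intro add_mono mult_mono card_ascending_lists card_repeated_block_lists assms
        times_div_less_eq_dividend order_refl) simp_all
  finally show ?thesis by (simp add: power_mult_distrib mult.assoc)
qed

lemma products_span_reindex:
  fixes w :: "'k \<Rightarrow> nat list \<Rightarrow> 'a::field"
  assumes span: "products_span r e K w" and fin: "finite K"
  shows "\<exists>w' :: nat \<Rightarrow> nat list \<Rightarrow> 'a. products_span r e {..<card K} w'"
proof -
  obtain h where h: "bij_betw h {..<card K} K"
    using ex_bij_betw_nat_finite[OF fin] by (auto simp: atLeast0LessThan)
  have "products_span r e {..<card K} (\<lambda>i. w (h i))"
    unfolding products_span_def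
  proof (intro conjI ballI)
    show "w (h i) \<in> tensors r e" if "i \<in> {..<card K}" for i
      using span bij_betwE[OF h] that unfolding products_span_def by blast
    fix T :: "nat list \<Rightarrow> 'a" assume "T \<in> tensors r (Suc e)"
    then obtain l where l: "\<forall>k\<in>K. l k \<in> Kn r"
      "T - (\<Sum>k\<in>K. cons_tensor (l k) (w k)) \<in> sym_relations r (Suc e)"
      using span unfolding products_span_def by blast
    have "(\<Sum>i<card K. cons_tensor (l (h i)) (w (h i))) = (\<Sum>k\<in>K. cons_tensor (l k) (w k))"
      by (rule sum.reindex_bij_betw[OF h])
    then show "\<exists>l. (\<forall>i\<in>{..<card K}. l i \<in> Kn r) \<and>
        T - (\<Sum>i<card K. cons_tensor (l i) (w (h i))) \<in> sym_relations r (Suc e)"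
      using l bij_betwE[OF h] by (intro exI[of _ "\<lambda>i. l (h i)"]) auto
  qed
  then show ?thesis by blast
qed

text \<open>
  The first term on the left is \<open>d! r\<close> with \<open>r = m s\<close>, the others bound \<open>d!\<close> times the number of
  generators, so the condition implies that \<open>n\<close> has room for \<open>r\<close> variables and one more per generator.
\<close>

theorem subrank_locus_lower_bound:
  assumes "d \<ge> 3"
  shows "\<exists>s D. s > 0 \<and> (\<forall>m n. fact d * (m * s) + (m * s) ^ (d - 1) + D * (m * s) ^ (d - 2) \<le> fact d
    * n \<longrightarrow>
    generically n d (subrank_locus n d (m * s) :: (nat list \<Rightarrow> 'a::alg_closed_field) set))"
proof -
  define e s where "e = d - 1" and "s = (3 * fact d :: nat)"
  have d: "d = Suc e" and e: "e \<ge> 2" and s: "s > 0" using assms by (auto simp: e_def s_def)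
  let ?k = "s ^ e div Suc e"
  obtain w :: "nat \<Rightarrow> nat \<Rightarrow> nat list \<Rightarrow> 'a" where w: "slots_span d s (\<lambda>_. {..<?k}) w"
  proof -
    have "(3 * fact d) ^ (d - 1) div d = ?k" using assms by (simp add: s_def e_def)
    then show thesis
      using slots_span_exists[OF assms, where 'a='a] that unfolding s_def[symmetric] by auto
  qed
  have "generically n d (subrank_locus n d (m * s) :: (nat list \<Rightarrow> 'a) set)"
    if le: "fact d * (m * s) + (m * s) ^ (d - 1) + (fact d * e * e * s) * (m * s) ^ (d - 2) \<le> fact d
      * n" for m n
  proof -
    let ?K = "block_generators m s e ?k"
    obtain W :: "nat list \<Rightarrow> nat \<Rightarrow> nat list \<Rightarrow> 'a" where
      W: "\<forall>A\<in>{A \<in> multi_indices m d. distinct A}. slots_span d s (\<lambda>_. {..<?k}) (\<lambda>b. W (delete_nth b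
        A))"
      using slots_span_simultaneously[OF w, of m] by (rule exE)
    have "products_span (m * s) e ?K (case_sum (\<lambda>(B, l). block_embed m s e B (W B l)) index_tensor)"
      using W d by (intro products_span_blocks[OF _ e s]) simp
    then obtain w' :: "nat \<Rightarrow> nat list \<Rightarrow> 'a" where w': "products_span (m * s) e {..<card ?K} w'"
      using products_span_reindex[OF _ finite_block_generators] by blast
    have "fact d * (m * s + card ?K) = fact d * (m * s) + fact d * card ?K" by (rule distrib_left)
    also have "\<dots> \<le> fact d * (m * s) + ((m * s) ^ e + fact d * e * e * s * (m * s) ^ (e - 1))"
      using card_block_generators[OF s, of e m] unfolding d by (rule add_left_mono)
    also have "\<dots> \<le> fact d * n" using le by (simp add: d)
    finally have "m * s + card ?K \<le> n" by simp
    then show ?thesis using generic_unit_if_products_span[OF w'] unfolding d by blast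
  qed
  then show ?thesis using s by blast
qed

section \<open>Asymptotics\<close>

text \<open>
  With \<open>x = (c n) powr (1 / e)\<close> the upper bound says \<open>g n \<le> x\<close>. The lower bound applies to the largest
  multiple of \<open>s\<close> below \<open>(1 - \<epsilon> / 2) x\<close>: the gap of \<open>\<epsilon> / 2 * x\<^sup>e\<close> absorbs the terms of lower order once
  \<open>x\<close> is large.
\<close>

lemma ratio_tendsto_1:
  fixes g :: "nat \<Rightarrow> nat" and c :: nat
  assumes e: "e \<ge> 2" and c: "c > 0" and s: "s > 0"
    and upper: "\<And>n. g n ^ e \<le> c * n"
    and lower: "\<And>m n. c * (m * s) + (m * s) ^ e + D * (m * s) ^ (e - 1) \<le> c * n \<Longrightarrow> m * s \<le> g n"
  shows "(\<lambda>n. real (g n) / (real c * real n) powr (1 / real e)) \<longlonglongrightarrow> 1"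
proof -
  define x where "x n = (real c * real n) powr (1 / real e)" for n
  have xe: "x n ^ e = real c * real n" for n
  proof (cases "n = 0")
    case False
    then have "x n > 0" using c by (simp add: x_def)
    then have "x n ^ e = x n powr real e" by (simp add: powr_realpow)
    also have "\<dots> = real c * real n" unfolding x_def powr_powr using e c by simp
    finally show ?thesis .
  qed (use e in \<open>simp add: x_def\<close>)
  have x0: "x n \<ge> 0" for n by (simp add: x_def)
  have g_le: "real (g n) \<le> x n" for n
  proof -
    have "real (g n) ^ e \<le> x n ^ e"
      unfolding xe using upper[of n] by (metis of_nat_le_iff of_nat_mult of_nat_power)
    then show ?thesis using x0 e by (simp add: power_mono_iff)
  qed
  show ?thesis
    unfolding x_def[symmetric]
  proof (rule LIMSEQ_I)
    fix \<epsilon>0 :: real assume "\<epsilon>0 > 0"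
    define \<epsilon> where "\<epsilon> = min \<epsilon>0 1 / 2"
    have \<epsilon>: "\<epsilon> > 0" "\<epsilon> < 1" "\<epsilon> < \<epsilon>0" using \<open>\<epsilon>0 > 0\<close> by (auto simp: \<epsilon>_def min_def)
    define X where "X = max 1 (max (2 * (real c + real D) / \<epsilon>) (2 * real s / \<epsilon>))"
    have "norm (real (g n) / x n - 1) < \<epsilon>0" if n: "n \<ge> nat \<lceil>X ^ e / real c\<rceil>" for n
    proof -
      have "X ^ e / real c \<le> real n" using n by linarith
      then have "X ^ e \<le> x n ^ e" unfolding xe using c by (simp add: field_simps)
      then have "X \<le> x n" using x0 e by (simp add: X_def power_mono_iff)
      then have x: "x n \<ge> 1" "2 * (real c + real D) / \<epsilon> \<le> x n" "2 * real s / \<epsilon> \<le> x n"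
        by (auto simp: X_def)
      define m where "m = nat \<lfloor>(1 - \<epsilon> / 2) * x n / real s\<rfloor>"
      define r where "r = real (m * s)"
      have pos: "(1 - \<epsilon> / 2) * x n / real s \<ge> 0" using \<epsilon> x0 by simp
      have "real m \<le> (1 - \<epsilon> / 2) * x n / real s" using pos by (simp add: m_def)
      then have r_le: "r \<le> (1 - \<epsilon> / 2) * x n" using s by (simp add: r_def field_simps)
      have "(1 - \<epsilon> / 2) * x n / real s < real m + 1" using pos unfolding m_def by linarith
      then have "(1 - \<epsilon> / 2) * x n < r + real s" using s by (simp add: r_def field_simps)
      moreover have "real s \<le> \<epsilon> / 2 * x n" using x(3) \<epsilon> by (simp add: field_simps)
      ultimately have r_ge: "r \<ge> (1 - \<epsilon>) * x n" by (simp add: algebra_simps)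
      have r0: "r \<ge> 0" by (simp add: r_def)
      have "(1 - \<epsilon> / 2) * x n \<le> 1 * x n" using \<epsilon> x0 by (intro mult_right_mono) auto
      then have rx: "r \<le> x n" using r_le by simp
      have "r ^ e \<le> ((1 - \<epsilon> / 2) * x n) ^ e" using r_le r0 by (rule power_mono)
      also have "\<dots> = (1 - \<epsilon> / 2) ^ e * x n ^ e" by (rule power_mult_distrib)
      also have "\<dots> \<le> (1 - \<epsilon> / 2) ^ 1 * x n ^ e"
        using \<epsilon> x0 e by (intro mult_right_mono power_decreasing) auto
      finally have 1: "r ^ e \<le> (1 - \<epsilon> / 2) * x n ^ e" by simp
      have "real c * r + real D * r ^ (e - 1) \<le> real c * x n ^ (e - 1) + real D * x n ^ (e - 1)"
      proof (intro add_mono mult_left_mono)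
        have "x n ^ 1 \<le> x n ^ (e - 1)" using x(1) e by (intro power_increasing) auto
        then show "r \<le> x n ^ (e - 1)" using rx by simp
        show "r ^ (e - 1) \<le> x n ^ (e - 1)" using rx r0 by (rule power_mono)
      qed auto
      also have "\<dots> = (real c + real D) * x n ^ (e - 1)" by (simp add: distrib_right)
      also have "\<dots> \<le> (\<epsilon> / 2 * x n) * x n ^ (e - 1)"
        using x(2) \<epsilon> x0 by (intro mult_right_mono) (auto simp: field_simps)
      also have "\<dots> = \<epsilon> / 2 * x n ^ e" using e by (simp add: power_eq_if)
      finally have "real c * r + r ^ e + real D * r ^ (e - 1) \<le> x n ^ e" using 1
        by (simp add: algebra_simps)
      then have "real (c * (m * s) + (m * s) ^ e + D * (m * s) ^ (e - 1)) \<le> real (c * n)"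
        unfolding xe r_def by simp
      then have "c * (m * s) + (m * s) ^ e + D * (m * s) ^ (e - 1) \<le> c * n"
        by (simp only: of_nat_le_iff)
      then have "r \<le> real (g n)" unfolding r_def using lower by (simp only: of_nat_le_iff)
      then have "(1 - \<epsilon>) * x n \<le> real (g n)" using r_ge by simp
      then have "1 - \<epsilon> \<le> real (g n) / x n" using x(1) by (simp add: field_simps)
      moreover have "real (g n) / x n \<le> 1" using g_le[of n] x(1) by simp
      ultimately show ?thesis using \<epsilon> by simp
    qed
    then show "\<exists>n0. \<forall>n\<ge>n0. norm (real (g n) / x n - 1) < \<epsilon>0" by blast
  qed
qed

theorem theorem1p2:
  fixes d :: nat
  assumes "\<not> (\<exists>c\<in>{0, 1, 2}. \<exists>k. d = c * char_exponent TYPE('a::alg_closed_field) ^ k)"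
  shows "(\<lambda>n. real (generic_symmetric_subrank TYPE('a) d n) /
            (fact d * real n) powr (1 / (real d - 1))) \<longlonglongrightarrow> 1"
proof -
  have "d \<noteq> c * char_exponent TYPE('a) ^ k" if "c \<in> {0, 1, 2}" for c k using assms that by blast
  from this[of 0 0] this[of 1 0] this[of 2 0] this[of 1]
  have d3: "d \<ge> 3" and notpow: "\<And>k. d \<noteq> char_exponent TYPE('a) ^ k" by auto
  then have d0: "d > 0" by simp
  let ?g = "generic_symmetric_subrank TYPE('a) d"
  have char: "generically n d (subrank_locus n d r :: (nat list \<Rightarrow> 'a) set) \<longleftrightarrow> r \<le> ?g n" for n r
    by (rule generic_subrank_characterization[OF d0]) (rule subrank_locus_upper_bound(1)[OF d0
      notpow])
  have upper: "?g n ^ (d - 1) \<le> fact d * n" for n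
  proof (cases "?g n = 0")
    case False
    have "?g n ^ d \<le> fact d * (?g n * n)"
      by (rule subrank_locus_upper_bound(2)[OF d0 notpow]) (simp add: char)
    then have "?g n * ?g n ^ (d - 1) \<le> ?g n * (fact d * n)"
      using d0 by (simp add: power_eq_if mult.left_commute)
    then show ?thesis using False by simp
  qed (use d3 in \<open>simp add: power_0_left\<close>)
  obtain s D where s: "s > 0"
    and lower: "\<And>m n. fact d * (m * s) + (m * s) ^ (d - 1) + D * (m * s) ^ (d - 2) \<le> fact d * n \<Longrightarrow>
      generically n d (subrank_locus n d (m * s) :: (nat list \<Rightarrow> 'a) set)"
    using subrank_locus_lower_bound[OF d3, where 'a='a] by blast
  have "(\<lambda>n. real (?g n) / (real (fact d) * real n) powr (1 / real (d - 1))) \<longlonglongrightarrow> 1"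
  proof (rule ratio_tendsto_1[OF _ _ s upper])
    show "m * s \<le> ?g n"
      if "fact d * (m * s) + (m * s) ^ (d - 1) + D * (m * s) ^ (d - 1 - 1) \<le> fact d * n" for m n
      using lower[of m n] that char by (simp add: numeral_2_eq_2)
  qed (use d3 in auto)
  then show ?thesis using d3 by (simp add: of_nat_diff)
qed

end
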